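(* Let $\mathcal{N}$ be a Hilbert space of entire functions such that the functions in $\mathcal{N}$ have no common zero in $\mathbb{C}$, and such that (i) for every $\lambda\in\mathbb{C}$ the functional $f\mapsto f(\lambda)$ is bounded on $\mathcal{N}$; (ii) for every $\lambda\in\mathbb{C}\setminus\mathbb{R}$ and $f\in\mathcal{N}$ with $f(\lambda)=0$, one has $\frac{z-\bar\lambda}{z-\lambda}f\in\mathcal{N}$ and $\|\frac{z-\bar\lambda}{z-\lambda}f\|=\|f\|$. Then there exist a zero-free entire function $u$ with $uu^\#\equiv1$ and an HB function $E$ with no real zeros such that $u\mathcal{N}=\mathcal{H}(E)$ and multiplication by $u$ is a unitary map from $\mathcal{N}$ onto $\mathcal{H}(E)$. If in addition either (1) $\mathcal{N}$ is contained in some de Branges space $\mathcal{H}(W)$, or (2) $\mathcal{N}$ is invariant under the backward shift $Lf(z)=\frac{f(z)-f(0)}{z}$ and $\sigma(L|_{\mathcal{N}})=\{0\}$, then $u(z)=e^{i\alpha z}$ for some $\alpha\in\mathbb{R}$. Moreover, if (2) holds then $E$ is regular and $|\alpha|\le\tau(E)$.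
   Context: A Hermite–Biehler (HB) function is an entire function $E$ with $|E(z)|>|E(\bar z)|$ for all $z$ in the upper half-plane $\mathbb{C}_+$. For entire $f$ write $f^\#(z)=\overline{f(\bar z)}$. The de Branges space $\mathcal{H}(E)$ is the Hilbert space of entire functions $f$ with $f/E\in H^2(\mathbb{C}_+)$ and $f^\#/E\in H^2(\mathbb{C}_+)$, with norm $\|f\|^2=\int_{\mathbb{R}}|f(t)/E(t)|^2\,dt$. $E$ is called regular if $1/((z+i)E(z))\in H^2(\mathbb{C}_+)$. For an entire function $f$, $\tau(f)=\limsup_{|z|\to\infty}\frac{\log|f(z)|}{|z|}$ is its exponential type. *)

theory Defs
  imports "HOL-Analysis.Analysis"
begin

definition sharp :: "(complex \<Rightarrow> complex) \<Rightarrow> complex \<Rightarrow> complex" where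
  "sharp f = (\<lambda>z. cnj (f (cnj z)))"

definition H2_upper :: "(complex \<Rightarrow> complex) \<Rightarrow> bool" where
  "H2_upper g \<longleftrightarrow> g holomorphic_on {z. 0 < Im z} \<and>
     (\<exists>C. \<forall>y>0. integrable lborel (\<lambda>x. (cmod (g (Complex x y)))\<^sup>2) \<and>
                 (\<integral>x. (cmod (g (Complex x y)))\<^sup>2 \<partial>lborel) \<le> C)"

definition HB :: "(complex \<Rightarrow> complex) \<Rightarrow> bool" where
  "HB E \<longleftrightarrow> E holomorphic_on UNIV \<and> (\<forall>z. 0 < Im z \<longrightarrow> cmod (E (cnj z)) < cmod (E z))"

definition deBranges :: "(complex \<Rightarrow> complex) \<Rightarrow> (complex \<Rightarrow> complex) set" where
  "deBranges E = {f. f holomorphic_on UNIV \<and> H2_upper (\<lambda>z. f z / E z)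
                     \<and> H2_upper (\<lambda>z. sharp f z / E z)}"

definition deBranges_norm :: "(complex \<Rightarrow> complex) \<Rightarrow> (complex \<Rightarrow> complex) \<Rightarrow> real" where
  "deBranges_norm E f = sqrt (\<integral>t. (cmod (f (complex_of_real t) / E (complex_of_real t)))\<^sup>2 \<partial>lborel)"

definition regular_HB :: "(complex \<Rightarrow> complex) \<Rightarrow> bool" where
  "regular_HB E \<longleftrightarrow> H2_upper (\<lambda>z. 1 / ((z + \<i>) * E z))"

definition exp_type :: "(complex \<Rightarrow> complex) \<Rightarrow> ereal" where
  "exp_type f = Limsup at_infinity (\<lambda>z. ereal (ln (cmod (f z)) / cmod z))"

definition hs_norm :: "((complex \<Rightarrow> complex) \<Rightarrow> (complex \<Rightarrow> complex) \<Rightarrow> complex)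
     \<Rightarrow> (complex \<Rightarrow> complex) \<Rightarrow> real" where
  "hs_norm ip f = sqrt (Re (ip f f))"

definition hilbert_space_entire ::
  "(complex \<Rightarrow> complex) set \<Rightarrow> ((complex \<Rightarrow> complex) \<Rightarrow> (complex \<Rightarrow> complex) \<Rightarrow> complex) \<Rightarrow> bool" where
  "hilbert_space_entire N ip \<longleftrightarrow>
     (\<forall>f\<in>N. f holomorphic_on UNIV) \<and>
     (\<lambda>_. 0) \<in> N \<and>
     (\<forall>f\<in>N. \<forall>g\<in>N. (\<lambda>z. f z + g z) \<in> N) \<and>
     (\<forall>c. \<forall>f\<in>N. (\<lambda>z. c * f z) \<in> N) \<and>
     (\<forall>f\<in>N. \<forall>g\<in>N. \<forall>h\<in>N. ip (\<lambda>z. f z + g z) h = ip f h + ip g h) \<and>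
     (\<forall>c. \<forall>f\<in>N. \<forall>g\<in>N. ip (\<lambda>z. c * f z) g = c * ip f g) \<and>
     (\<forall>f\<in>N. \<forall>g\<in>N. ip g f = cnj (ip f g)) \<and>
     (\<forall>f\<in>N. 0 \<le> Re (ip f f)) \<and>
     (\<forall>f\<in>N. ip f f = 0 \<longrightarrow> f = (\<lambda>_. 0)) \<and>
     (\<forall>F :: nat \<Rightarrow> complex \<Rightarrow> complex. (\<forall>n. F n \<in> N) \<and>
        (\<forall>e>0. \<exists>M. \<forall>m\<ge>M. \<forall>n\<ge>M. hs_norm ip (\<lambda>z. F m z - F n z) < e) \<longrightarrow>
        (\<exists>f\<in>N. (\<lambda>n. hs_norm ip (\<lambda>z. F n z - f z)) \<longlonglongrightarrow> 0))"

definition backshift :: "(complex \<Rightarrow> complex) \<Rightarrow> complex \<Rightarrow> complex" where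
  "backshift f = (\<lambda>z. if z = 0 then deriv f 0 else (f z - f 0) / z)"

definition spectrum_on ::
  "(complex \<Rightarrow> complex) set \<Rightarrow> ((complex \<Rightarrow> complex) \<Rightarrow> real)
    \<Rightarrow> ((complex \<Rightarrow> complex) \<Rightarrow> (complex \<Rightarrow> complex)) \<Rightarrow> complex set" where
  "spectrum_on N nrm T = {\<mu>. \<not> (bij_betw (\<lambda>f. (\<lambda>z. T f z - \<mu> * f z)) N N \<and>
       (\<exists>C. \<forall>f\<in>N. nrm f \<le> C * nrm (\<lambda>z. T f z - \<mu> * f z)))}"

end

theory Submission
  imports Defs "HOL-Complex_Analysis.Complex_Analysis" "HOL-Probability.Sinc_Integral" "HOL-Real_Asymp.Real_Asymp"
begin

text \<open>
  Comparing the reproducing kernels of the subspaces of functions vanishing at \<open>\<i>\<close> and at \<open>-\<i>\<close>,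
  which multiplication by \<open>(z + \<i>) / (z - \<i>)\<close> identifies isometrically, gives
  \<open>2 \<i> (z - cnj w) K w z = Q z cnj (Q w) - P z cnj (P w)\<close> with \<open>P\<close> and \<open>Q\<close> entire.
  Hence \<open>P P\<^sup># = Q Q\<^sup>#\<close>, \<open>P\<close> is zero-free in the closed upper and \<open>Q\<close> in the closed lower half-plane,
  so \<open>P\<^sup># / Q\<close> is a zero-free entire function that is unimodular on the real line. With \<open>u\<close> its
  (normalized) square root, \<open>E = sqrt pi u P\<close> has \<open>E\<^sup>#\<close> proportional to \<open>u Q\<close>, and the space
  \<open>u N\<close> has the reproducing kernel of \<open>\<H>(E)\<close>; equality of the spaces then follows from
  Cauchy's formula for Hardy functions.

  Under either additional hypothesis there is a function \<open>F\<close> without zeros in the upper half-plane such that \<open>F\<close>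
  and \<open>u\<^sup>2 F\<close> both belong to \<open>H\<^sup>2\<close>. Writing \<open>u = exp (\<i> \<gamma>)\<close>, this makes \<open>\<gamma>\<close> a difference of
  functions that grow like functions with positive real part, so \<open>\<gamma>\<close> is linear. For (1) take
  \<open>F = K \<i> / W\<close>; for (2) the difference quotients \<open>(f - f w) / (z - w)\<close> stay in \<open>N\<close> and
  \<open>F = 1 / (u (z + \<i>) E)\<close> works. Regularity and the bound on the type are read off the two functions.
\<close>

section \<open>Hardy space of the upper half-plane\<close>

text \<open>The obstacle is that \<open>N\<close> need not be closed under \<open>sharp\<close>. The
  defect is a zero-free factor: up to a constant, \<open>sharp (K (-\<i>))\<close> is u^2 times
  \<open>K \<i>\<close>, and multiplication by \<open>u\<close> symmetrizes the space. A hypothesis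
  that yields bounds for both \<open>f\<close> and \<open>sharp f\<close> over one denominator
  therefore puts a function and its multiple by u^2 into H^2; this is how the additional hypotheses
  reach \<open>u\<close>. Since \<open>E\<close> has no zeros in the closed upper half-plane,
  quotients by \<open>E\<close> are continuous up to the real line and their boundary values are
  plain restrictions. Cauchy's formula can then be read off rectangles whose bottom side lies on the
  line. The difficulty is at the far sides, where square integrability gives decay only on average.
  H^2 functions are O(1 / sqrt (Im z)), so away from the line the logarithm of the modulus is
  bounded above. Caratheodory's inequality turns this one-sided bound into a growth bound for the
  logarithm itself.\<close>

lemma has_contour_integral_linepath_same_Im_iff:
  assumes "a < b"
  shows "(f has_contour_integral I) (linepath (Complex a c) (Complex b c)) \<longleftrightarrow>
         ((\<lambda>x. f (Complex x c)) has_integral I) {a..b}"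
proof -
  have "(f has_contour_integral I) (linepath (Complex a c) (Complex b c)) \<longleftrightarrow>
        ((\<lambda>x. f (linepath (Complex a c) (Complex b c) x) * (Complex b c - Complex a c)) has_integral I) {0..1}"
    by (subst has_contour_integral_linepath) simp_all
  also have "\<dots> \<longleftrightarrow> ((\<lambda>x. f (Complex (a + (b - a) * x) c) * of_real (b - a)) has_integral I) {0..1}"
    by (intro has_integral_cong arg_cong2[of _ _ _ _ "(*)"] arg_cong[of _ _ f])
       (auto simp: linepath_def complex_eq_iff algebra_simps)
  also have "{0..1} = (\<lambda>x. x / (b - a)) ` {0..b-a}"
    using assms by simp
  also have "((\<lambda>x. f (Complex (a + (b-a) * x) c) * of_real (b-a)) has_integral I) \<dots> \<longleftrightarrow>
             ((\<lambda>x. f (Complex (a + x) c) * of_real (b-a)) has_integral ((b-a) *\<^sub>R I)) {0..b-a}"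
    by (subst has_integral_stretch_real_iff) (use assms in simp_all)
  also have "\<dots> \<longleftrightarrow> ((\<lambda>x. of_real (b-a) * f (Complex x c)) has_integral (b-a) *\<^sub>R I) {a..b}"
    by (subst has_integral_shift_real_ivl_iff[where c = "-a"])
       (simp_all add: scaleR_conv_of_real mult_ac)
  also have "\<dots> \<longleftrightarrow> ((\<lambda>x. f (Complex x c)) has_integral I) {a..b}"
    by (subst has_integral_mult_right_iff) (use assms in \<open>auto simp: scaleR_conv_of_real\<close>)
  finally show ?thesis .
qed

lemma contour_integral_linepath_same_Im:
  assumes "a < b" "(\<lambda>x. f (Complex x c)) integrable_on {a..b}"
  shows "contour_integral (linepath (Complex a c) (Complex b c)) f = integral {a..b} (\<lambda>x. f (Complex x c))"
  using assms has_contour_integral_linepath_same_Im_iff contour_integral_unique integrable_integral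
  by metis

text \<open>The top and left sides are run through backwards, whence the two minus signs; on the
  vertical sides dz = i dy.\<close>

lemma contour_integral_rectpath:
  fixes f :: "complex \<Rightarrow> complex"
  assumes "0 < R" "0 < Y" and cont: "continuous_on (path_image (rectpath (Complex (-R) 0) (Complex R Y))) f"
  shows "contour_integral (rectpath (Complex (-R) 0) (Complex R Y)) f =
    integral {-R..R} (\<lambda>x. f (Complex x 0)) - integral {-R..R} (\<lambda>x. f (Complex x Y))
    + \<i> * integral {0..Y} (\<lambda>y. f (Complex R y)) - \<i> * integral {0..Y} (\<lambda>y. f (Complex (-R) y))"
proof -
  let ?a1 = "Complex (-R) 0" and ?a2 = "Complex R 0" and ?a3 = "Complex R Y" and ?a4 = "Complex (-R) Y"
  have pim: "path_image (rectpath ?a1 ?a3) =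
     closed_segment ?a1 ?a2 \<union> closed_segment ?a2 ?a3 \<union> closed_segment ?a3 ?a4 \<union> closed_segment ?a4 ?a1"
    by (simp add: rectpath_def Let_def path_image_join Un_assoc)
  have c: "continuous_on (closed_segment ?a1 ?a2) f" "continuous_on (closed_segment ?a2 ?a3) f"
    "continuous_on (closed_segment ?a4 ?a3) f" "continuous_on (closed_segment ?a1 ?a4) f"
    "continuous_on (closed_segment ?a3 ?a4) f" "continuous_on (closed_segment ?a4 ?a1) f"
    using cont unfolding pim by (auto elim!: continuous_on_subset simp: closed_segment_commute)
  note i = c[THEN contour_integrable_continuous_linepath]
  have 1: "contour_integral (rectpath ?a1 ?a3) f =
      contour_integral (linepath ?a1 ?a2) f + (contour_integral (linepath ?a2 ?a3) f
     + (contour_integral (linepath ?a3 ?a4) f + contour_integral (linepath ?a4 ?a1) f))"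
    using i by (simp add: rectpath_def Let_def contour_integrable_joinI)
  have h: "(\<lambda>x. f (Complex x y)) integrable_on {-R..R}" if "(\<lambda>x. f x) contour_integrable_on linepath (Complex (-R) y) (Complex R y)" for y
    using that has_contour_integral_linepath_same_Im_iff[of "-R" R f _ y] assms(1)
    unfolding contour_integrable_on_def integrable_on_def by auto
  have 2: "contour_integral (linepath ?a1 ?a2) f = integral {-R..R} (\<lambda>x. f (Complex x 0))"
    by (rule contour_integral_linepath_same_Im) (use assms h i in auto)
  have 3: "contour_integral (linepath ?a3 ?a4) f = - integral {-R..R} (\<lambda>x. f (Complex x Y))"
    by (subst contour_integral_reverse_linepath[OF c(3)[unfolded closed_segment_commute[of ?a4]]], simp, rule contour_integral_linepath_same_Im) (use assms h i in auto)
  have 4: "contour_integral (linepath ?a2 ?a3) f = \<i> * integral {0..Y} (\<lambda>y. f (Complex R y))"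
    by (rule contour_integral_linepath_same_Re) (use assms in auto)
  have 5: "contour_integral (linepath ?a4 ?a1) f = - (\<i> * integral {0..Y} (\<lambda>y. f (Complex (-R) y)))"
    by (subst contour_integral_reverse_linepath[OF c(4)[unfolded closed_segment_commute[of ?a1]]], simp, rule contour_integral_linepath_same_Re) (use assms in auto)
  show ?thesis unfolding 1 2 3 4 5 by simp
qed

lemma interior_closed_upper_half_plane: "interior {z::complex. 0 \<le> Im z} = {z. 0 < Im z}"
  using interior_halfspace_ge[of "\<i>" 0] by (simp add: inner_complex_def)

text \<open>The bottom side lies on the real line, where \<open>g\<close> is only continuous. Hence
  the weak forms of Cauchy's theorem, with differentiability in the interior of the closed
  half-plane alone. A point \<open>w\<close> below the line is outside the rectangle and gives
  0.\<close>

lemma Cauchy_rectangle: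
  fixes g :: "complex \<Rightarrow> complex"
  assumes cont: "continuous_on {z. 0 \<le> Im z} g" and hol: "g holomorphic_on {z. 0 < Im z}"
    and "\<bar>Re w\<bar> < R" "Im w < Y" "Im w \<noteq> 0" "0 < Y"
  defines "h \<equiv> \<lambda>z. g z / (z - w)"
  shows "integral {-R..R} (\<lambda>x. h (Complex x 0)) - integral {-R..R} (\<lambda>x. h (Complex x Y))
    + \<i> * integral {0..Y} (\<lambda>y. h (Complex R y)) - \<i> * integral {0..Y} (\<lambda>y. h (Complex (-R) y))
    = (if 0 < Im w then 2 * pi * \<i> * g w else 0)"
proof -
  let ?r = "rectpath (Complex (-R) 0) (Complex R Y)"
  let ?H = "{z. 0 \<le> Im z}"
  have R: "0 < R" using assms by auto
  have pi: "path_image ?r \<subseteq> ?H - {w}"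
    using R \<open>0 < Y\<close> assms by (auto simp: path_image_rectpath)
  have conv: "convex ?H" by (rule convex_halfspace_Im_ge)
  have fd: "g field_differentiable at x" if "x \<in> interior ?H - {}" for x
    by (rule holomorphic_on_imp_differentiable_at[OF hol open_halfspace_Im_gt])
       (use that interior_closed_upper_half_plane in auto)
  have "(h has_contour_integral (if 0 < Im w then 2 * pi * \<i> * g w else 0)) ?r"
  proof (cases "0 < Im w")
    case True
    have "(h has_contour_integral (2*pi * \<i> * winding_number ?r w * g w)) ?r"
      unfolding h_def
      by (rule Cauchy_integral_formula_weak[OF conv finite.emptyI cont fd])
         (use True pi interior_closed_upper_half_plane in auto)
    moreover have "winding_number ?r w = 1"
      by (rule winding_number_rectpath) (use assms True in \<open>auto simp: in_box_complex_iff\<close>)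
    ultimately show ?thesis using True by simp
  next
    case False
    have "(h has_contour_integral 0) ?r"
    proof (rule Cauchy_theorem_convex[OF _ conv finite.emptyI])
      show "continuous_on ?H h" unfolding h_def
        by (intro continuous_intros cont) (use False assms in auto)
      fix x assume "x \<in> interior ?H - {}"
      with fd[OF this] show "h field_differentiable at x" unfolding h_def
        by (intro derivative_intros) (use False assms interior_closed_upper_half_plane in auto)
    qed (use pi in auto)
    then show ?thesis using False by simp
  qed
  then have "contour_integral ?r h = (if 0 < Im w then 2 * pi * \<i> * g w else 0)"
    by (rule contour_integral_unique)
  moreover have "continuous_on (path_image ?r) h"
    unfolding h_def by (intro continuous_intros continuous_on_subset[OF cont]) (use pi in auto)
  ultimately show ?thesis
    using contour_integral_rectpath[OF R \<open>0 < Y\<close>, of h] by simp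
qed

section \<open>The Poisson kernel and Hardy functions continuous up to the real line\<close>

lemma has_bochner_integral_inverse_1_plus_square:
  "has_bochner_integral lborel (\<lambda>x::real. inverse (1 + x^2)) pi"
  using integrable_inverse_1_plus_square LBINT_inverse_1_plus_square
  by (simp add: has_bochner_integral_iff set_integrable_def interval_lebesgue_integral_def set_lebesgue_integral_def einterval_def)

lemma has_bochner_integral_Poisson:
  assumes "0 < b"
  shows "has_bochner_integral lborel (\<lambda>x::real. 1 / ((x - a)^2 + b^2)) (pi / b)"
proof -
  have i: "integrable lborel (\<lambda>x::real. inverse (1 + x^2))" and j: "(\<integral>x. inverse (1 + x^2) \<partial>lborel) = pi"
    using has_bochner_integral_inverse_1_plus_square by (auto simp: has_bochner_integral_iff)
  define p where "p x = 1 / ((x - a)^2 + b^2)" for x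
  have *: "inverse (1 + (- a / b + 1/b * x)^2) = b^2 * p x" for x
  proof -
    have "1 + (- a / b + 1/b * x)^2 = ((x-a)^2 + b^2) / b^2"
      using assms by (simp add: field_simps power2_eq_square)
    then show ?thesis by (simp add: p_def)
  qed
  have "integrable lborel (\<lambda>x. inverse (1 + (- a / b + 1/b * x)^2))"
    using lborel_integrable_real_affine[OF i, of "1/b" "-a/b"] assms by simp
  then have I: "integrable lborel p"
    unfolding * using assms by simp
  have "pi = \<bar>1/b\<bar> *\<^sub>R (\<integral>x. inverse (1 + (- a / b + 1/b * x)^2) \<partial>lborel)"
    by (subst j[symmetric], rule lborel_integral_real_affine) (use assms in auto)
  then have "pi = b * (\<integral>x. p x \<partial>lborel)"
    unfolding * using assms by (simp add: power2_eq_square)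
  then have "has_bochner_integral lborel p (pi / b)" 
    using I assms by (simp add: has_bochner_integral_iff field_simps)
  then show ?thesis by (simp add: p_def[abs_def])
qed

text \<open>A Hardy function together with its boundary values: the bound covers
  \<open>y = 0\<close>. The integral of nonnegative functions makes integrability part of the bound,
  and the explicit \<open>C\<close> survives limits by Fatou's lemma.\<close>

definition hardy2 :: "(complex \<Rightarrow> complex) \<Rightarrow> real \<Rightarrow> bool" where
  "hardy2 g C \<longleftrightarrow> continuous_on {z. 0 \<le> Im z} g \<and> g holomorphic_on {z. 0 < Im z} \<and> 0 \<le> C \<and>
     (\<forall>y\<ge>0. (\<integral>\<^sup>+x. ennreal ((cmod (g (Complex x y)))\<^sup>2) \<partial>lborel) \<le> ennreal C)"

lemma continuous_on_Complex_horizontal: "continuous_on S (\<lambda>x. Complex x y)"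
  by (intro continuous_intros)

lemma continuous_on_Complex_vertical: "continuous_on S (\<lambda>y. Complex x y)"
  by (intro continuous_intros)

lemma hardy2_continuous_horizontal:
  assumes "hardy2 g C" "0 \<le> y"
  shows "continuous_on S (\<lambda>x. g (Complex x y))"
  using assms unfolding hardy2_def
  by (auto intro!: continuous_on_compose2[OF _ continuous_on_Complex_horizontal])

lemma hardy2_measurable [measurable]:
  assumes "hardy2 g C" "0 \<le> y"
  shows "(\<lambda>x. g (Complex x y)) \<in> borel_measurable borel"
  by (rule borel_measurable_continuous_onI hardy2_continuous_horizontal assms)+

lemma hardy2_square_integrable:
  assumes "hardy2 g C" "0 \<le> y"
  shows "integrable lborel (\<lambda>x. (cmod (g (Complex x y)))\<^sup>2)" "(\<integral>x. (cmod (g (Complex x y)))\<^sup>2 \<partial>lborel) \<le> C"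
proof -
  note [measurable] = hardy2_measurable[OF assms]
  have *: "(\<integral>\<^sup>+x. ennreal ((cmod (g (Complex x y)))\<^sup>2) \<partial>lborel) \<le> ennreal C" and C: "0 \<le> C"
    using assms by (auto simp: hardy2_def)
  show i: "integrable lborel (\<lambda>x. (cmod (g (Complex x y)))\<^sup>2)"
    using order_le_less_trans[OF * ennreal_less_top] by (intro integrableI_bounded) auto
  show "(\<integral>x. (cmod (g (Complex x y)))\<^sup>2 \<partial>lborel) \<le> C"
    using * C by (subst (asm) nn_integral_eq_integral[OF i]) auto
qed

text \<open>By Fubini the squared modulus is integrable over every horizontal strip, so it cannot have
  large integrals over all far away vertical segments. This replaces pointwise bounds in
  the contour argument below.\<close>

lemma hardy2_good_abscissa:
  assumes g: "hardy2 g C" and Y: "0 < Y"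
  obtains R where "R0 \<le> R" and "integral {0..Y} (\<lambda>y. (cmod (g (Complex R y)))\<^sup>2) \<le> 1"
    and "integral {0..Y} (\<lambda>y. (cmod (g (Complex (-R) y)))\<^sup>2) \<le> 1"
proof -
  \<comment> \<open>Cutting off at \<open>max 0 y\<close> makes the integrand continuous on the
    whole plane, hence jointly measurable, though \<open>g\<close> is controlled only on the closed
    half-plane.\<close>
  define G where "G x y = (cmod (g (Complex x (max 0 y))))\<^sup>2" for x y :: real
  define \<phi> where "\<phi> x = (\<integral>\<^sup>+y. ennreal (G x y) * indicator {0..Y} y \<partial>lborel)" for x
  have C: "0 \<le> C" using g by (simp add: hardy2_def)
  have cG: "continuous_on UNIV (\<lambda>p. G (fst p) (snd p))"
    unfolding G_def
    by (intro continuous_intros continuous_on_compose2[of "{z. 0 \<le> Im z}" g UNIV "\<lambda>p. Complex (fst p) (max 0 (snd p))"])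
       (use g in \<open>auto simp: hardy2_def\<close>)
  have mG [measurable]: "(\<lambda>p. G (fst p) (snd p)) \<in> borel_measurable (lborel \<Otimes>\<^sub>M lborel)"
    using borel_measurable_continuous_onI[OF cG] by (simp add: lborel_prod borel_prod)
  have mG' [measurable]: "(\<lambda>p. G (snd p) (fst p)) \<in> borel_measurable (lborel \<Otimes>\<^sub>M lborel)"
    using measurable_pair_swap[OF mG] by (simp add: split_beta)
  have m\<phi> [measurable]: "\<phi> \<in> borel_measurable lborel"
    unfolding \<phi>_def by measurable
  have "(\<integral>\<^sup>+x. \<phi> x \<partial>lborel) = (\<integral>\<^sup>+y. \<integral>\<^sup>+x. ennreal (G x y) * indicator {0..Y} y \<partial>lborel \<partial>lborel)"
    unfolding \<phi>_def by (rule lborel_pair.Fubini') measurable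
  also have "\<dots> \<le> (\<integral>\<^sup>+y. ennreal C * indicator {0..Y} y \<partial>lborel)"
  proof (rule nn_integral_mono)
    fix y :: real
    show "(\<integral>\<^sup>+x. ennreal (G x y) * indicator {0..Y} y \<partial>lborel) \<le> ennreal C * indicator {0..Y} y"
      using g by (cases "y \<in> {0..Y}") (auto simp: G_def hardy2_def)
  qed
  also have "\<dots> = ennreal (C * Y)"
    using C Y by (simp add: nn_integral_cmult ennreal_mult)
  finally have I\<phi>: "(\<integral>\<^sup>+x. \<phi> x \<partial>lborel) \<le> ennreal (C * Y)" .
  have I\<phi>': "(\<integral>\<^sup>+x. \<phi> (-x) \<partial>lborel) \<le> ennreal (C * Y)"
    using I\<phi> nn_integral_real_affine[of \<phi> "-1" 0] by simp
  have "\<exists>R\<ge>R0. \<phi> R + \<phi> (-R) \<le> 1"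
  proof (rule ccontr)
    assume "\<not> ?thesis"
    then have big: "1 \<le> \<phi> R + \<phi> (-R)" if "R \<ge> R0" for R
      using that by (metis linear)
    \<comment> \<open>If every abscissa beyond \<open>R0\<close> were bad, an interval of this
      length would carry more mass than the total \<open>2 * C * Y\<close> available to \<phi> and
      its reflection.\<close>
    define L where "L = 2 * C * Y + 1"
    have L: "0 < L" using C Y by (simp add: L_def add_nonneg_pos)
    have "ennreal L = (\<integral>\<^sup>+x. indicator {R0..R0+L} x \<partial>lborel)"
      using L by simp
    also have "\<dots> \<le> (\<integral>\<^sup>+x. \<phi> x + \<phi> (-x) \<partial>lborel)"
      by (intro nn_integral_mono) (auto simp: indicator_def big)
    also have "\<dots> = (\<integral>\<^sup>+x. \<phi> x \<partial>lborel) + (\<integral>\<^sup>+x. \<phi> (-x) \<partial>lborel)"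
      by (rule nn_integral_add) measurable
    also have "\<dots> \<le> ennreal (C * Y) + ennreal (C * Y)"
      by (intro add_mono I\<phi> I\<phi>')
    also have "\<dots> = ennreal (2 * C * Y)"
      using C Y by (simp flip: ennreal_plus)
    finally show False using C Y by (simp add: L_def)
  qed
  then obtain R where R: "R0 \<le> R" and s: "\<phi> R + \<phi> (-R) \<le> 1" by auto
  have conv: "integral {0..Y} (\<lambda>y. (cmod (g (Complex x y)))\<^sup>2) \<le> 1" if "\<phi> x \<le> 1" for x
  proof -
    have c: "continuous_on {0..Y} (\<lambda>y. (cmod (g (Complex x y)))\<^sup>2)"
      by (intro continuous_intros continuous_on_compose2[OF _ continuous_on_Complex_vertical, of "{z. 0 \<le> Im z}" g])
         (use g in \<open>auto simp: hardy2_def\<close>)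
    have si: "set_integrable lborel {0..Y} (\<lambda>y. (cmod (g (Complex x y)))\<^sup>2)"
      by (rule borel_integrable_atLeastAtMost') (rule c)
    have "\<phi> x = (\<integral>\<^sup>+y. ennreal (indicator {0..Y} y *\<^sub>R (cmod (g (Complex x y)))\<^sup>2) \<partial>lborel)"
      unfolding \<phi>_def by (intro nn_integral_cong) (auto simp: G_def indicator_def)
    also have "\<dots> = ennreal (\<integral>y. indicator {0..Y} y *\<^sub>R (cmod (g (Complex x y)))\<^sup>2 \<partial>lborel)"
      using si by (intro nn_integral_eq_integral) (auto simp: set_integrable_def)
    also have "\<dots> = ennreal (integral {0..Y} (\<lambda>y. (cmod (g (Complex x y)))\<^sup>2))"
      using set_borel_integral_eq_integral(2)[OF si] by (simp add: set_lebesgue_integral_def)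
    finally show ?thesis using that by simp
  qed
  have "\<phi> R \<le> \<phi> R + \<phi> (-R)" "\<phi> (-R) \<le> \<phi> R + \<phi> (-R)" by auto
  then have "\<phi> R \<le> 1" "\<phi> (-R) \<le> 1"
    using s by (blast intro: order_trans)+
  with R conv that show ?thesis by blast
qed

text \<open>Weighted arithmetic-geometric mean inequality for the product of \<open>g\<close> and
  the Cauchy kernel. The weight \<open>t\<close> stays free: at height \<open>s\<^sup>2\<close>
  above \<open>w\<close> the choice \<open>t = 1 / s\<close> makes the bound decay in
  \<open>s\<close>.\<close>

lemma hardy2_Cauchy_kernel_bound:
  assumes g: "hardy2 g C" and y: "0 \<le> y" "y \<noteq> Im w" and t: "0 < t"
  shows "integrable lborel (\<lambda>x. g (Complex x y) / (Complex x y - w))"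
    and "(\<integral>x. cmod (g (Complex x y) / (Complex x y - w)) \<partial>lborel) \<le> (t * C + pi / (\<bar>y - Im w\<bar> * t)) / 2"
proof -
  note [measurable] = hardy2_measurable[OF g y(1)]
  define b where "b = \<bar>y - Im w\<bar>"
  have b: "0 < b" using y by (simp add: b_def)
  note sq = hardy2_square_integrable[OF g y(1)]
  have P: "integrable lborel (\<lambda>x. 1 / ((x - Re w)^2 + b^2))" "(\<integral>x. 1 / ((x - Re w)^2 + b^2) \<partial>lborel) = pi / b"
    using has_bochner_integral_Poisson[OF b, of "Re w"] by (auto simp: has_bochner_integral_iff)
  have nrm: "(cmod (Complex x y - w))\<^sup>2 = (x - Re w)^2 + b^2" for x
    by (simp add: cmod_power2 b_def)
  have bound: "cmod (g (Complex x y) / (Complex x y - w)) \<le>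
     (t * (cmod (g (Complex x y)))\<^sup>2 + (1 / ((x - Re w)^2 + b^2)) / t) / 2" for x
  proof -
    define p q where "p = cmod (g (Complex x y))" and "q = 1 / cmod (Complex x y - w)"
    have "0 \<le> (sqrt t * p - q / sqrt t)\<^sup>2" by simp
    also have "\<dots> = t * p\<^sup>2 + q\<^sup>2 / t - 2 * p * q"
      using t by (simp add: power2_diff power_mult_distrib power_divide)
    finally have "p * q \<le> (t * p\<^sup>2 + q\<^sup>2 / t) / 2" by simp
    moreover have "q\<^sup>2 = 1 / ((x - Re w)^2 + b^2)"
      by (simp add: q_def power_divide nrm)
    ultimately show ?thesis by (simp add: p_def q_def norm_divide)
  qed
  have I: "integrable lborel (\<lambda>x. (t * (cmod (g (Complex x y)))\<^sup>2 + (1 / ((x - Re w)^2 + b^2)) / t) / 2)"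
    by (intro integrable_divide Bochner_Integration.integrable_add integrable_mult_right sq P)
  have m: "(\<lambda>x. g (Complex x y) / (Complex x y - w)) \<in> borel_measurable lborel"
    by (intro borel_measurable_divide)
       (auto intro!: borel_measurable_continuous_onI continuous_intros hardy2_measurable[OF g y(1)])
  show i: "integrable lborel (\<lambda>x. g (Complex x y) / (Complex x y - w))"
    by (rule Bochner_Integration.integrable_bound[OF I m]) (intro AE_I2, use bound in \<open>metis abs_ge_self order_trans real_norm_def\<close>)
  have "(\<integral>x. cmod (g (Complex x y) / (Complex x y - w)) \<partial>lborel) \<le>
     (\<integral>x. (t * (cmod (g (Complex x y)))\<^sup>2 + (1 / ((x - Re w)^2 + b^2)) / t) / 2 \<partial>lborel)"
    by (intro integral_mono integrable_norm i I bound)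
  also have "\<dots> = (t * (\<integral>x. (cmod (g (Complex x y)))\<^sup>2 \<partial>lborel) + (pi / b) / t) / 2"
    using Bochner_Integration.integral_add[OF integrable_mult_right[OF sq(1), of t] integrable_divide[OF P(1), of t]]
    by (simp only: integral_divide_zero integral_mult_right_zero P)
  also have "\<dots> \<le> (t * C + pi / (b * t)) / 2"
    using sq(2) t b by (simp add: field_simps)
  finally show "(\<integral>x. cmod (g (Complex x y) / (Complex x y - w)) \<partial>lborel) \<le> (t * C + pi / (\<bar>y - Im w\<bar> * t)) / 2"
    by (simp add: b_def)
qed

text \<open>On rectangles through good abscissas the vertical sides vanish as the width grows; the
  top side, at height s^2 above \<open>w\<close>, is O(1 / s). The width tends to infinity first,
  then the height.\<close>

theorem hardy2_Cauchy:
  assumes g: "hardy2 g C" and w: "Im w \<noteq> 0"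
  shows "has_bochner_integral lborel (\<lambda>x. g (Complex x 0) / (Complex x 0 - w))
           (if 0 < Im w then 2 * pi * \<i> * g w else 0)"
proof -
  define h where "h z = g z / (z - w)" for z
  define V where "V = (if 0 < Im w then 2 * pi * \<i> * g w else 0)"
  have C: "0 \<le> C" and cg: "continuous_on {z. 0 \<le> Im z} g" and hg: "g holomorphic_on {z. 0 < Im z}"
    using g by (auto simp: hardy2_def)
  have int: "integrable lborel (\<lambda>x. h (Complex x y))" if "0 \<le> y" "y \<noteq> Im w" for y
    using hardy2_Cauchy_kernel_bound(1)[OF g that zero_less_one] by (simp add: h_def)
  have int0: "integrable lborel (\<lambda>x. h (Complex x 0))"
    using int[of 0] w by simp
  have HK: "integral {a..b} (\<lambda>x. h (Complex x y)) = (\<integral>x. indicator {a..b} x *\<^sub>R h (Complex x y) \<partial>lborel)"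
    if "0 \<le> y" "y \<noteq> Im w" for a b y
  proof -
    have si: "set_integrable lborel {a..b} (\<lambda>x. h (Complex x y))"
      unfolding set_integrable_def using int[OF that] by (intro integrable_mult_indicator) auto
    then show ?thesis
      using set_borel_integral_eq_integral(2)[OF si] by (simp add: set_lebesgue_integral_def)
  qed
  define D where "D = cmod ((\<integral>x. h (Complex x 0) \<partial>lborel) - V)"
  \<comment> \<open>The top side will lie \<open>s\<^sup>2\<close> above \<open>w\<close>; the
    second condition keeps it above the real line when \<open>w\<close> is in the lower
    half-plane.\<close>
  have key: "D \<le> (C + pi) / (2 * s)" if s: "0 < s" "0 < Im w + s\<^sup>2" for s
  proof -
    define Y where "Y = Im w + s\<^sup>2"
    have Y: "0 < Y" "Im w < Y" "0 \<le> Y" "Y \<noteq> Im w" using s by (auto simp: Y_def)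
    have "\<exists>R. real n + cmod w + 1 \<le> R \<and> integral {0..Y} (\<lambda>y. (cmod (g (Complex R y)))\<^sup>2) \<le> 1
       \<and> integral {0..Y} (\<lambda>y. (cmod (g (Complex (-R) y)))\<^sup>2) \<le> 1" for n :: nat
      by (rule hardy2_good_abscissa[OF g Y(1)]) blast
    then obtain R where R: "\<And>n. real n + cmod w + 1 \<le> R n"
      "\<And>n. integral {0..Y} (\<lambda>y. (cmod (g (Complex (R n) y)))\<^sup>2) \<le> 1"
      "\<And>n. integral {0..Y} (\<lambda>y. (cmod (g (Complex (- R n) y)))\<^sup>2) \<le> 1"
      by metis
    \<comment> \<open>The kernel is at most \<open>1 / (real n + 1)\<close> on this side, and
      \<open>a \<le> 1 + a\<^sup>2\<close> lets the mean square bound control the integral of the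
      modulus of \<open>g\<close>.\<close>
    have side: "cmod (integral {0..Y} (\<lambda>y. h (Complex X y))) \<le> (Y + 1) / (real n + 1)"
      if X: "real n + cmod w + 1 \<le> \<bar>X\<bar>" and i: "integral {0..Y} (\<lambda>y. (cmod (g (Complex X y)))\<^sup>2) \<le> 1" for X n
    proof -
      have far: "real n + 1 \<le> cmod (Complex X y - w)" for y
        using X abs_Re_le_cmod[of w] abs_Re_le_cmod[of "Complex X y - w"] by simp
      have nz: "Complex X y - w \<noteq> 0" for y
      proof
        assume "Complex X y - w = 0"
        with far[of y] show False by simp
      qed
      have cv: "continuous_on {0..Y} (\<lambda>y. g (Complex X y))"
        by (intro continuous_on_compose2[OF cg continuous_on_Complex_vertical]) auto
      have i2: "(\<lambda>y. (cmod (g (Complex X y)))\<^sup>2) integrable_on {0..Y}"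
        by (intro integrable_continuous_interval continuous_intros cv)
      have "cmod (integral {0..Y} (\<lambda>y. h (Complex X y))) \<le> integral {0..Y} (\<lambda>y. (1 + (cmod (g (Complex X y)))\<^sup>2) / (real n + 1))"
      proof (rule integral_norm_bound_integral)
        show "(\<lambda>y. h (Complex X y)) integrable_on {0..Y}"
          unfolding h_def
          by (intro integrable_continuous_interval continuous_intros cv) (use nz in blast)
        show "(\<lambda>y. (1 + (cmod (g (Complex X y)))\<^sup>2) / (real n + 1)) integrable_on {0..Y}"
          by (intro integrable_continuous_interval continuous_intros cv) auto
        fix y assume "y \<in> {0..Y}"
        have "cmod (g (Complex X y)) \<le> 1 + (cmod (g (Complex X y)))\<^sup>2"
          using sum_power2_ge_zero[of "cmod (g (Complex X y)) - 1" 0] zero_le_power2[of "cmod (g (Complex X y))"]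
          by (simp add: power2_eq_square algebra_simps) (use norm_ge_zero[of "g (Complex X y)"] in linarith)
        then show "cmod (h (Complex X y)) \<le> (1 + (cmod (g (Complex X y)))\<^sup>2) / (real n + 1)"
          unfolding h_def norm_divide by (intro frac_le far) auto
      qed
      also have "\<dots> = (Y + integral {0..Y} (\<lambda>y. (cmod (g (Complex X y)))\<^sup>2)) / (real n + 1)"
        using Y i2 by (simp add: Henstock_Kurzweil_Integration.integral_add integrable_const_ivl)
      also have "\<dots> \<le> (Y + 1) / (real n + 1)"
        using i by (intro divide_right_mono) auto
      finally show ?thesis .
    qed
    have top: "cmod (integral {-R n..R n} (\<lambda>x. h (Complex x Y))) \<le> (C + pi) / (2 * s)" for n
    proof -
      have "cmod (integral {-R n..R n} (\<lambda>x. h (Complex x Y))) \<le>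
        (\<integral>x. cmod (indicator {-R n..R n} x *\<^sub>R h (Complex x Y)) \<partial>lborel)"
        unfolding HK[OF Y(3,4)] by (rule integral_norm_bound)
      also have "\<dots> \<le> (\<integral>x. cmod (h (Complex x Y)) \<partial>lborel)"
        by (intro integral_mono integrable_norm integrable_mult_indicator int Y) (auto simp: indicator_def)
      also have "\<dots> \<le> (1/s * C + pi / (\<bar>Y - Im w\<bar> * (1/s))) / 2"
        unfolding h_def by (rule hardy2_Cauchy_kernel_bound(2)[OF g Y(3,4)]) (use s in auto)
      also have "\<dots> = (C + pi) / (2 * s)"
        using s by (simp add: Y_def field_simps power2_eq_square)
      finally show ?thesis .
    qed
    have est: "cmod (integral {-R n..R n} (\<lambda>x. h (Complex x 0)) - V) \<le> (C + pi) / (2 * s) + 2 * ((Y + 1) / (real n + 1))" for n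
    proof -
      have Rw: "\<bar>Re w\<bar> < R n" "0 < R n"
        using R(1)[of n] abs_Re_le_cmod[of w] by auto
      have eq: "integral {-R n..R n} (\<lambda>x. h (Complex x 0)) - V = integral {-R n..R n} (\<lambda>x. h (Complex x Y))
        + \<i> * integral {0..Y} (\<lambda>y. h (Complex (- R n) y)) - \<i> * integral {0..Y} (\<lambda>y. h (Complex (R n) y))"
        using Cauchy_rectangle[OF cg hg Rw(1) Y(2) w Y(1)] by (simp add: h_def V_def algebra_simps)
      have "cmod (integral {-R n..R n} (\<lambda>x. h (Complex x 0)) - V) \<le>
         cmod (integral {-R n..R n} (\<lambda>x. h (Complex x Y)))
         + cmod (integral {0..Y} (\<lambda>y. h (Complex (- R n) y))) + cmod (integral {0..Y} (\<lambda>y. h (Complex (R n) y)))"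
        unfolding eq by (rule order_trans[OF norm_triangle_ineq4 add_mono[OF order_trans[OF norm_triangle_ineq]]]) (auto simp: norm_mult)
      moreover have "cmod (integral {0..Y} (\<lambda>y. h (Complex (R n) y))) \<le> (Y + 1) / (real n + 1)"
        by (rule side) (use R[of n] Rw(2) in auto)
      moreover have "cmod (integral {0..Y} (\<lambda>y. h (Complex (- R n) y))) \<le> (Y + 1) / (real n + 1)"
        by (rule side) (use R[of n] Rw(2) in auto)
      ultimately show ?thesis
        using top[of n] by linarith
    qed
    have lim: "(\<lambda>n. integral {-R n..R n} (\<lambda>x. h (Complex x 0))) \<longlonglongrightarrow> (\<integral>x. h (Complex x 0) \<partial>lborel)"
      unfolding HK[OF order_refl w[symmetric]]
    proof (rule integral_dominated_convergence[where w = "\<lambda>x. cmod (h (Complex x 0))"])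
      show "AE x in lborel. (\<lambda>n. indicator {- R n..R n} x *\<^sub>R h (Complex x 0)) \<longlonglongrightarrow> h (Complex x 0)"
      proof (intro AE_I2 tendsto_eventually)
        fix x :: real
        obtain m :: nat where m: "\<bar>x\<bar> \<le> real m" using real_arch_simple by blast
        show "\<forall>\<^sub>F n in sequentially. indicator {- R n..R n} x *\<^sub>R h (Complex x 0) = h (Complex x 0)"
        proof (rule eventually_sequentiallyI[of m])
          fix n assume "m \<le> n"
          then have "\<bar>x\<bar> \<le> R n" using m R(1)[of n] norm_ge_zero[of w] of_nat_mono[of m n, where ?'a = real] by linarith
          then show "indicator {- R n..R n} x *\<^sub>R h (Complex x 0) = h (Complex x 0)" by (auto simp: indicator_def)
        qed
      qed
    qed (use int0 in \<open>auto simp: indicator_def\<close>)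
    have "(\<lambda>n. cmod (integral {-R n..R n} (\<lambda>x. h (Complex x 0)) - V)) \<longlonglongrightarrow> D"
      unfolding D_def by (intro tendsto_intros lim)
    moreover have "(\<lambda>n. (C + pi) / (2 * s) + 2 * ((Y + 1) / (real n + 1))) \<longlonglongrightarrow> (C + pi) / (2 * s) + 2 * 0"
      by (intro tendsto_intros) real_asymp
    ultimately show "D \<le> (C + pi) / (2 * s)"
      using est by (auto intro: LIMSEQ_le)
  qed
  have "D \<le> 0"
  proof (rule tendsto_lowerbound)
    show "((\<lambda>s. (C + pi) / (2 * s)) \<longlongrightarrow> 0) at_top" by real_asymp
    have "\<forall>\<^sub>F s::real in at_top. max 1 \<bar>Im w\<bar> < s" by (rule eventually_gt_at_top)
    then show "\<forall>\<^sub>F s in at_top. D \<le> (C + pi) / (2 * s)"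
    proof eventually_elim
      case (elim s)
      have "s \<le> s\<^sup>2" using elim by (simp add: power2_eq_square)
      then show ?case using elim by (intro key) auto
    qed
  qed auto
  then have "(\<integral>x. h (Complex x 0) \<partial>lborel) = V" by (simp add: D_def)
  then show ?thesis using int0 by (simp add: has_bochner_integral_iff h_def V_def)
qed

text \<open>Subtract Cauchy's formula at the conjugate point, where the integral is 0: the
  difference of the two Cauchy kernels is \<open>2 * pi * \<i>\<close> times the Poisson
  kernel.\<close>

lemma hardy2_Poisson:
  assumes g: "hardy2 g C" and b: "0 < b"
  shows "has_bochner_integral lborel (\<lambda>x. g (Complex x 0) * of_real (b / pi * (1 / ((x - a)^2 + b^2)))) (g (Complex a b))"
proof -
  have "has_bochner_integral lborel (\<lambda>x. (g (Complex x 0) / (Complex x 0 - Complex a b) - g (Complex x 0) / (Complex x 0 - Complex a (-b))) / (2 * pi * \<i>))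
     ((2 * pi * \<i> * g (Complex a b) - 0) / (2 * pi * \<i>))"
    using hardy2_Cauchy[OF g, of "Complex a b"] hardy2_Cauchy[OF g, of "Complex a (-b)"] b
    by (intro has_bochner_integral_divide has_bochner_integral_diff) auto
  moreover have "(g (Complex x 0) / (Complex x 0 - Complex a b) - g (Complex x 0) / (Complex x 0 - Complex a (-b))) / (2 * pi * \<i>)
     = g (Complex x 0) * of_real (b / pi * (1 / ((x - a)^2 + b^2)))" for x
  proof -
    have alg: "G / p - G / q = G * (q - p) / (p * q)" if "p \<noteq> 0" "q \<noteq> 0" for G p q :: complex
      using that by (simp add: field_simps)
    have 1: "Complex x 0 - Complex a b \<noteq> 0" "Complex x 0 - Complex a (-b) \<noteq> 0"
      using b by (auto simp: complex_eq_iff)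
    have 2: "(Complex x 0 - Complex a b) * (Complex x 0 - Complex a (-b)) = of_real ((x - a)^2 + b^2)"
      by (simp add: complex_eq_iff power2_eq_square)
    have "g (Complex x 0) / (Complex x 0 - Complex a b) - g (Complex x 0) / (Complex x 0 - Complex a (-b)) =
       g (Complex x 0) * ((Complex x 0 - Complex a (-b)) - (Complex x 0 - Complex a b)) / ((Complex x 0 - Complex a b) * (Complex x 0 - Complex a (-b)))"
      by (rule alg[OF 1])
    also have "(Complex x 0 - Complex a (-b)) - (Complex x 0 - Complex a b) = 2 * b * \<i>"
      by (simp add: complex_eq_iff)
    finally show ?thesis unfolding 2 by simp
  qed
  ultimately show ?thesis by simp
qed

lemma Poisson_kernel_le:
  fixes b :: real
  assumes "0 < b"
  shows "b / pi * (1 / ((x - a)\<^sup>2 + b\<^sup>2)) \<le> 1 / (pi * b)" "0 \<le> b / pi * (1 / ((x - a)\<^sup>2 + b\<^sup>2))"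
proof -
  have "1 / ((x - a)\<^sup>2 + b\<^sup>2) \<le> 1 / b\<^sup>2"
    using assms by (intro divide_left_mono mult_pos_pos add_nonneg_pos) auto
  then have "b / pi * (1 / ((x - a)\<^sup>2 + b\<^sup>2)) \<le> b / pi * (1 / b\<^sup>2)"
    using assms by (intro mult_left_mono) auto
  then show "b / pi * (1 / ((x - a)\<^sup>2 + b\<^sup>2)) \<le> 1 / (pi * b)"
    using assms by (simp add: power2_eq_square)
qed (use assms in auto)

text \<open>The Poisson kernel is a probability density and \<open>g (a + ib)\<close> is the mean of \<open>g\<close> with respect
  to it, so its variance is the difference of the two sides.\<close>

lemma hardy2_Poisson_square:
  assumes g: "hardy2 g C" and b: "0 < b"
  shows "integrable lborel (\<lambda>x. (cmod (g (Complex x 0)))\<^sup>2 * (b / pi * (1 / ((x - a)\<^sup>2 + b\<^sup>2))))"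
    and "(cmod (g (Complex a b)))\<^sup>2 \<le> (\<integral>x. (cmod (g (Complex x 0)))\<^sup>2 * (b / pi * (1 / ((x - a)\<^sup>2 + b\<^sup>2))) \<partial>lborel)"
proof -
  note [measurable] = hardy2_measurable[OF g order_refl]
  define p where "p x = b / pi * (1 / ((x - a)\<^sup>2 + b\<^sup>2))" for x
  have p: "0 \<le> p x" "p x \<le> 1 / (pi * b)" for x
    using Poisson_kernel_le[OF b, of x a] by (auto simp: p_def)
  have mp [measurable]: "p \<in> borel_measurable borel" unfolding p_def by measurable
  have p1: "has_bochner_integral lborel p 1"
    using has_bochner_integral_mult_right[OF has_bochner_integral_Poisson[OF b, of a], of "b / pi"] b
    unfolding p_def by simp
  have pg: "has_bochner_integral lborel (\<lambda>x. g (Complex x 0) * of_real (p x)) (g (Complex a b))"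
    using hardy2_Poisson[OF g b] by (simp add: p_def)
  have i: "integrable lborel (\<lambda>x. (cmod (g (Complex x 0)))\<^sup>2 * p x)"
  proof (rule Bochner_Integration.integrable_bound)
    show "integrable lborel (\<lambda>x. (cmod (g (Complex x 0)))\<^sup>2 * (1 / (pi * b)))"
      by (intro integrable_mult_left hardy2_square_integrable(1)[OF g order_refl])
    have "norm ((cmod (g (Complex x 0)))\<^sup>2 * p x) \<le> norm ((cmod (g (Complex x 0)))\<^sup>2 * (1 / (pi * b)))" for x
      using mult_left_mono[OF p(2)[of x], of "(cmod (g (Complex x 0)))\<^sup>2"] p(1)[of x] b by (simp add: abs_mult)
    then show "AE x in lborel. norm ((cmod (g (Complex x 0)))\<^sup>2 * p x) \<le> norm ((cmod (g (Complex x 0)))\<^sup>2 * (1 / (pi * b)))"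
      by (intro AE_I2)
  qed measurable
  show "integrable lborel (\<lambda>x. (cmod (g (Complex x 0)))\<^sup>2 * (b / pi * (1 / ((x - a)\<^sup>2 + b\<^sup>2))))"
    using i by (simp add: p_def)
  define c where "c = g (Complex a b)"
  define J where "J = (\<integral>x. (cmod (g (Complex x 0)))\<^sup>2 * p x \<partial>lborel)"
  have "has_bochner_integral lborel (\<lambda>x. (cmod (g (Complex x 0)))\<^sup>2 * p x - 2 * Re (cnj c * (g (Complex x 0) * of_real (p x))) + (cmod c)\<^sup>2 * p x)
     (J - 2 * Re (cnj c * c) + (cmod c)\<^sup>2 * 1)"
    using has_bochner_integral_bounded_linear[OF bounded_linear_Re has_bochner_integral_mult_right[OF pg, of "cnj c"]]
    by (intro has_bochner_integral_add has_bochner_integral_diff has_bochner_integral_mult_right p1)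
       (auto simp only: has_bochner_integral_iff J_def c_def i)
  moreover have "(cmod (g (Complex x 0)))\<^sup>2 * p x - 2 * Re (cnj c * (g (Complex x 0) * of_real (p x))) + (cmod c)\<^sup>2 * p x
      = p x * (cmod (g (Complex x 0) - c))\<^sup>2" for x
    unfolding cmod_power2 by (simp add: power2_eq_square algebra_simps)
  moreover have "J - 2 * Re (cnj c * c) + (cmod c)\<^sup>2 * 1 = J - (cmod c)\<^sup>2"
    unfolding cmod_power2 by (simp add: power2_eq_square)
  ultimately have "has_bochner_integral lborel (\<lambda>x. p x * (cmod (g (Complex x 0) - c))\<^sup>2) (J - (cmod c)\<^sup>2)"
    by (simp only:)
  then have "0 \<le> J - (cmod c)\<^sup>2"
    using Bochner_Integration.integral_nonneg[of lborel "\<lambda>x. p x * (cmod (g (Complex x 0) - c))\<^sup>2"] p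
    by (simp add: has_bochner_integral_iff)
  then show "(cmod (g (Complex a b)))\<^sup>2 \<le> (\<integral>x. (cmod (g (Complex x 0)))\<^sup>2 * (b / pi * (1 / ((x - a)\<^sup>2 + b\<^sup>2))) \<partial>lborel)"
    by (simp add: J_def c_def p_def)
qed

text \<open>The Poisson kernel is at most its peak value \<open>1 / (pi * b)\<close>.\<close>

lemma hardy2_pointwise:
  assumes g: "hardy2 g C" and b: "0 < b"
  shows "(cmod (g (Complex a b)))\<^sup>2 \<le> C / (pi * b)"
proof -
  note sq = hardy2_square_integrable[OF g order_refl]
  have "(cmod (g (Complex a b)))\<^sup>2 \<le> (\<integral>x. (cmod (g (Complex x 0)))\<^sup>2 * (b / pi * (1 / ((x - a)\<^sup>2 + b\<^sup>2))) \<partial>lborel)"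
    by (rule hardy2_Poisson_square[OF g b])
  also have "\<dots> \<le> (\<integral>x. (cmod (g (Complex x 0)))\<^sup>2 * (1 / (pi * b)) \<partial>lborel)"
    by (intro integral_mono hardy2_Poisson_square[OF g b] integrable_mult_left sq mult_left_mono Poisson_kernel_le[OF b]) auto
  also have "\<dots> = (\<integral>x. (cmod (g (Complex x 0)))\<^sup>2 \<partial>lborel) * (1 / (pi * b))"
    by (rule integral_mult_left_zero)
  also have "\<dots> \<le> C * (1 / (pi * b))"
    using b by (intro mult_right_mono sq) auto
  finally show ?thesis by simp
qed

text \<open>Tonelli's theorem: the Poisson kernel is symmetric in \<open>a\<close> and
  \<open>x\<close>, so it has mass 1 in \<open>a\<close> as well. Consequently the integral over the
  real line is the best Hardy constant, which ties \<open>hardy2\<close> to the norm of a de Branges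
  space.\<close>

lemma hardy2_horizontal_le_boundary:
  assumes g: "hardy2 g C" and b: "0 \<le> b"
  shows "(\<integral>\<^sup>+a. ennreal ((cmod (g (Complex a b)))\<^sup>2) \<partial>lborel) \<le> (\<integral>\<^sup>+x. ennreal ((cmod (g (Complex x 0)))\<^sup>2) \<partial>lborel)"
proof (cases "b = 0")
  case False
  then have b: "0 < b" using assms by simp
  note [measurable] = hardy2_measurable[OF g order_refl]
  define p where "p a x = b / pi * (1 / ((x - a)\<^sup>2 + b\<^sup>2))" for a x
  have p0: "0 \<le> p a x" for a x using Poisson_kernel_le[OF b, of x a] by (auto simp: p_def)
  have [measurable]: "(\<lambda>a. p a x) \<in> borel_measurable borel" for x
    unfolding p_def by measurable
  have p1: "(\<integral>\<^sup>+a. ennreal (p a x) \<partial>lborel) = 1" for x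
  proof -
    have "has_bochner_integral lborel (\<lambda>a. p a x) 1"
      using has_bochner_integral_mult_right[OF has_bochner_integral_Poisson[OF b, of x], of "b / pi"] b
      unfolding p_def by (simp add: power2_commute)
    then show ?thesis using p0 by (subst nn_integral_eq_integral) (auto simp: has_bochner_integral_iff)
  qed
  have "(\<integral>\<^sup>+a. ennreal ((cmod (g (Complex a b)))\<^sup>2) \<partial>lborel) \<le>
     (\<integral>\<^sup>+a. \<integral>\<^sup>+x. ennreal ((cmod (g (Complex x 0)))\<^sup>2 * p a x) \<partial>lborel \<partial>lborel)"
  proof (rule nn_integral_mono)
    fix a
    show "ennreal ((cmod (g (Complex a b)))\<^sup>2) \<le> (\<integral>\<^sup>+x. ennreal ((cmod (g (Complex x 0)))\<^sup>2 * p a x) \<partial>lborel)"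
    proof (subst nn_integral_eq_integral)
      show "integrable lborel (\<lambda>x. (cmod (g (Complex x 0)))\<^sup>2 * p a x)"
        unfolding p_def by (rule hardy2_Poisson_square[OF g b])
      show "ennreal ((cmod (g (Complex a b)))\<^sup>2) \<le> ennreal (\<integral>x. (cmod (g (Complex x 0)))\<^sup>2 * p a x \<partial>lborel)"
        unfolding p_def by (intro ennreal_leI hardy2_Poisson_square[OF g b])
    qed (use p0 in auto)
  qed
  also have "\<dots> = (\<integral>\<^sup>+x. \<integral>\<^sup>+a. ennreal ((cmod (g (Complex x 0)))\<^sup>2 * p a x) \<partial>lborel \<partial>lborel)"
    unfolding p_def by (rule lborel_pair.Fubini') measurable
  also have "\<dots> = (\<integral>\<^sup>+x. ennreal ((cmod (g (Complex x 0)))\<^sup>2) * (\<integral>\<^sup>+a. ennreal (p a x) \<partial>lborel) \<partial>lborel)"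
    by (intro nn_integral_cong) (simp add: ennreal_mult' nn_integral_cmult)
  finally show ?thesis by (simp add: p1)
qed simp

lemma hardy2_optimal:
  assumes g: "hardy2 g C"
  shows "hardy2 g (\<integral>x. (cmod (g (Complex x 0)))\<^sup>2 \<partial>lborel)"
proof -
  have "(\<integral>\<^sup>+x. ennreal ((cmod (g (Complex x 0)))\<^sup>2) \<partial>lborel) = ennreal (\<integral>x. (cmod (g (Complex x 0)))\<^sup>2 \<partial>lborel)"
    by (intro nn_integral_eq_integral hardy2_square_integrable[OF g order_refl]) auto
  with hardy2_horizontal_le_boundary[OF g] g show ?thesis
    unfolding hardy2_def by auto
qed

section \<open>Passage between \<open>hardy2\<close> and \<open>H2_upper\<close>\<close>

lemma nn_integral_horizontal_le_iff:
  fixes F :: "real \<Rightarrow> complex"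
  assumes "continuous_on UNIV F" "0 \<le> C"
  shows "(\<integral>\<^sup>+x. ennreal ((cmod (F x))\<^sup>2) \<partial>lborel) \<le> ennreal C \<longleftrightarrow>
     integrable lborel (\<lambda>x. (cmod (F x))\<^sup>2) \<and> (\<integral>x. (cmod (F x))\<^sup>2 \<partial>lborel) \<le> C"
proof
  have [measurable]: "F \<in> borel_measurable borel" by (rule borel_measurable_continuous_onI) (rule assms)
  assume *: "(\<integral>\<^sup>+x. ennreal ((cmod (F x))\<^sup>2) \<partial>lborel) \<le> ennreal C"
  have i: "integrable lborel (\<lambda>x. (cmod (F x))\<^sup>2)"
    using order_le_less_trans[OF * ennreal_less_top] by (intro integrableI_bounded) auto
  with * assms show "integrable lborel (\<lambda>x. (cmod (F x))\<^sup>2) \<and> (\<integral>x. (cmod (F x))\<^sup>2 \<partial>lborel) \<le> C"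
    by (simp add: nn_integral_eq_integral[OF i])
next
  assume "integrable lborel (\<lambda>x. (cmod (F x))\<^sup>2) \<and> (\<integral>x. (cmod (F x))\<^sup>2 \<partial>lborel) \<le> C"
  then show "(\<integral>\<^sup>+x. ennreal ((cmod (F x))\<^sup>2) \<partial>lborel) \<le> ennreal C"
    by (simp add: nn_integral_eq_integral ennreal_leI)
qed

lemma holomorphic_upper_continuous_horizontal:
  assumes "g holomorphic_on {z. 0 < Im z}" "0 < y"
  shows "continuous_on S (\<lambda>x. g (Complex x y))"
  by (intro continuous_on_compose2[OF holomorphic_on_imp_continuous_on[OF assms(1)] continuous_on_Complex_horizontal])
     (use assms in auto)

lemma H2_upper_iff_nn_integral:
  "H2_upper g \<longleftrightarrow> g holomorphic_on {z. 0 < Im z} \<and>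
     (\<exists>C\<ge>0. \<forall>y>0. (\<integral>\<^sup>+x. ennreal ((cmod (g (Complex x y)))\<^sup>2) \<partial>lborel) \<le> ennreal C)"
proof (cases "g holomorphic_on {z. 0 < Im z}")
  case True
  note c = holomorphic_upper_continuous_horizontal[OF True]
  show ?thesis
  proof
    assume "H2_upper g"
    then obtain C where C: "\<forall>y>0. integrable lborel (\<lambda>x. (cmod (g (Complex x y)))\<^sup>2) \<and> (\<integral>x. (cmod (g (Complex x y)))\<^sup>2 \<partial>lborel) \<le> C"
      unfolding H2_upper_def by auto
    \<comment> \<open>The constant in \<open>H2_upper\<close> carries no sign condition; a single
      horizontal line supplies it.\<close>
    have "0 \<le> (\<integral>x. (cmod (g (Complex x 1)))\<^sup>2 \<partial>lborel)" by (rule Bochner_Integration.integral_nonneg) auto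
    also have "\<dots> \<le> C" using C by auto
    finally have "0 \<le> C" .
    moreover have "\<forall>y>0. (\<integral>\<^sup>+x. ennreal ((cmod (g (Complex x y)))\<^sup>2) \<partial>lborel) \<le> ennreal C"
      using C nn_integral_horizontal_le_iff[OF c \<open>0 \<le> C\<close>] by blast
    ultimately show "g holomorphic_on {z. 0 < Im z} \<and>
     (\<exists>C\<ge>0. \<forall>y>0. (\<integral>\<^sup>+x. ennreal ((cmod (g (Complex x y)))\<^sup>2) \<partial>lborel) \<le> ennreal C)"
      using True by blast
  next
    assume "g holomorphic_on {z. 0 < Im z} \<and>
     (\<exists>C\<ge>0. \<forall>y>0. (\<integral>\<^sup>+x. ennreal ((cmod (g (Complex x y)))\<^sup>2) \<partial>lborel) \<le> ennreal C)"
    then obtain C where "0 \<le> C" "\<forall>y>0. (\<integral>\<^sup>+x. ennreal ((cmod (g (Complex x y)))\<^sup>2) \<partial>lborel) \<le> ennreal C" by blast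
    then show "H2_upper g"
      unfolding H2_upper_def using True nn_integral_horizontal_le_iff[OF c \<open>0 \<le> C\<close>] by blast
  qed
qed (simp add: H2_upper_def)

lemma hardy2_imp_H2_upper: "hardy2 g C \<Longrightarrow> H2_upper g"
  unfolding hardy2_def H2_upper_iff_nn_integral by fastforce

text \<open>A function in H^2 need not extend to the real line. Its upward shifts do, and they share
  one constant, so pointwise bounds transfer.\<close>

lemma H2_upper_imp_hardy2_shift:
  assumes "H2_upper g"
  obtains C where "\<And>e. 0 < e \<Longrightarrow> hardy2 (\<lambda>z. g (z + Complex 0 e)) C"
proof -
  obtain C where C: "0 \<le> C" "\<And>y. 0 < y \<Longrightarrow> (\<integral>\<^sup>+x. ennreal ((cmod (g (Complex x y)))\<^sup>2) \<partial>lborel) \<le> ennreal C"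
    and h: "g holomorphic_on {z. 0 < Im z}"
    using assms unfolding H2_upper_iff_nn_integral by blast
  have "hardy2 (\<lambda>z. g (z + Complex 0 e)) C" if e: "0 < e" for e
    unfolding hardy2_def
  proof (intro conjI allI impI C(1))
    show "continuous_on {z. 0 \<le> Im z} (\<lambda>z. g (z + Complex 0 e))"
      by (intro continuous_on_compose2[OF holomorphic_on_imp_continuous_on[OF h]] continuous_intros) (use e in auto)
    show "(\<lambda>z. g (z + Complex 0 e)) holomorphic_on {z. 0 < Im z}"
    proof -
      have "(g \<circ> (\<lambda>z. z + Complex 0 e)) holomorphic_on {z. 0 < Im z}"
        by (rule holomorphic_on_compose_gen[OF _ h]) (use e in \<open>auto intro!: holomorphic_intros\<close>)
      then show ?thesis by (simp add: o_def)
    qed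
    fix y :: real assume "0 \<le> y"
    then show "(\<integral>\<^sup>+x. ennreal ((cmod (g (Complex x y + Complex 0 e)))\<^sup>2) \<partial>lborel) \<le> ennreal C"
      using C(2)[of "y + e"] e by (simp add: plus_complex.code)
  qed
  then show ?thesis by (rule that)
qed

lemma H2_upper_pointwise:
  assumes "H2_upper g"
  obtains M where "0 < M" "\<And>z. 0 < Im z \<Longrightarrow> cmod (g z) \<le> M / sqrt (Im z)"
proof -
  obtain C where C: "\<And>e. 0 < e \<Longrightarrow> hardy2 (\<lambda>z. g (z + Complex 0 e)) C"
    by (rule H2_upper_imp_hardy2_shift[OF assms]) blast
  have C0: "0 \<le> C" using C[of 1] by (simp add: hardy2_def)
  have "cmod (g z) \<le> sqrt (C + 1) / sqrt (Im z)" if z: "0 < Im z" for z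
  proof -
    \<comment> \<open>Half of the height is spent on the shift and half on the Poisson estimate;
      \<open>pi\<close> absorbs the resulting factor 2, and \<open>C + 1\<close> makes the final
      constant positive.\<close>
    have "(cmod (g (Complex (Re z) (Im z / 2) + Complex 0 (Im z / 2))))\<^sup>2 \<le> C / (pi * (Im z / 2))"
      using hardy2_pointwise[OF C, of "Im z / 2" "Im z / 2" "Re z"] z by simp
    also have "Complex (Re z) (Im z / 2) + Complex 0 (Im z / 2) = z"
      by (simp add: complex_eq_iff)
    also have "C / (pi * (Im z / 2)) \<le> (C + 1) / Im z"
      using z C0 pi_gt3 by (intro frac_le) auto
    finally have "cmod (g z) \<le> sqrt ((C + 1) / Im z)"
      by (rule real_le_rsqrt)
    then show ?thesis by (simp add: real_sqrt_divide)
  qed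
  then show ?thesis using C0 by (intro that[of "sqrt (C + 1)"]) auto
qed

text \<open>Fatou's lemma along the heights \<open>1 / real (Suc n)\<close> carries the uniform
  bound to the real line.\<close>

lemma H2_upper_imp_hardy2:
  assumes g: "H2_upper g" and c: "continuous_on {z. 0 \<le> Im z} g"
  obtains C where "hardy2 g C"
proof -
  obtain C where C: "0 \<le> C" "\<And>y. 0 < y \<Longrightarrow> (\<integral>\<^sup>+x. ennreal ((cmod (g (Complex x y)))\<^sup>2) \<partial>lborel) \<le> ennreal C"
    and h: "g holomorphic_on {z. 0 < Im z}"
    using g unfolding H2_upper_iff_nn_integral by blast
  have ch: "continuous_on UNIV (\<lambda>x. g (Complex x y))" if "0 \<le> y" for y
    by (intro continuous_on_compose2[OF c continuous_on_Complex_horizontal]) (use that in auto)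
  have lim: "(\<lambda>n. ennreal ((cmod (g (Complex x (1 / real (Suc n)))))\<^sup>2)) \<longlonglongrightarrow> ennreal ((cmod (g (Complex x 0)))\<^sup>2)" for x
  proof -
    have "(\<lambda>n. g (Complex x (1 / real (Suc n)))) \<longlonglongrightarrow> g (Complex x 0)"
      by (rule continuous_on_tendsto_compose[OF c])
         (auto intro!: tendsto_Complex tendsto_const LIMSEQ_Suc[OF lim_1_over_n] simp del: of_nat_Suc)
    then show ?thesis by (intro tendsto_intros)
  qed
  have "(\<integral>\<^sup>+x. ennreal ((cmod (g (Complex x 0)))\<^sup>2) \<partial>lborel) =
     (\<integral>\<^sup>+x. liminf (\<lambda>n. ennreal ((cmod (g (Complex x (1 / real (Suc n)))))\<^sup>2)) \<partial>lborel)"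
    by (intro nn_integral_cong) (simp add: lim_imp_Liminf[OF _ lim] del: of_nat_Suc)
  also have "\<dots> \<le> liminf (\<lambda>n. \<integral>\<^sup>+x. ennreal ((cmod (g (Complex x (1 / real (Suc n)))))\<^sup>2) \<partial>lborel)"
  proof (rule nn_integral_liminf)
    fix n
    have [measurable]: "(\<lambda>x. g (Complex x (1 / real (Suc n)))) \<in> borel_measurable borel"
      by (rule borel_measurable_continuous_onI) (rule ch, simp)
    show "(\<lambda>x. ennreal ((cmod (g (Complex x (1 / real (Suc n)))))\<^sup>2)) \<in> borel_measurable lborel" by measurable
  qed
  also have "\<dots> \<le> ennreal C"
  proof -
    have "liminf (\<lambda>n. \<integral>\<^sup>+x. ennreal ((cmod (g (Complex x (1 / real (Suc n)))))\<^sup>2) \<partial>lborel) \<le> liminf (\<lambda>_. ennreal C)"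
      by (intro Liminf_mono always_eventually allI C) simp
    then show ?thesis by (simp only: Liminf_const[OF sequentially_bot])
  qed
  finally have "(\<integral>\<^sup>+x. ennreal ((cmod (g (Complex x 0)))\<^sup>2) \<partial>lborel) \<le> ennreal C" .
  then have "hardy2 g C"
    unfolding hardy2_def using C c h by (auto simp: le_less)
  then show ?thesis by (rule that)
qed

section \<open>Hilbert spaces of entire functions\<close>

text \<open>Discriminant of a nonnegative quadratic in \<open>t\<close>. Besides the Cauchy-Schwarz
  inequality it also measures how nearly a minimizing sequence is stationary.\<close>

lemma power2_le_of_discriminant:
  fixes x y q :: real
  assumes "\<And>t. 0 \<le> x - 2 * t * y + t\<^sup>2 * q" "0 \<le> q"
  shows "y\<^sup>2 \<le> x * q"
proof (cases "q = 0")
  case True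
  show ?thesis
  proof (cases "y = 0")
    case False
    \<comment> \<open>The expression is affine in \<open>t\<close> here and takes the value -1 at
      this \<open>t\<close>.\<close>
    then show ?thesis using assms(1)[of "(x + 1) / (2 * y)"] True by (simp add: field_simps)
  qed (use True in simp)
next
  case False
  then show ?thesis using assms(1)[of "y / q"] assms(2)
    by (simp add: field_simps power2_eq_square)
qed

locale entire_hilbert_space =
  fixes N :: "(complex \<Rightarrow> complex) set"
    and ip :: "(complex \<Rightarrow> complex) \<Rightarrow> (complex \<Rightarrow> complex) \<Rightarrow> complex"
  assumes hs: "hilbert_space_entire N ip"
begin

abbreviation nrm where "nrm \<equiv> hs_norm ip"

lemma holo: "f \<in> N \<Longrightarrow> f holomorphic_on A"
  using hs unfolding hilbert_space_entire_def by (meson holomorphic_on_subset subset_UNIV)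

lemma zero_mem: "(\<lambda>_. 0) \<in> N"
  using hs unfolding hilbert_space_entire_def by blast

lemma add_mem: "f \<in> N \<Longrightarrow> g \<in> N \<Longrightarrow> (\<lambda>z. f z + g z) \<in> N"
  using hs unfolding hilbert_space_entire_def by blast

lemma scale_mem: "f \<in> N \<Longrightarrow> (\<lambda>z. c * f z) \<in> N"
  using hs unfolding hilbert_space_entire_def by blast

lemma diff_mem: "f \<in> N \<Longrightarrow> g \<in> N \<Longrightarrow> (\<lambda>z. f z - g z) \<in> N"
  using add_mem[OF _ scale_mem[of g "-1"], of f] by simp

lemma ip_add_left: "f \<in> N \<Longrightarrow> g \<in> N \<Longrightarrow> h \<in> N \<Longrightarrow> ip (\<lambda>z. f z + g z) h = ip f h + ip g h"
  using hs unfolding hilbert_space_entire_def by blast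

lemma ip_scale_left: "f \<in> N \<Longrightarrow> h \<in> N \<Longrightarrow> ip (\<lambda>z. c * f z) h = c * ip f h"
  using hs unfolding hilbert_space_entire_def by blast

lemma ip_cnj: "f \<in> N \<Longrightarrow> g \<in> N \<Longrightarrow> ip g f = cnj (ip f g)"
  using hs unfolding hilbert_space_entire_def by blast

lemma ip_diff_left: "f \<in> N \<Longrightarrow> g \<in> N \<Longrightarrow> h \<in> N \<Longrightarrow> ip (\<lambda>z. f z - g z) h = ip f h - ip g h"
  using ip_add_left[OF _ scale_mem[of g "-1"], of f h] ip_scale_left[of g h "-1"] by simp

lemma ip_add_right: "f \<in> N \<Longrightarrow> g \<in> N \<Longrightarrow> h \<in> N \<Longrightarrow> ip h (\<lambda>z. f z + g z) = ip h f + ip h g"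
  using ip_add_left[of f g h] add_mem[of f g] by (simp add: ip_cnj[of _ h])

lemma ip_scale_right: "f \<in> N \<Longrightarrow> h \<in> N \<Longrightarrow> ip h (\<lambda>z. c * f z) = cnj c * ip h f"
  using ip_scale_left[of f h c] scale_mem[of f c] by (simp add: ip_cnj[of _ h])

lemma ip_diff_right: "f \<in> N \<Longrightarrow> g \<in> N \<Longrightarrow> h \<in> N \<Longrightarrow> ip h (\<lambda>z. f z - g z) = ip h f - ip h g"
  using ip_diff_left[of f g h] diff_mem[of f g] by (simp add: ip_cnj[of _ h])

lemma ip_self_nonneg: "f \<in> N \<Longrightarrow> 0 \<le> Re (ip f f)"
  using hs unfolding hilbert_space_entire_def by blast

lemma ip_self_Im: "f \<in> N \<Longrightarrow> Im (ip f f) = 0"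
  using ip_cnj[of f f] by (simp add: complex_eq_iff)

lemma ip_self: "f \<in> N \<Longrightarrow> ip f f = of_real ((nrm f)\<^sup>2)"
  using ip_self_Im[of f] ip_self_nonneg[of f] by (simp add: hs_norm_def complex_eq_iff)

lemma ip_self_eq_0: "f \<in> N \<Longrightarrow> ip f f = 0 \<Longrightarrow> f = (\<lambda>_. 0)"
  using hs unfolding hilbert_space_entire_def by blast

lemma nrm_nonneg: "0 \<le> nrm f" if "f \<in> N"
  using ip_self_nonneg[OF that] by (simp add: hs_norm_def)

lemma nrm_power2: "f \<in> N \<Longrightarrow> (nrm f)\<^sup>2 = Re (ip f f)"
  using ip_self_nonneg[of f] by (simp add: hs_norm_def)

lemma nrm_power2_add: "f \<in> N \<Longrightarrow> g \<in> N \<Longrightarrow> (nrm (\<lambda>z. f z + g z))\<^sup>2 = (nrm f)\<^sup>2 + 2 * Re (ip f g) + (nrm g)\<^sup>2"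
  using add_mem[of f g] ip_cnj[of f g] by (simp add: nrm_power2 ip_add_left ip_add_right)

lemma nrm_power2_diff: "f \<in> N \<Longrightarrow> g \<in> N \<Longrightarrow> (nrm (\<lambda>z. f z - g z))\<^sup>2 = (nrm f)\<^sup>2 - 2 * Re (ip f g) + (nrm g)\<^sup>2"
  using diff_mem[of f g] ip_cnj[of f g] by (simp add: nrm_power2 ip_diff_left ip_diff_right)

lemma nrm_scale: "f \<in> N \<Longrightarrow> nrm (\<lambda>z. c * f z) = cmod c * nrm f"
proof -
  assume f: "f \<in> N"
  have "(nrm (\<lambda>z. c * f z))\<^sup>2 = (cmod c * nrm f)\<^sup>2"
    using f scale_mem[OF f, of c] ip_self_Im[OF f]
    by (simp add: nrm_power2 ip_scale_left ip_scale_right power_mult_distrib cmod_power2)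
       (simp add: power2_eq_square algebra_simps)
  then show ?thesis
    using nrm_nonneg[OF f] nrm_nonneg[OF scale_mem[OF f, of c]] by (simp add: power2_eq_iff_nonneg)
qed

lemma complete:
  assumes "\<And>n::nat. F n \<in> N" "\<And>e. 0 < e \<Longrightarrow> \<exists>M. \<forall>m\<ge>M. \<forall>n\<ge>M. nrm (\<lambda>z. F m z - F n z) < e"
  obtains f where "f \<in> N" "(\<lambda>n. nrm (\<lambda>z. F n z - f z)) \<longlonglongrightarrow> 0"
proof -
  have "\<exists>f\<in>N. (\<lambda>n. nrm (\<lambda>z. F n z - f z)) \<longlonglongrightarrow> 0"
  proof (rule mp[OF spec[OF hs[unfolded hilbert_space_entire_def, THEN conjunct2, THEN conjunct2, THEN conjunct2,
      THEN conjunct2, THEN conjunct2, THEN conjunct2, THEN conjunct2, THEN conjunct2, THEN conjunct2], of F]])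
    show "(\<forall>n. F n \<in> N) \<and> (\<forall>e>0. \<exists>M. \<forall>m\<ge>M. \<forall>n\<ge>M. nrm (\<lambda>z. F m z - F n z) < e)"
      using assms by simp
  qed
  then show ?thesis using that by (elim bexE)
qed

lemma Cauchy_Schwarz_Re: "f \<in> N \<Longrightarrow> g \<in> N \<Longrightarrow> \<bar>Re (ip f g)\<bar> \<le> nrm f * nrm g"
proof -
  assume f: "f \<in> N" and g: "g \<in> N"
  have "(Re (ip f g))\<^sup>2 \<le> (nrm f)\<^sup>2 * (nrm g)\<^sup>2"
  proof (rule power2_le_of_discriminant)
    fix t :: real
    have "0 \<le> (nrm (\<lambda>z. f z - of_real t * g z))\<^sup>2" by simp
    then show "0 \<le> (nrm f)\<^sup>2 - 2 * t * Re (ip f g) + t\<^sup>2 * (nrm g)\<^sup>2"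
      using nrm_power2_diff[OF f scale_mem[OF g, of "of_real t"]] nrm_scale[OF g, of "of_real t"]
      by (simp add: ip_scale_right f g power_mult_distrib)
  qed simp
  then have "(Re (ip f g))\<^sup>2 \<le> (nrm f * nrm g)\<^sup>2" by (simp add: power_mult_distrib)
  then show ?thesis
    using abs_le_square_iff[of "Re (ip f g)" "nrm f * nrm g"] nrm_nonneg[OF f] nrm_nonneg[OF g] by simp
qed

lemma Cauchy_Schwarz: "f \<in> N \<Longrightarrow> g \<in> N \<Longrightarrow> cmod (ip f g) \<le> nrm f * nrm g"
proof -
  assume f: "f \<in> N" and g: "g \<in> N"
  \<comment> \<open>Rotating \<open>f\<close> by a unimodular constant makes the inner product real
    and nonnegative; the value 1 serves when it vanishes.\<close>
  define c where "c = (if ip f g = 0 then 1 else cnj (ip f g) / of_real (cmod (ip f g)))"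
  have c: "cmod c = 1" by (simp add: c_def norm_divide)
  have "c * ip f g = of_real (cmod (ip f g))"
    by (simp add: c_def complex_norm_square[symmetric] power2_eq_square mult.commute)
  then have "cmod (ip f g) = Re (ip (\<lambda>z. c * f z) g)"
    by (simp add: ip_scale_left f g)
  also have "\<dots> \<le> nrm (\<lambda>z. c * f z) * nrm g"
    using Cauchy_Schwarz_Re[OF scale_mem[OF f] g, of c] by linarith
  finally show ?thesis by (simp add: nrm_scale[OF f] c)
qed

lemma nrm_triangle: "f \<in> N \<Longrightarrow> g \<in> N \<Longrightarrow> nrm (\<lambda>z. f z + g z) \<le> nrm f + nrm g"
proof -
  assume f: "f \<in> N" and g: "g \<in> N"
  have "(nrm (\<lambda>z. f z + g z))\<^sup>2 \<le> (nrm f + nrm g)\<^sup>2"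
    using nrm_power2_add[OF f g] Cauchy_Schwarz_Re[OF f g] by (simp add: power2_sum)
  then show ?thesis
    using nrm_nonneg[OF f] nrm_nonneg[OF g] by (meson add_nonneg_nonneg power2_le_imp_le)
qed

text \<open>The representing vector is the limit of a minimizing sequence in \<open>V\<close> for
  \<open>\<parallel>f\<parallel>\<^sup>2 - 2 Re (\<phi> f)\<close>, which is Cauchy by the parallelogram law.\<close>

lemma Riesz_subspace:
  assumes V: "V \<subseteq> N" "(\<lambda>_. 0) \<in> V" "\<And>f g. f \<in> V \<Longrightarrow> g \<in> V \<Longrightarrow> (\<lambda>z. f z + g z) \<in> V"
    "\<And>c f. f \<in> V \<Longrightarrow> (\<lambda>z. c * f z) \<in> V"
    and add: "\<And>f g. f \<in> N \<Longrightarrow> g \<in> N \<Longrightarrow> \<phi> (\<lambda>z. f z + g z) = \<phi> f + \<phi> g"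
    and scale: "\<And>c f. f \<in> N \<Longrightarrow> \<phi> (\<lambda>z. c * f z) = c * \<phi> f"
    and bdd: "\<And>f. f \<in> N \<Longrightarrow> cmod (\<phi> f) \<le> B * nrm f"
  obtains s m where "\<And>n::nat. s n \<in> V" "m \<in> N" "(\<lambda>n. nrm (\<lambda>z. s n z - m z)) \<longlonglongrightarrow> 0"
    "\<And>g. g \<in> V \<Longrightarrow> ip g m = \<phi> g"
proof -
  define J where "J f = (nrm f)\<^sup>2 - 2 * Re (\<phi> f)" for f
  have lower: "- B\<^sup>2 \<le> J f" if "f \<in> N" for f
  proof -
    have "2 * Re (\<phi> f) \<le> 2 * (B * nrm f)"
      using bdd[OF that] complex_Re_le_cmod[of "\<phi> f"] by simp
    moreover have "0 \<le> (nrm f - B)\<^sup>2" by simp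
    ultimately show ?thesis by (simp add: J_def power2_diff mult.commute)
  qed
  define d where "d = (INF f\<in>V. J f)"
  have bd: "bdd_below (J ` V)"
    using lower V(1) by (intro bdd_belowI2[of _ "- B\<^sup>2"]) auto
  have dle: "d \<le> J f" if "f \<in> V" for f
    unfolding d_def by (rule cINF_lower[OF bd that])
  have "\<exists>f\<in>V. J f < d + 1 / real (Suc n)" for n
  proof -
    have "\<exists>f\<in>V. J f < d + 1 / real (Suc n)"
      using cINF_less_iff[OF _ bd, of "d + 1 / real (Suc n)"] V(2) unfolding d_def by auto
    then show ?thesis .
  qed
  then obtain s where s: "\<And>n. s n \<in> V" "\<And>n. J (s n) < d + 1 / real (Suc n)" by metis
  have sN: "s n \<in> N" for n using s(1) V(1) by blast
  have half: "(nrm (\<lambda>z. f z - g z))\<^sup>2 \<le> 2 * (J f - d) + 2 * (J g - d)" if f: "f \<in> V" and g: "g \<in> V" for f g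
  proof -
    have N: "f \<in> N" "g \<in> N" using f g V(1) by auto
    define h where "h = (\<lambda>z. 1/2 * (f z + g z))"
    have "d \<le> J h" unfolding h_def by (intro dle V f g)
    moreover have "(nrm h)\<^sup>2 = ((nrm f)\<^sup>2 + 2 * Re (ip f g) + (nrm g)\<^sup>2) / 4"
      unfolding h_def nrm_scale[OF add_mem[OF N]] power_mult_distrib nrm_power2_add[OF N]
      by (simp add: power2_eq_square)
    moreover have "\<phi> h = (\<phi> f + \<phi> g) / 2"
      unfolding h_def scale[OF add_mem[OF N]] add[OF N] by simp
    ultimately show ?thesis
      using nrm_power2_diff[OF N] by (simp add: J_def field_simps)
  qed
  have "\<exists>M. \<forall>m\<ge>M. \<forall>n\<ge>M. nrm (\<lambda>z. s m z - s n z) < e" if e: "0 < e" for e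
  proof -
    obtain M :: nat where M: "4 / e\<^sup>2 < real M" using reals_Archimedean2 by blast
    show ?thesis
    proof (intro exI[of _ M] allI impI)
      fix m n assume mn: "M \<le> m" "M \<le> n"
      have small: "4 * (J (s k) - d) < e\<^sup>2" if "M \<le> k" for k
      proof -
        have "4 / e\<^sup>2 < real (Suc k)" using M that by simp
        then have "1 / real (Suc k) < e\<^sup>2 / 4" using e by (simp add: field_simps)
        then have "J (s k) - d < e\<^sup>2 / 4" using s(2)[of k] by linarith
        then show ?thesis by simp
      qed
      have "(nrm (\<lambda>z. s m z - s n z))\<^sup>2 < e\<^sup>2"
        using half[OF s(1)[of m] s(1)[of n]] small[OF mn(1)] small[OF mn(2)] by linarith
      then show "nrm (\<lambda>z. s m z - s n z) < e"
        using e by (meson less_eq_real_def power_less_imp_less_base)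
    qed
  qed
  from complete[OF sN this] obtain m where m: "m \<in> N" and lim: "(\<lambda>n. nrm (\<lambda>z. s n z - m z)) \<longlonglongrightarrow> 0" by blast
  have rep: "Re (ip g m) = Re (\<phi> g)" if g: "g \<in> V" for g
  proof -
    have gN: "g \<in> N" using g V(1) by blast
    have est: "\<bar>Re (ip (s n) g) - Re (\<phi> g)\<bar> \<le> sqrt (1 / real (Suc n)) * nrm g" for n
    proof -
      \<comment> \<open>\<open>J\<close> stays above \<open>d\<close> along the real line through
        \<open>s n\<close> in direction \<open>g\<close>. The discriminant turns the gap
        \<open>J (s n) - d\<close> into a bound for the defect of the representation, so
        \<open>V\<close> may fail to be closed.\<close>
      have "(Re (\<phi> g) - Re (ip (s n) g))\<^sup>2 \<le> (J (s n) - d) * (nrm g)\<^sup>2"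
      proof (rule power2_le_of_discriminant)
        fix t :: real
        have sg: "(\<lambda>z. of_real t * g z) \<in> N" by (rule scale_mem[OF gN])
        have "d \<le> J (\<lambda>z. s n z + of_real t * g z)" by (intro dle V s g)
        also have "\<dots> = J (s n) - 2 * t * (Re (\<phi> g) - Re (ip (s n) g)) + t\<^sup>2 * (nrm g)\<^sup>2"
          unfolding J_def nrm_power2_add[OF sN sg] nrm_scale[OF gN] add[OF sN sg] scale[OF gN] ip_scale_right[OF gN sN]
          by (simp add: power_mult_distrib algebra_simps)
        finally show "0 \<le> J (s n) - d - 2 * t * (Re (\<phi> g) - Re (ip (s n) g)) + t\<^sup>2 * (nrm g)\<^sup>2" by simp
      qed simp
      also have "\<dots> \<le> (1 / real (Suc n)) * (nrm g)\<^sup>2"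
        using s(2)[of n] by (intro mult_right_mono) auto
      finally have "sqrt ((Re (\<phi> g) - Re (ip (s n) g))\<^sup>2) \<le> sqrt ((1 / real (Suc n)) * (nrm g)\<^sup>2)"
        by (rule real_sqrt_le_mono)
      then show ?thesis using nrm_nonneg[OF gN] unfolding real_sqrt_mult by (simp add: abs_minus_commute)
    qed
    have l1: "(\<lambda>n. Re (ip (s n) g)) \<longlonglongrightarrow> Re (\<phi> g)"
    proof (rule LIM_zero_cancel, rule Lim_null_comparison)
      show "\<forall>\<^sub>F n in sequentially. norm (Re (ip (s n) g) - Re (\<phi> g)) \<le> sqrt (1 / real (Suc n)) * nrm g"
        using est by simp
      have "(\<lambda>n. sqrt (1 / real (Suc n)) * nrm g) \<longlonglongrightarrow> sqrt 0 * nrm g"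
        by (intro tendsto_intros LIMSEQ_Suc[OF lim_1_over_n])
      then show "(\<lambda>n. sqrt (1 / real (Suc n)) * nrm g) \<longlonglongrightarrow> 0" by simp
    qed
    have l2: "(\<lambda>n. Re (ip (s n) g)) \<longlonglongrightarrow> Re (ip m g)"
    proof (rule LIM_zero_cancel, rule Lim_null_comparison)
      show "\<forall>\<^sub>F n in sequentially. norm (Re (ip (s n) g) - Re (ip m g)) \<le> nrm (\<lambda>z. s n z - m z) * nrm g"
        using Cauchy_Schwarz_Re[OF diff_mem[OF sN m] gN] by (simp add: ip_diff_left sN m gN)
      show "(\<lambda>n. nrm (\<lambda>z. s n z - m z) * nrm g) \<longlonglongrightarrow> 0"
        using tendsto_mult_right[OF lim, of "nrm g"] by simp
    qed
    show ?thesis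
      using LIMSEQ_unique[OF l1 l2] ip_cnj[OF m gN] by simp
  qed
  have "ip g m = \<phi> g" if g: "g \<in> V" for g
  proof (rule complex_eqI)
    have gN: "g \<in> N" using g V(1) by blast
    have "Re (ip (\<lambda>z. \<i> * g z) m) = Re (\<phi> (\<lambda>z. \<i> * g z))" by (rule rep[OF V(4)[OF g]])
    then show "Im (ip g m) = Im (\<phi> g)"
      by (simp add: ip_scale_left[OF gN m] scale[OF gN])
  qed (rule rep[OF g])
  then show ?thesis using that s(1) m lim by blast
qed

lemma Riesz:
  assumes "\<And>f g. f \<in> N \<Longrightarrow> g \<in> N \<Longrightarrow> \<phi> (\<lambda>z. f z + g z) = \<phi> f + \<phi> g"
    and "\<And>c f. f \<in> N \<Longrightarrow> \<phi> (\<lambda>z. c * f z) = c * \<phi> f"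
    and "\<And>f. f \<in> N \<Longrightarrow> cmod (\<phi> f) \<le> B * nrm f"
  obtains m where "m \<in> N" "\<And>g. g \<in> N \<Longrightarrow> ip g m = \<phi> g"
proof (rule Riesz_subspace[OF subset_refl zero_mem add_mem scale_mem, of \<phi> B])
  fix s :: "nat \<Rightarrow> complex \<Rightarrow> complex" and m
  assume "m \<in> N" "\<And>g. g \<in> N \<Longrightarrow> ip g m = \<phi> g"
  then show thesis by (rule that)
qed (assumption | rule assms)+

end

section \<open>The reproducing kernel\<close>

text \<open>The division property prescribes a function only off one point; continuity fixes the
  remaining value.\<close>

lemma entire_eq_off_point:
  fixes f g :: "complex \<Rightarrow> complex"
  assumes "f holomorphic_on UNIV" "g holomorphic_on UNIV" and eq: "\<And>z. z \<noteq> a \<Longrightarrow> f z = g z"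
  shows "f = g"
proof
  fix z
  show "f z = g z"
  proof (cases "z = a")
    case True
    have "isCont f a" "isCont g a"
      using assms(1,2) by (auto dest!: holomorphic_on_imp_continuous_on simp: continuous_on_eq_continuous_at)
    then have "f \<midarrow>a\<rightarrow> f a" "g \<midarrow>a\<rightarrow> g a" by (auto simp: isCont_def)
    moreover have "(f \<midarrow>a\<rightarrow> g a) \<longleftrightarrow> (g \<midarrow>a\<rightarrow> g a)"
      by (intro filterlim_cong refl) (auto simp: eventually_at eq intro!: exI[of _ 1])
    ultimately show ?thesis using True LIM_unique by blast
  qed (rule eq)
qed

locale entire_rkhs = entire_hilbert_space +
  assumes nocommon: "\<forall>w. \<exists>f\<in>N. f w \<noteq> 0"
    and eval_bdd: "\<forall>w. \<exists>C. \<forall>f\<in>N. cmod (f w) \<le> C * hs_norm ip f"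
begin

text \<open>\<open>K w z\<close> is the reproducing kernel at \<open>w\<close>, evaluated at
  \<open>z\<close>: holomorphic in \<open>z\<close>, antiholomorphic in \<open>w\<close>.\<close>

definition K :: "complex \<Rightarrow> complex \<Rightarrow> complex" where
  "K w = (SOME k. k \<in> N \<and> (\<forall>f\<in>N. ip f k = f w))"

lemma K: "K w \<in> N" "f \<in> N \<Longrightarrow> ip f (K w) = f w"
proof -
  obtain C where C: "\<And>f. f \<in> N \<Longrightarrow> cmod (f w) \<le> C * nrm f"
    using eval_bdd by blast
  obtain k where "k \<in> N" "\<And>f. f \<in> N \<Longrightarrow> ip f k = f w"
    by (rule Riesz[of "\<lambda>f. f w" C]) (use C in auto)
  then have "\<exists>k. k \<in> N \<and> (\<forall>f\<in>N. ip f k = f w)" by blast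
  from someI_ex[OF this] show "K w \<in> N" "f \<in> N \<Longrightarrow> ip f (K w) = f w"
    unfolding K_def by auto
qed

lemma K_cnj: "K z w = cnj (K w z)"
  using ip_cnj[OF K(1) K(1), of z w] K(2)[OF K(1), of w z] K(2)[OF K(1), of z w] by simp

lemma K_self: "K w w = of_real ((nrm (K w))\<^sup>2)" "0 < nrm (K w)"
proof -
  show 1: "K w w = of_real ((nrm (K w))\<^sup>2)"
    using K(2)[OF K(1), of w w] ip_self[OF K(1), of w] by simp
  show "0 < nrm (K w)"
  proof (rule ccontr)
    assume "\<not> 0 < nrm (K w)"
    then have "nrm (K w) = 0" using nrm_nonneg[OF K(1), of w] by simp
    then have "K w = (\<lambda>_. 0)" using ip_self_eq_0[OF K(1)] ip_self[OF K(1)] by simp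
    \<comment> \<open>The absence of common zeros is what makes the diagonal of the kernel
      positive.\<close>
    obtain f where f: "f \<in> N" "f w \<noteq> 0" using nocommon by blast
    have "f w = ip f (\<lambda>_. 0)" using K(2)[OF f(1), of w] \<open>K w = (\<lambda>_. 0)\<close> by simp
    also have "\<dots> = 0" using ip_scale_right[OF f(1) f(1), of 0] by simp
    finally show False using f by simp
  qed
qed

text \<open>The excluded point is later \<open>a = w\<close> real, where the factor
  \<open>z - cnj w\<close> of the kernel formula vanishes.\<close>

lemma K_nonzero: "\<exists>z. z \<noteq> a \<and> K w z \<noteq> 0"
proof (rule ccontr)
  assume "\<not> ?thesis"
  then have "K w = (\<lambda>_. 0)"
    by (intro entire_eq_off_point[of _ _ a] holo K(1) zero_mem) auto
  then show False using K_self[of w] by simp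
qed

end

section \<open>The isometric division property and its effect on the kernel\<close>

locale debranges_like = entire_rkhs +
  assumes div_inv: "\<forall>w. Im w \<noteq> 0 \<longrightarrow> (\<forall>f\<in>N. f w = 0 \<longrightarrow>
        (\<exists>g\<in>N. (\<forall>z. z \<noteq> w \<longrightarrow> g z = (z - cnj w) / (z - w) * f z) \<and>
                hs_norm ip g = hs_norm ip f))"
begin

text \<open>The value at \<open>w\<close> is left to the removable singularity: members of
  \<open>N\<close> are entire, so it is determined.\<close>

definition rot :: "(complex \<Rightarrow> complex) \<Rightarrow> complex \<Rightarrow> (complex \<Rightarrow> complex)" where
  "rot f w = (SOME g. g \<in> N \<and> (\<forall>z. z \<noteq> w \<longrightarrow> g z = (z - cnj w) / (z - w) * f z) \<and> nrm g = nrm f)"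

lemma rot:
  assumes "Im w \<noteq> 0" "f \<in> N" "f w = 0"
  shows "rot f w \<in> N" "z \<noteq> w \<Longrightarrow> rot f w z = (z - cnj w) / (z - w) * f z" "nrm (rot f w) = nrm f"
proof -
  have "\<exists>g. g \<in> N \<and> (\<forall>z. z \<noteq> w \<longrightarrow> g z = (z - cnj w) / (z - w) * f z) \<and> nrm g = nrm f"
    using div_inv assms by blast
  from someI_ex[OF this] show "rot f w \<in> N" "z \<noteq> w \<Longrightarrow> rot f w z = (z - cnj w) / (z - w) * f z" "nrm (rot f w) = nrm f"
    unfolding rot_def by auto
qed

lemma rot_add:
  assumes w: "Im w \<noteq> 0" and f: "f \<in> N" "f w = 0" and g: "g \<in> N" "g w = 0"
  shows "rot (\<lambda>z. f z + g z) w = (\<lambda>z. rot f w z + rot g w z)"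
proof (rule entire_eq_off_point[of _ _ w])
  have fg: "(\<lambda>z. f z + g z) \<in> N" "f w + g w = 0" using f g add_mem by auto
  show "rot (\<lambda>z. f z + g z) w holomorphic_on UNIV" "(\<lambda>z. rot f w z + rot g w z) holomorphic_on UNIV"
    by (intro holo add_mem rot w f g fg)+
  show "rot (\<lambda>z. f z + g z) w z = rot f w z + rot g w z" if "z \<noteq> w" for z
    using that by (simp add: rot(2)[OF w f] rot(2)[OF w g] rot(2)[OF w fg] distrib_left)
qed

lemma rot_scale:
  assumes w: "Im w \<noteq> 0" and f: "f \<in> N" "f w = 0"
  shows "rot (\<lambda>z. c * f z) w = (\<lambda>z. c * rot f w z)"
proof (rule entire_eq_off_point[of _ _ w])
  have cf: "(\<lambda>z. c * f z) \<in> N" "c * f w = 0" using f scale_mem by auto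
  show "rot (\<lambda>z. c * f z) w holomorphic_on UNIV" "(\<lambda>z. c * rot f w z) holomorphic_on UNIV"
    by (intro holo scale_mem rot w f cf)+
  show "rot (\<lambda>z. c * f z) w z = c * rot f w z" if "z \<noteq> w" for z
    using that by (simp add: rot(2)[OF w f] rot(2)[OF w cf])
qed

text \<open>Polarization upgrades equality of norms to equality of inner products.\<close>

lemma ip_rot:
  assumes w: "Im w \<noteq> 0" and f: "f \<in> N" "f w = 0" and g: "g \<in> N" "g w = 0"
  shows "ip (rot f w) (rot g w) = ip f g"
proof -
  have Re_eq: "Re (ip (rot f w) (rot g w)) = Re (ip f g)" if f: "f \<in> N" "f w = 0" for f
  proof -
    have fg: "(\<lambda>z. f z + g z) \<in> N" "f w + g w = 0" using f g add_mem by auto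
    show ?thesis
      using nrm_power2_add[OF f(1) g(1)] nrm_power2_add[OF rot(1)[OF w f] rot(1)[OF w g]]
        rot(3)[OF w fg] rot(3)[OF w f] rot(3)[OF w g] rot_add[OF w f g] by simp
  qed
  have "Re (ip (rot (\<lambda>z. \<i> * f z) w) (rot g w)) = Re (ip (\<lambda>z. \<i> * f z) g)"
    by (rule Re_eq) (use f scale_mem in auto)
  then have "Im (ip (rot f w) (rot g w)) = Im (ip f g)"
    by (simp add: rot_scale[OF w f] ip_scale_left rot[OF w f] rot[OF w g] f g)
  with Re_eq[OF f] show ?thesis by (simp add: complex_eq_iff)
qed

text \<open>The two sides represent, up to a factor, the same evaluation functional on \<open>{h \<in> N. h (-\<i>) = 0}\<close>.\<close>

lemma kernel_transform:
  assumes c: "c \<noteq> \<i>" "c \<noteq> -\<i>" and z: "z \<noteq> \<i>"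
  shows "(z + \<i>) / (z - \<i>) * (K c z - K c \<i> / K \<i> \<i> * K \<i> z) =
    (cnj c + \<i>) / (cnj c - \<i>) * (K c z - K c (-\<i>) / K (-\<i>) (-\<i>) * K (-\<i>) z)"
proof -
  \<comment> \<open>\<open>A\<close> and \<open>B\<close> represent evaluation at \<open>c\<close>
    on the subspaces of functions vanishing at \<open>\<i>\<close> and at
    \<open>-\<i>\<close>.\<close>
  define A where "A = (\<lambda>z. K c z - K c \<i> / K \<i> \<i> * K \<i> z)"
  define B where "B = (\<lambda>z. K c z - K c (-\<i>) / K (-\<i>) (-\<i>) * K (-\<i>) z)"
  have nz: "K w w \<noteq> 0" for w using K_self[of w] by simp
  have A: "A \<in> N" unfolding A_def by (intro diff_mem scale_mem K)
  have A': "A \<i> = 0" unfolding A_def using nz[of \<i>] by simp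
  note A = A A'
  have B: "B \<in> N" unfolding B_def by (intro diff_mem scale_mem K)
  have B': "B (-\<i>) = 0" unfolding B_def using nz[of "-\<i>"] by simp
  note B = B B'
  have ipA: "ip g A = g c" if "g \<in> N" "g \<i> = 0" for g
    unfolding A_def ip_diff_right[OF K(1) scale_mem[OF K(1)] that(1)] ip_scale_right[OF K(1) that(1)] K(2)[OF that(1)]
    by (simp add: that(2))
  have ipB: "ip g B = g c" if "g \<in> N" "g (-\<i>) = 0" for g
    unfolding B_def ip_diff_right[OF K(1) scale_mem[OF K(1)] that(1)] ip_scale_right[OF K(1) that(1)] K(2)[OF that(1)]
    by (simp add: that(2))
  have i: "Im \<i> \<noteq> 0" "Im (-\<i>) \<noteq> 0" by auto
  define s where "s = (cnj c + \<i>) / (cnj c - \<i>)"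
  define TA where "TA = rot A \<i>"
  have TA: "TA \<in> N" "TA (-\<i>) = 0" unfolding TA_def using rot[OF i(1) A] by (auto simp: complex_eq_iff)
  \<comment> \<open>\<open>D\<close> lies in the subspace of functions vanishing at
    \<open>-\<i>\<close> and will be orthogonal to it. The factor \<open>s\<close> is the conjugate
    of \<open>(c - \<i>) / (c + \<i>)\<close>, the multiplier of \<open>rot h (-\<i>)\<close> at
    \<open>c\<close>.\<close>
  define D where "D = (\<lambda>z. TA z - s * B z)"
  have D: "D \<in> N" "D (-\<i>) = 0" unfolding D_def using TA B by (auto intro!: diff_mem scale_mem)
  have ipD: "ip h D = 0" if h: "h \<in> N" "h (-\<i>) = 0" for h
  proof -
    define g where "g = rot h (-\<i>)"
    have g: "g \<in> N" "g \<i> = 0" unfolding g_def using rot[OF i(2) h] by (auto simp: complex_eq_iff)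
    have gz: "g z = (z - \<i>) / (z + \<i>) * h z" if "z \<noteq> -\<i>" for z
      using rot(2)[OF i(2) h that] by (simp add: g_def)
    have "rot g \<i> = h"
    proof (rule entire_eq_off_point[of _ _ \<i>])
      show "rot g \<i> holomorphic_on UNIV" "h holomorphic_on UNIV" by (intro holo rot i g h)+
      fix z assume z: "z \<noteq> \<i>"
      show "rot g \<i> z = h z"
      proof (cases "z = -\<i>")
        case True
        then show ?thesis using rot(2)[OF i(1) g z] h(2) by simp
      next
        case False
        then have "z - \<i> \<noteq> 0" "z + \<i> \<noteq> 0" using z by (auto simp: add_eq_0_iff2)
        then show ?thesis using rot(2)[OF i(1) g z] gz[OF False] by simp
      qed
    qed
    then have "ip h TA = ip g A"
      unfolding TA_def using ip_rot[OF i(1) g A] by simp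
    also have "\<dots> = (c - \<i>) / (c + \<i>) * h c" using ipA[OF g] gz[OF c(2)] by simp
    also have "\<dots> = cnj s * ip h B" using ipB[OF h] by (simp add: s_def)
    finally show ?thesis
      unfolding D_def using ip_diff_right[OF TA(1) scale_mem[OF B(1)] h(1)] ip_scale_right[OF B(1) h(1)] by simp
  qed
  have "D = (\<lambda>_. 0)" using ip_self_eq_0[OF D(1) ipD[OF D]] .
  then have "TA z = s * B z" by (simp add: D_def fun_eq_iff)
  then show ?thesis using rot(2)[OF i(1) A z] by (simp add: TA_def A_def B_def s_def)
qed

text \<open>After cross-multiplication in \<open>kernel_transform\<close> each correction term is a
  function of \<open>z\<close> times a conjugated function of \<open>c\<close>; \<open>P\<close> and
  \<open>Q\<close> are these factors. Dividing by the norm splits \<open>1 / K \<i> \<i>\<close>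
  evenly between the two.\<close>

definition P where "P z = (z + \<i>) * K \<i> z / of_real (nrm (K \<i>))"
definition Q where "Q z = (z - \<i>) * K (-\<i>) z / of_real (nrm (K (-\<i>)))"

lemma PQ_holomorphic: "P holomorphic_on A" "Q holomorphic_on A"
  unfolding P_def Q_def using K_self(2)[of \<i>] K_self(2)[of "-\<i>"] by (intro holomorphic_intros holo K(1); simp)+

lemma Q_i: "Q \<i> = 0" and P_mi: "P (-\<i>) = 0"
  by (simp_all add: P_def Q_def)

lemma P_i: "P \<i> = 2 * \<i> * nrm (K \<i>)" and Q_mi: "Q (-\<i>) = - 2 * \<i> * nrm (K (-\<i>))"
  using K_self[of \<i>] K_self[of "-\<i>"] by (simp_all add: P_def Q_def power2_eq_square)

text \<open>Cross-multiplying \<open>kernel_transform\<close> leaves \<open>K c z\<close> with the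
  coefficient \<open>2 * \<i> * (z - cnj c)\<close>. The points \<open>\<i>\<close> and
  \<open>-\<i>\<close>, excluded there, are settled directly by \<open>Q \<i> = 0\<close> and
  \<open>P (-\<i>) = 0\<close>, and in the other variable by Hermitian symmetry.\<close>

lemma K_formula: "2 * \<i> * (z - cnj c) * K c z = Q z * cnj (Q c) - P z * cnj (P c)"
proof -
  define F where "F z c \<longleftrightarrow> 2 * \<i> * (z - cnj c) * K c z = Q z * cnj (Q c) - P z * cnj (P c)" for z c
  have n: "nrm (K \<i>) \<noteq> 0" "nrm (K (-\<i>)) \<noteq> 0" using K_self(2)[of \<i>] K_self(2)[of "-\<i>"] by auto
  have ci: "F z \<i>" for z
  proof -
    have "P z * nrm (K \<i>) = (z + \<i>) * K \<i> z" using n by (simp add: P_def)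
    then show ?thesis unfolding F_def Q_i P_i by simp
  qed
  have cmi: "F z (-\<i>)" for z
  proof -
    have "Q z * nrm (K (-\<i>)) = (z - \<i>) * K (-\<i>) z" using n by (simp add: Q_def)
    then show ?thesis unfolding F_def P_mi Q_mi by simp
  qed
  have sym: "F z c" if "F c z" for z c
    using arg_cong[OF that[unfolded F_def], of cnj] K_cnj[of z c] unfolding F_def by (simp add: algebra_simps)
  have "F z c"
  proof (cases "c = \<i> \<or> c = -\<i> \<or> z = \<i> \<or> z = -\<i>")
    case True
    then show ?thesis by (elim disjE) (auto intro: ci cmi sym)
  next
    case False
    then have c: "c \<noteq> \<i>" "c \<noteq> -\<i>" and z: "z \<noteq> \<i>" by auto
    have z2: "z - \<i> \<noteq> 0" using z by simp
    have c2: "cnj c - \<i> \<noteq> 0" using c(2) by (auto simp: complex_eq_iff)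
    note T = kernel_transform[OF c z]
    have cross: "a * d * X = b * e * Y" if "a / e * X = b / d * Y" "e \<noteq> 0" "d \<noteq> 0" for a b d e X Y :: complex
      using that by (simp add: field_simps)
    have 1: "K c \<i> = cnj (K \<i> c)" "K c (-\<i>) = cnj (K (-\<i>) c)" by (rule K_cnj)+
    have "(z + \<i>) * (cnj c - \<i>) * (K c z - K c \<i> / K \<i> \<i> * K \<i> z) =
      (cnj c + \<i>) * (z - \<i>) * (K c z - K c (-\<i>) / K (-\<i>) (-\<i>) * K (-\<i>) z)"
      by (rule cross[OF T z2 c2])
    then have "((cnj c + \<i>) * (z - \<i>) - (z + \<i>) * (cnj c - \<i>)) * K c z =
      (cnj c + \<i>) * (z - \<i>) * (K c (-\<i>) / K (-\<i>) (-\<i>) * K (-\<i>) z)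
      - (z + \<i>) * (cnj c - \<i>) * (K c \<i> / K \<i> \<i> * K \<i> z)"
      by (simp add: algebra_simps)
    moreover have "(cnj c + \<i>) * (z - \<i>) - (z + \<i>) * (cnj c - \<i>) = 2 * \<i> * (z - cnj c)"
      by (simp add: algebra_simps)
    moreover have "(cnj c + \<i>) * (z - \<i>) * (K c (-\<i>) / K (-\<i>) (-\<i>) * K (-\<i>) z) = Q z * cnj (Q c)"
      unfolding Q_def 1 K_self(1)[of "-\<i>"] by (simp add: power2_eq_square)
    moreover have "(z + \<i>) * (cnj c - \<i>) * (K c \<i> / K \<i> \<i> * K \<i> z) = P z * cnj (P c)"
      unfolding P_def 1 K_self(1)[of \<i>] by (simp add: power2_eq_square)
    ultimately show ?thesis by (simp add: F_def)
  qed
  then show ?thesis by (simp add: F_def)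
qed

text \<open>The diagonal \<open>c = z\<close> of the kernel formula; the sign of \<open>Im z\<close>
  decides which of \<open>P\<close> and \<open>Q\<close> is larger, the source of the
  Hermite-Biehler inequality.\<close>

lemma P_Q_norm: "(cmod (P z))\<^sup>2 = (cmod (Q z))\<^sup>2 + 4 * Im z * (nrm (K z))\<^sup>2"
proof -
  have "2 * \<i> * (z - cnj z) * K z z = of_real ((cmod (Q z))\<^sup>2 - (cmod (P z))\<^sup>2)"
    unfolding K_formula of_real_diff complex_norm_square ..
  moreover have "2 * \<i> * (z - cnj z) * K z z = of_real (- 4 * Im z * (nrm (K z))\<^sup>2)"
    unfolding K_self(1) by (simp add: complex_eq_iff)
  ultimately have "(cmod (Q z))\<^sup>2 - (cmod (P z))\<^sup>2 = - 4 * Im z * (nrm (K z))\<^sup>2"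
    by (simp only: of_real_eq_iff)
  then show ?thesis by simp
qed

lemma Q_less_P: "0 < Im z \<Longrightarrow> cmod (Q z) < cmod (P z)"
  using P_Q_norm[of z] K_self(2)[of z] power2_less_imp_less[of "cmod (Q z)" "cmod (P z)"] by simp

lemma P_less_Q: "Im z < 0 \<Longrightarrow> cmod (P z) < cmod (Q z)"
  using P_Q_norm[of z] K_self(2)[of z] power2_less_imp_less[of "cmod (P z)" "cmod (Q z)"]
  by (simp add: mult_neg_pos)

text \<open>\<open>P\<close> and \<open>Q\<close> have equal modulus on the real line, so a zero of
  one is common to both; then the kernel formula at \<open>c = x\<close> would force
  \<open>K x\<close> to vanish off \<open>x\<close>.\<close>

lemma PQ_real_nonzero:
  assumes "Im x = 0"
  shows "P x \<noteq> 0" "Q x \<noteq> 0"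
proof -
  have eq: "cmod (P x) = cmod (Q x)" using P_Q_norm[of x] assms by (simp add: power2_eq_iff_nonneg)
  have "Q x \<noteq> 0"
  proof
    assume Q0: "Q x = 0"
    then have P0: "P x = 0" using eq by simp
    have "cnj x = x" using assms by (simp add: complex_eq_iff)
    obtain z where z: "z \<noteq> x" "K x z \<noteq> 0" using K_nonzero by blast
    show False using K_formula[of z x] z Q0 P0 \<open>cnj x = x\<close> by simp
  qed
  then show "P x \<noteq> 0" "Q x \<noteq> 0" using eq by auto
qed

lemma P_nonzero: "0 \<le> Im z \<Longrightarrow> P z \<noteq> 0"
  using PQ_real_nonzero[of z] Q_less_P[of z] by (cases "Im z = 0") auto

lemma Q_nonzero: "Im z \<le> 0 \<Longrightarrow> Q z \<noteq> 0"
  using PQ_real_nonzero[of z] P_less_Q[of z] by (cases "Im z = 0") auto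

lemma K_i_nonzero: "0 \<le> Im z \<Longrightarrow> K \<i> z \<noteq> 0"
  using P_nonzero[of z] by (auto simp: P_def)

text \<open>At \<open>c = cnj z\<close> the kernel side of the formula vanishes.\<close>

lemma PQ_sharp: "P z * sharp P z = Q z * sharp Q z"
  using K_formula[of z "cnj z"] by (simp add: sharp_def)

end

section \<open>The unimodular factor\<close>

lemma sharp_holomorphic: "f holomorphic_on UNIV \<Longrightarrow> sharp f holomorphic_on UNIV"
proof -
  assume f: "f holomorphic_on UNIV"
  have "range cnj = UNIV" by (rule surjI[of _ cnj]) simp
  then show ?thesis using holomorphic_on_compose_cnj_cnj[of f UNIV] f by (simp add: sharp_def[abs_def] o_def)
qed

lemma sharp_sharp [simp]: "sharp (sharp f) = f"
  by (simp add: sharp_def)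

text \<open>With this scaling \<open>exp (\<i> * \<gamma> z)\<close> is a square root. Dividing by
  \<open>v 0\<close> permits \<open>\<gamma> 0 = 0\<close>, which later rules out a constant term in
  the linear exponent.\<close>

lemma unimodular_entire_log:
  assumes hol: "v holomorphic_on UNIV" and nz: "\<And>z. v z \<noteq> 0" and uni: "\<And>z. v z * sharp v z = 1"
  obtains \<gamma> where "\<gamma> holomorphic_on UNIV" "\<gamma> 0 = 0" "sharp \<gamma> = \<gamma>" "\<And>z. exp (2 * \<i> * \<gamma> z) = v z / v 0"
proof -
  obtain L where L: "L holomorphic_on UNIV" "\<And>z. exp (L z) = v z"
    using holomorphic_logarithm_exists[OF convex_UNIV open_UNIV hol, of 0] nz by auto
  define \<gamma> where "\<gamma> z = (L z - L 0) / (2 * \<i>)" for z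
  have h\<gamma>: "\<gamma> holomorphic_on UNIV" unfolding \<gamma>_def by (intro holomorphic_intros L) auto
  have e\<gamma>: "exp (2 * \<i> * \<gamma> z) = v z / v 0" for z
    by (simp add: \<gamma>_def exp_diff L(2))
  define d where "d z = 2 * \<i> * (\<gamma> z - sharp \<gamma> z)" for z
  have hd: "d holomorphic_on UNIV" unfolding d_def by (intro holomorphic_intros h\<gamma> sharp_holomorphic)
  have "exp (d z) = 1" for z
  proof -
    have "exp (d z) = exp (2 * \<i> * \<gamma> z) * cnj (exp (2 * \<i> * \<gamma> (cnj z)))"
      unfolding d_def sharp_def exp_cnj exp_add[symmetric] by (simp add: algebra_simps)
    also have "\<dots> = (v z * sharp v z) / (v 0 * sharp v 0)"
      unfolding e\<gamma> by (simp add: sharp_def)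
    finally show ?thesis by (simp add: uni)
  qed
  \<comment> \<open>\<open>exp (d z) = 1\<close> makes \<open>d\<close> constant: differentiating
    leaves the derivative of \<open>d\<close> times a nonvanishing factor.\<close>
  have "(d has_field_derivative 0) (at z within UNIV)" for z
  proof -
    have d: "(d has_field_derivative deriv d z) (at z)"
      by (rule holomorphic_derivI[OF hd]) auto
    have "((\<lambda>z. exp (d z)) has_field_derivative exp (d z) * deriv d z) (at z)"
      by (rule DERIV_chain2[OF DERIV_exp d])
    moreover have "((\<lambda>z. exp (d z)) has_field_derivative 0) (at z)"
      using \<open>\<And>z. exp (d z) = 1\<close> by simp
    ultimately have "exp (d z) * deriv d z = 0" by (rule DERIV_unique)
    then show ?thesis using d by simp
  qed
  then obtain c where "\<And>z. d z = c"
    using has_field_derivative_zero_constant[OF convex_UNIV] by (metis UNIV_I)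
  moreover have "d 0 = 0" by (simp add: d_def sharp_def \<gamma>_def)
  ultimately have "d z = 0" for z by metis
  then have "sharp \<gamma> = \<gamma>" by (auto simp: d_def fun_eq_iff)
  then show ?thesis using that h\<gamma> e\<gamma> by (auto simp: \<gamma>_def)
qed

section \<open>The quotient of the two kernel factors and the function \<open>E\<close>\<close>

context debranges_like begin

text \<open>By the identity \<open>P P\<^sup># = Q Q\<^sup>#\<close> this is the entire function \<open>P\<^sup># / Q\<close>.\<close>

definition phase :: "complex \<Rightarrow> complex" where
  "phase z = (if Q z \<noteq> 0 then sharp P z / Q z else sharp Q z / P z)"

lemma phase_eq: "P z \<noteq> 0 \<Longrightarrow> phase z = sharp Q z / P z"
  using PQ_sharp[of z] by (simp add: phase_def field_simps)

lemma P_or_Q_nonzero: "P z \<noteq> 0 \<or> Q z \<noteq> 0"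
  using P_nonzero[of z] Q_nonzero[of z] by linarith

lemma sharp_P_eq: "sharp P z = phase z * Q z"
proof (cases "Q z = 0")
  case True
  then have "sharp P z = 0" using PQ_sharp[of z] P_or_Q_nonzero[of z] by simp
  then show ?thesis using True by simp
qed (simp add: phase_def)

lemma phase_holomorphic: "phase holomorphic_on UNIV"
proof -
  have c: "continuous_on UNIV P" "continuous_on UNIV Q"
    by (intro holomorphic_on_imp_continuous_on PQ_holomorphic)+
  have o: "open {z. P z \<noteq> 0}" "open {z. Q z \<noteq> 0}"
    using open_Collect_neq[OF c(1) continuous_on_const] open_Collect_neq[OF c(2) continuous_on_const] by auto
  have s: "sharp P holomorphic_on UNIV" "sharp Q holomorphic_on UNIV"
    by (intro sharp_holomorphic PQ_holomorphic)+
  have "(\<lambda>z. sharp P z / Q z) holomorphic_on {z. Q z \<noteq> 0}"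
    by (intro holomorphic_intros PQ_holomorphic holomorphic_on_subset[OF s(1)]) auto
  then have 1: "phase holomorphic_on {z. Q z \<noteq> 0}"
    by (rule holomorphic_transform) (simp add: phase_def)
  have "(\<lambda>z. sharp Q z / P z) holomorphic_on {z. P z \<noteq> 0}"
    by (intro holomorphic_intros PQ_holomorphic holomorphic_on_subset[OF s(2)]) auto
  then have 2: "phase holomorphic_on {z. P z \<noteq> 0}"
    by (rule holomorphic_transform) (simp add: phase_eq)
  have "phase holomorphic_on ({z. Q z \<noteq> 0} \<union> {z. P z \<noteq> 0})"
    by (rule holomorphic_on_Un[OF 1 2 o(2,1)])
  also have "{z. Q z \<noteq> 0} \<union> {z. P z \<noteq> 0} = UNIV" using P_or_Q_nonzero by auto
  finally show ?thesis .
qed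

text \<open>\<open>sharp\<close> exchanges the half-planes, so in each of them one of the two
  quotients has both numerator and denominator without zeros.\<close>

lemma phase_nonzero: "phase z \<noteq> 0"
proof (cases "Im z \<le> 0")
  case True
  then have "Q z \<noteq> 0" "sharp P z \<noteq> 0"
    using Q_nonzero[of z] P_nonzero[of "cnj z"] by (auto simp: sharp_def)
  then show ?thesis by (simp add: phase_def)
next
  case False
  then have "P z \<noteq> 0" "sharp Q z \<noteq> 0"
    using P_nonzero[of z] Q_nonzero[of "cnj z"] by (auto simp: sharp_def)
  then show ?thesis by (simp add: phase_eq)
qed

lemma phase_sharp: "phase z * sharp phase z = 1"
proof -
  have *: "phase z * sharp phase z = 1" if "Im z \<le> 0" for z
  proof -
    have "Q z \<noteq> 0" "sharp P z \<noteq> 0" "P (cnj z) \<noteq> 0"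
      using that Q_nonzero[of z] P_nonzero[of "cnj z"] by (auto simp: sharp_def)
    then show ?thesis
      by (simp add: sharp_def[of phase] phase_eq) (simp add: phase_def sharp_def)
  qed
  show ?thesis
  proof (cases "Im z \<le> 0")
    case False
    then have "phase (cnj z) * sharp phase (cnj z) = 1" using *[of "cnj z"] by simp
    from arg_cong[OF this, of cnj] show ?thesis
      by (simp add: sharp_def mult.commute)
  qed (rule *)
qed

end

text \<open>\<gamma> comes from an existence statement, so it is a parameter here; the final proof
  supplies it through \<open>unimodular_entire_log\<close>.\<close>

locale debranges_factor = debranges_like +
  fixes \<gamma> :: "complex \<Rightarrow> complex"
  assumes \<gamma>_hol: "\<gamma> holomorphic_on UNIV" and \<gamma>_0: "\<gamma> 0 = 0" and \<gamma>_sharp: "sharp \<gamma> = \<gamma>"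
    and \<gamma>_phase: "\<And>z. exp (2 * \<i> * \<gamma> z) = phase z / phase 0"
begin

definition u where "u z = exp (\<i> * \<gamma> z)"
text \<open>The factor \<open>sqrt pi\<close> turns the coefficient \<open>2 * \<i>\<close> of
  \<open>K_formula\<close> into the coefficient \<open>\<i> / (2 * pi)\<close> of the reproducing
  kernel that belongs to \<open>deBranges_norm\<close>.\<close>

definition E where "E z = of_real (sqrt pi) * u z * P z"

lemma u_hol: "u holomorphic_on A"
  unfolding u_def by (intro holomorphic_intros holomorphic_on_subset[OF \<gamma>_hol]) auto

lemma u_nz [simp]: "u z \<noteq> 0" by (simp add: u_def)

lemma sharp_u: "sharp u z = 1 / u z"
proof -
  have "cnj (\<gamma> (cnj z)) = \<gamma> z" using \<gamma>_sharp by (metis sharp_def)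
  then show ?thesis by (simp add: sharp_def u_def exp_cnj exp_minus divide_inverse)
qed

lemma u_square: "u z * u z = phase z / phase 0"
  using \<gamma>_phase[of z] by (simp add: u_def mult.assoc flip: exp_add mult_2)

lemma cmod_phase_0: "cmod (phase 0) = 1"
proof -
  have "of_real ((cmod (phase 0))\<^sup>2) = (of_real 1 :: complex)"
    using phase_sharp[of 0] unfolding complex_norm_square by (simp add: sharp_def)
  then have "(cmod (phase 0))\<^sup>2 = 1\<^sup>2" unfolding of_real_eq_iff by simp
  then show ?thesis by (rule power2_eq_imp_eq) auto
qed

lemma E_hol: "E holomorphic_on A"
  unfolding E_def by (intro holomorphic_intros u_hol PQ_holomorphic)

text \<open>This is why a square root of \<open>phase\<close> is taken: \<open>sharp P\<close>
  contributes \<open>phase\<close>, \<open>sharp u\<close> contributes \<open>1 / u\<close>, and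
  \<open>phase / u\<close> is again a constant times \<open>u\<close>.\<close>

lemma sharp_E: "sharp E z = of_real (sqrt pi) * phase 0 * u z * Q z"
proof -
  have "sharp E z = of_real (sqrt pi) * sharp u z * sharp P z"
    by (simp add: sharp_def E_def)
  also have "\<dots> = of_real (sqrt pi) * (phase z / u z) * Q z" by (simp add: sharp_u sharp_P_eq)
  also have "phase z / u z = phase 0 * u z"
    using u_square[of z] phase_nonzero[of 0] by (simp add: field_simps)
  finally show ?thesis by simp
qed

lemma E_nz: "0 \<le> Im z \<Longrightarrow> E z \<noteq> 0"
  using P_nonzero[of z] by (simp add: E_def)

lemma HB_E: "HB E"
proof -
  have "cmod (E (cnj z)) < cmod (E z)" if "0 < Im z" for z
  proof -
    have "cmod (E (cnj z)) = cmod (sharp E z)" by (simp add: sharp_def)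
    also have "\<dots> = sqrt pi * cmod (u z) * cmod (Q z)"
      by (simp add: sharp_E norm_mult cmod_phase_0)
    also have "\<dots> < sqrt pi * cmod (u z) * cmod (P z)"
      using Q_less_P[OF that] by (intro mult_strict_left_mono) auto
    finally show ?thesis by (simp add: E_def norm_mult)
  qed
  then show ?thesis by (simp add: HB_def E_hol)
qed

text \<open>The unimodular constant \<open>phase 0\<close> cancels and
  \<open>u z * cnj (u c)\<close> factors out, so the kernel transported by \<open>u\<close> has the
  form of a de Branges kernel.\<close>

lemma E_kernel:
  "(z - cnj c) * (u z * K c z * cnj (u c)) = \<i> / (2 * pi) * (E z * cnj (E c) - sharp E z * cnj (sharp E c))"
proof -
  have s: "complex_of_real (sqrt pi) * complex_of_real (sqrt pi) = of_real pi"
    by (simp flip: of_real_mult)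
  have p: "phase 0 * cnj (phase 0) = 1"
    using cmod_phase_0 by (simp add: complex_norm_square[symmetric])
  have "E z * cnj (E c) - sharp E z * cnj (sharp E c) =
    (of_real (sqrt pi) * of_real (sqrt pi)) * (u z * cnj (u c)) * (P z * cnj (P c) - (phase 0 * cnj (phase 0)) * (Q z * cnj (Q c)))"
    unfolding E_def sharp_E by (simp add: algebra_simps)
  also have "\<dots> = - of_real pi * (u z * cnj (u c)) * (2 * \<i> * (z - cnj c) * K c z)"
    unfolding s p K_formula by (simp add: algebra_simps)
  finally have eq: "E z * cnj (E c) - sharp E z * cnj (sharp E c) = - of_real pi * (u z * cnj (u c)) * (2 * \<i> * (z - cnj c) * K c z)" .
  have alg: "\<i> / (2 * p) * (- p * (a * b) * (2 * \<i> * X * k)) = X * (a * k * b)" if "p \<noteq> 0" for p a b X k :: complex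
  proof -
    have "- p * (a * b) * (2 * \<i> * X * k) = (2 * p) * (- \<i> * (X * (a * k * b)))" by (simp add: mult_ac)
    moreover have "\<i> / (2 * p) * ((2 * p) * w) = \<i> * w" for w using that by simp
    ultimately show ?thesis by (metis complex_i_mult_minus minus_mult_left minus_minus)
  qed
  show ?thesis unfolding eq using alg[of "of_real pi"] by simp
qed

end

section \<open>De Branges spaces\<close>

lemma L2_Cauchy_Schwarz:
  fixes a b :: "real \<Rightarrow> complex"
  assumes [measurable]: "a \<in> borel_measurable lborel" "b \<in> borel_measurable lborel"
    and A: "integrable lborel (\<lambda>x. (cmod (a x))\<^sup>2)" and B: "integrable lborel (\<lambda>x. (cmod (b x))\<^sup>2)"
  shows "integrable lborel (\<lambda>x. a x * cnj (b x))"
    and "(cmod (\<integral>x. a x * cnj (b x) \<partial>lborel))\<^sup>2 \<le> (\<integral>x. (cmod (a x))\<^sup>2 \<partial>lborel) * (\<integral>x. (cmod (b x))\<^sup>2 \<partial>lborel)"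
proof -
  have [measurable]: "(\<lambda>x. cnj (b x)) \<in> borel_measurable lborel"
    by (rule measurable_compose[OF assms(2)], rule borel_measurable_continuous_onI, intro continuous_intros)
  have AB: "integrable lborel (\<lambda>x. (cmod (a x))\<^sup>2 + (cmod (b x))\<^sup>2)"
    by (intro Bochner_Integration.integrable_add A B)
  have am: "p * q \<le> p\<^sup>2 + q\<^sup>2" if "0 \<le> p" "0 \<le> q" for p q :: real
  proof -
    have "0 \<le> (p - q)\<^sup>2" by simp
    moreover have "0 \<le> p * q" using that by simp
    ultimately show ?thesis by (simp add: power2_diff)
  qed
  have N: "integrable lborel (\<lambda>x. cmod (a x) * cmod (b x))"
    by (rule Bochner_Integration.integrable_bound[OF AB]) (auto intro!: am)
  show I: "integrable lborel (\<lambda>x. a x * cnj (b x))"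
    by (rule Bochner_Integration.integrable_bound[OF N]) (auto simp: norm_mult)
  have "(\<integral>x. cmod (a x) * cmod (b x) \<partial>lborel)\<^sup>2 \<le> (\<integral>x. (cmod (a x))\<^sup>2 \<partial>lborel) * (\<integral>x. (cmod (b x))\<^sup>2 \<partial>lborel)"
  proof (rule power2_le_of_discriminant)
    fix t :: real
    have "0 \<le> (\<integral>x. (cmod (a x) - t * cmod (b x))\<^sup>2 \<partial>lborel)" by simp
    also have "\<dots> = (\<integral>x. (cmod (a x))\<^sup>2 - 2 * t * (cmod (a x) * cmod (b x)) + t\<^sup>2 * (cmod (b x))\<^sup>2 \<partial>lborel)"
      by (simp add: power2_diff power_mult_distrib algebra_simps)
    also have "\<dots> = (\<integral>x. (cmod (a x))\<^sup>2 \<partial>lborel) - 2 * t * (\<integral>x. cmod (a x) * cmod (b x) \<partial>lborel) + t\<^sup>2 * (\<integral>x. (cmod (b x))\<^sup>2 \<partial>lborel)"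
      by (subst Bochner_Integration.integral_add Bochner_Integration.integral_diff;
          (intro Bochner_Integration.integrable_diff integrable_mult_right A B N)?)+ simp
    finally show "0 \<le> (\<integral>x. (cmod (a x))\<^sup>2 \<partial>lborel) - 2 * t * (\<integral>x. cmod (a x) * cmod (b x) \<partial>lborel) + t\<^sup>2 * (\<integral>x. (cmod (b x))\<^sup>2 \<partial>lborel)" .
  qed simp
  moreover have "cmod (\<integral>x. a x * cnj (b x) \<partial>lborel) \<le> (\<integral>x. cmod (a x) * cmod (b x) \<partial>lborel)"
    using integral_norm_bound[of lborel "\<lambda>x. a x * cnj (b x)"] by (simp add: norm_mult)
  ultimately show "(cmod (\<integral>x. a x * cnj (b x) \<partial>lborel))\<^sup>2 \<le> (\<integral>x. (cmod (a x))\<^sup>2 \<partial>lborel) * (\<integral>x. (cmod (b x))\<^sup>2 \<partial>lborel)"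
    by (meson norm_ge_zero order_trans power_mono)
qed

text \<open>Meant for reproducing kernels, with \<open>a = cnj c\<close> possibly inside the
  half-plane. The decay says nothing at \<open>a\<close> itself; near it compactness takes
  over.\<close>

lemma hardy2_of_decay:
  assumes c: "continuous_on {z. 0 \<le> Im z} F" and h: "F holomorphic_on {z. 0 < Im z}"
    and b: "\<And>z. 0 \<le> Im z \<Longrightarrow> cmod (F z) * cmod (z - a) \<le> C"
  obtains D where "hardy2 F D"
proof -
  have "compact ({z. 0 \<le> Im z} \<inter> cball a 1)"
    by (intro closed_Int_compact closed_halfspace_Im_ge) auto
  then have "bounded (F ` ({z. 0 \<le> Im z} \<inter> cball a 1))"
    by (intro compact_imp_bounded compact_continuous_image continuous_on_subset[OF c]) auto
  then obtain B where B: "0 < B" "\<And>z. 0 \<le> Im z \<Longrightarrow> z \<in> cball a 1 \<Longrightarrow> cmod (F z) \<le> B"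
    by (auto simp: bounded_pos)
  \<comment> \<open>The 2 comes from \<open>(x - Re a)\<^sup>2 + 1 \<le> 2\<close> within distance 1
    of \<open>a\<close> and \<open>(x - Re a)\<^sup>2 + 1 \<le> r\<^sup>2 * 2\<close>
    beyond.\<close>
  define M where "M = (max B \<bar>C\<bar>)\<^sup>2 * 2"
  have M: "0 \<le> M" by (simp add: M_def)
  have bound: "(cmod (F (Complex x y)))\<^sup>2 \<le> M * (1 / ((x - Re a)\<^sup>2 + 1\<^sup>2))" if y: "0 \<le> y" for x y
  proof -
    let ?z = "Complex x y"
    define r where "r = cmod (?z - a)"
    have le: "(x - Re a)\<^sup>2 \<le> r\<^sup>2" by (simp add: r_def cmod_power2)
    have pos: "0 < (x - Re a)\<^sup>2 + 1" by (simp add: add_nonneg_pos)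
    have "(cmod (F ?z))\<^sup>2 * ((x - Re a)\<^sup>2 + 1) \<le> M"
    proof (cases "r \<le> 1")
      case True
      then have "cmod (F ?z) \<le> B" using B(2)[of ?z] y by (simp add: r_def dist_norm norm_minus_commute)
      then have 1: "(cmod (F ?z))\<^sup>2 \<le> (max B \<bar>C\<bar>)\<^sup>2" by (intro power_mono) auto
      have "r\<^sup>2 \<le> 1" using True by (simp add: r_def power_le_one)
      then have 2: "(x - Re a)\<^sup>2 + 1 \<le> 2" using le by simp
      show ?thesis unfolding M_def using 1 2 pos by (intro mult_mono) auto
    next
      case False
      then have "1 \<le> r\<^sup>2" by (simp add: one_le_power)
      then have 2: "(x - Re a)\<^sup>2 + 1 \<le> r\<^sup>2 * 2" using le by simp
      have "cmod (F ?z) * r \<le> max B \<bar>C\<bar>" 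
      proof -
        have "cmod (F ?z) * r \<le> C" using b[of ?z] y by (simp add: r_def)
        then show ?thesis by linarith
      qed
      then have 1: "(cmod (F ?z) * r)\<^sup>2 \<le> (max B \<bar>C\<bar>)\<^sup>2"
        by (intro power_mono) (auto simp: r_def)
      have "(cmod (F ?z))\<^sup>2 * ((x - Re a)\<^sup>2 + 1) \<le> (cmod (F ?z))\<^sup>2 * (r\<^sup>2 * 2)"
        using 2 by (intro mult_left_mono) auto
      also have "\<dots> \<le> M" using 1 by (simp add: M_def power_mult_distrib)
      finally show ?thesis .
    qed
    then show ?thesis using pos by (simp add: field_simps)
  qed
  have "hardy2 F (M * pi)"
    unfolding hardy2_def
  proof (intro conjI allI impI c h)
    show "0 \<le> M * pi" using M by simp
    fix y :: real assume y: "0 \<le> y"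
    have i: "has_bochner_integral lborel (\<lambda>x. M * (1 / ((x - Re a)\<^sup>2 + 1\<^sup>2))) (M * (pi / 1))"
      by (intro has_bochner_integral_mult_right has_bochner_integral_Poisson) auto
    have "(\<integral>\<^sup>+x. ennreal ((cmod (F (Complex x y)))\<^sup>2) \<partial>lborel) \<le> (\<integral>\<^sup>+x. ennreal (M * (1 / ((x - Re a)\<^sup>2 + 1\<^sup>2))) \<partial>lborel)"
      by (intro nn_integral_mono ennreal_leI bound y)
    also have "\<dots> = ennreal (M * pi)"
      using i M by (subst nn_integral_eq_integral) (auto simp: has_bochner_integral_iff)
    finally show "(\<integral>\<^sup>+x. ennreal ((cmod (F (Complex x y)))\<^sup>2) \<partial>lborel) \<le> ennreal (M * pi)" .
  qed
  then show ?thesis by (rule that)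
qed

lemma hardy2_add:
  assumes "hardy2 f A" "hardy2 g B"
  shows "hardy2 (\<lambda>z. f z + g z) (2 * A + 2 * B)"
  unfolding hardy2_def
proof (intro conjI allI impI)
  show "continuous_on {z. 0 \<le> Im z} (\<lambda>z. f z + g z)" "(\<lambda>z. f z + g z) holomorphic_on {z. 0 < Im z}"
    using assms unfolding hardy2_def by (auto intro!: continuous_intros holomorphic_intros)
  have AB: "0 \<le> A" "0 \<le> B" using assms by (auto simp: hardy2_def)
  then show "0 \<le> 2 * A + 2 * B" by simp
  fix y :: real assume y: "0 \<le> y"
  have [measurable]: "(\<lambda>x. f (Complex x y)) \<in> borel_measurable borel" "(\<lambda>x. g (Complex x y)) \<in> borel_measurable borel"
    using hardy2_measurable assms y by auto
  have "(\<integral>\<^sup>+x. ennreal ((cmod (f (Complex x y) + g (Complex x y)))\<^sup>2) \<partial>lborel) \<le>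
    (\<integral>\<^sup>+x. 2 * ennreal ((cmod (f (Complex x y)))\<^sup>2) + 2 * ennreal ((cmod (g (Complex x y)))\<^sup>2) \<partial>lborel)"
  proof (rule nn_integral_mono)
    fix x
    have "(cmod (a + b))\<^sup>2 \<le> 2 * (cmod a)\<^sup>2 + 2 * (cmod b)\<^sup>2" for a b :: complex
    proof -
      have "(cmod (a + b))\<^sup>2 \<le> (cmod a + cmod b)\<^sup>2" by (intro power_mono norm_triangle_ineq) auto
      moreover have "0 \<le> (cmod a - cmod b)\<^sup>2" by simp
      ultimately show ?thesis by (simp add: power2_sum power2_diff)
    qed
    then have "ennreal ((cmod (f (Complex x y) + g (Complex x y)))\<^sup>2) \<le> ennreal (2 * (cmod (f (Complex x y)))\<^sup>2 + 2 * (cmod (g (Complex x y)))\<^sup>2)"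
      by (rule ennreal_leI)
    then show "ennreal ((cmod (f (Complex x y) + g (Complex x y)))\<^sup>2) \<le> 2 * ennreal ((cmod (f (Complex x y)))\<^sup>2) + 2 * ennreal ((cmod (g (Complex x y)))\<^sup>2)"
      by (simp add: ennreal_mult')
  qed
  also have "\<dots> = 2 * (\<integral>\<^sup>+x. ennreal ((cmod (f (Complex x y)))\<^sup>2) \<partial>lborel) + 2 * (\<integral>\<^sup>+x. ennreal ((cmod (g (Complex x y)))\<^sup>2) \<partial>lborel)"
    by (subst nn_integral_add) (auto simp: nn_integral_cmult)
  also have "\<dots> \<le> 2 * ennreal A + 2 * ennreal B"
    using assms y unfolding hardy2_def by (intro add_mono mult_left_mono) auto
  also have "\<dots> = ennreal (2 * A + 2 * B)" using AB by (simp add: ennreal_mult')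
  finally show "(\<integral>\<^sup>+x. ennreal ((cmod (f (Complex x y) + g (Complex x y)))\<^sup>2) \<partial>lborel) \<le> ennreal (2 * A + 2 * B)" .
qed

lemma hardy2_scale:
  assumes "hardy2 f A"
  shows "hardy2 (\<lambda>z. c * f z) ((cmod c)\<^sup>2 * A)"
  unfolding hardy2_def
proof (intro conjI allI impI)
  show "continuous_on {z. 0 \<le> Im z} (\<lambda>z. c * f z)" "(\<lambda>z. c * f z) holomorphic_on {z. 0 < Im z}"
    using assms unfolding hardy2_def by (auto intro!: continuous_intros holomorphic_intros)
  have A: "0 \<le> A" using assms by (auto simp: hardy2_def)
  then show "0 \<le> (cmod c)\<^sup>2 * A" by simp
  fix y :: real assume y: "0 \<le> y"
  have [measurable]: "(\<lambda>x. f (Complex x y)) \<in> borel_measurable borel"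
    using hardy2_measurable assms y by auto
  have "(\<integral>\<^sup>+x. ennreal ((cmod (c * f (Complex x y)))\<^sup>2) \<partial>lborel) = ennreal ((cmod c)\<^sup>2) * (\<integral>\<^sup>+x. ennreal ((cmod (f (Complex x y)))\<^sup>2) \<partial>lborel)"
    by (simp add: norm_mult power_mult_distrib ennreal_mult' nn_integral_cmult)
  also have "\<dots> \<le> ennreal ((cmod c)\<^sup>2) * ennreal A"
    using assms y unfolding hardy2_def by (intro mult_left_mono) auto
  finally show "(\<integral>\<^sup>+x. ennreal ((cmod (c * f (Complex x y)))\<^sup>2) \<partial>lborel) \<le> ennreal ((cmod c)\<^sup>2 * A)"
    by (simp add: ennreal_mult')
qed

text \<open>Excluding real zeros makes the quotients by \<open>E\<close> continuous up to the real
  line, so the boundary values in \<open>dip\<close> are plain restrictions.\<close>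

locale hb_zero_free =
  fixes E :: "complex \<Rightarrow> complex"
  assumes HB: "HB E" and E_nonzero: "0 \<le> Im z \<Longrightarrow> E z \<noteq> 0"
begin

definition dip :: "(complex \<Rightarrow> complex) \<Rightarrow> (complex \<Rightarrow> complex) \<Rightarrow> complex" where
  "dip f g = (\<integral>x. f (Complex x 0) / E (Complex x 0) * cnj (g (Complex x 0) / E (Complex x 0)) \<partial>lborel)"

lemma E_holo: "E holomorphic_on A"
  using HB unfolding HB_def by (meson holomorphic_on_subset subset_UNIV)

lemma sharp_E_le: "0 \<le> Im z \<Longrightarrow> cmod (sharp E z) \<le> cmod (E z)"
proof (cases "Im z = 0")
  case True
  then have "cnj z = z" by (simp add: complex_eq_iff)
  then show ?thesis by (simp add: sharp_def)
next
  case False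
  assume "0 \<le> Im z"
  then show ?thesis using False HB by (simp add: HB_def sharp_def less_imp_le)
qed

lemma quotient_regular:
  assumes "f holomorphic_on UNIV"
  shows "continuous_on {z. 0 \<le> Im z} (\<lambda>z. f z / E z)" "(\<lambda>z. f z / E z) holomorphic_on {z. 0 < Im z}"
  using E_nonzero
  by (auto intro!: holomorphic_on_imp_continuous_on holomorphic_intros E_holo holomorphic_on_subset[OF assms])

lemma deBranges_iff_hardy2:
  "f \<in> deBranges E \<longleftrightarrow> f holomorphic_on UNIV \<and> (\<exists>C. hardy2 (\<lambda>z. f z / E z) C) \<and> (\<exists>C. hardy2 (\<lambda>z. sharp f z / E z) C)"
proof
  assume "f \<in> deBranges E"
  then have f: "f holomorphic_on UNIV" "H2_upper (\<lambda>z. f z / E z)" "H2_upper (\<lambda>z. sharp f z / E z)"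
    by (auto simp: deBranges_def)
  show "f holomorphic_on UNIV \<and> (\<exists>C. hardy2 (\<lambda>z. f z / E z) C) \<and> (\<exists>C. hardy2 (\<lambda>z. sharp f z / E z) C)"
    using H2_upper_imp_hardy2[OF f(2) quotient_regular(1)[OF f(1)]]
      H2_upper_imp_hardy2[OF f(3) quotient_regular(1)[OF sharp_holomorphic[OF f(1)]]] f(1) by metis
qed (auto simp: deBranges_def hardy2_imp_H2_upper)

lemma deBranges_sharp: "f \<in> deBranges E \<Longrightarrow> sharp f \<in> deBranges E"
  using sharp_holomorphic by (auto simp: deBranges_def)

lemma deBranges_entire: "f \<in> deBranges E \<Longrightarrow> f holomorphic_on A"
  unfolding deBranges_def by (auto intro: holomorphic_on_subset)

lemma deBranges_L2:
  assumes "f \<in> deBranges E"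
  shows "(\<lambda>x. f (Complex x 0) / E (Complex x 0)) \<in> borel_measurable lborel"
    "integrable lborel (\<lambda>x. (cmod (f (Complex x 0) / E (Complex x 0)))\<^sup>2)"
proof -
  obtain C where C: "hardy2 (\<lambda>z. f z / E z) C" using assms deBranges_iff_hardy2 by blast
  show "(\<lambda>x. f (Complex x 0) / E (Complex x 0)) \<in> borel_measurable lborel"
    using hardy2_measurable[OF C order_refl] by simp
  show "integrable lborel (\<lambda>x. (cmod (f (Complex x 0) / E (Complex x 0)))\<^sup>2)"
    using hardy2_square_integrable(1)[OF C order_refl] by simp
qed

lemma dip_integrable:
  assumes "f \<in> deBranges E" "g \<in> deBranges E"
  shows "integrable lborel (\<lambda>x. f (Complex x 0) / E (Complex x 0) * cnj (g (Complex x 0) / E (Complex x 0)))"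
  using L2_Cauchy_Schwarz(1) deBranges_L2[OF assms(1)] deBranges_L2[OF assms(2)] by blast

lemma dip_self: "dip f f = of_real (\<integral>x. (cmod (f (Complex x 0) / E (Complex x 0)))\<^sup>2 \<partial>lborel)"
  unfolding dip_def complex_norm_square[symmetric] by (rule integral_complex_of_real)

lemma deBranges_norm_eq: "deBranges_norm E f = sqrt (Re (dip f f))"
  by (simp add: deBranges_norm_def dip_self complex_of_real_def)

lemma dip_Cauchy_Schwarz:
  assumes "f \<in> deBranges E" "g \<in> deBranges E"
  shows "cmod (dip f g) \<le> sqrt (Re (dip f f)) * sqrt (Re (dip g g))"
proof -
  have "(cmod (dip f g))\<^sup>2 \<le> Re (dip f f) * Re (dip g g)"
    using L2_Cauchy_Schwarz(2) deBranges_L2[OF assms(1)] deBranges_L2[OF assms(2)]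
    unfolding dip_self Re_complex_of_real unfolding dip_def by blast
  from real_le_rsqrt[OF this] show ?thesis by (simp only: real_sqrt_mult)
qed

lemma dip_cnj: "dip g f = cnj (dip f g)"
proof -
  have "cnj (dip f g) = (\<integral>x. cnj (f (Complex x 0) / E (Complex x 0) * cnj (g (Complex x 0) / E (Complex x 0))) \<partial>lborel)"
    unfolding dip_def by (rule Bochner_Integration.integral_cnj[symmetric])
  also have "\<dots> = dip g f"
    unfolding dip_def by (intro Bochner_Integration.integral_cong) (auto simp: mult.commute)
  finally show ?thesis ..
qed

lemma dip_add_left:
  assumes "f \<in> deBranges E" "g \<in> deBranges E" "h \<in> deBranges E"
  shows "dip (\<lambda>z. f z + g z) h = dip f h + dip g h"
  unfolding dip_def add_divide_distrib distrib_right
  by (rule Bochner_Integration.integral_add) (intro dip_integrable assms)+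

lemma dip_scale_left: "dip (\<lambda>z. c * f z) h = c * dip f h"
  unfolding dip_def integral_mult_right_zero[symmetric] by (simp add: mult_ac)

lemma dip_diff_left:
  assumes "f \<in> deBranges E" "g \<in> deBranges E" "h \<in> deBranges E"
  shows "dip (\<lambda>z. f z - g z) h = dip f h - dip g h"
  unfolding dip_def diff_divide_distrib left_diff_distrib
  by (rule Bochner_Integration.integral_diff) (intro dip_integrable assms)+

lemma dip_sharp: "dip (sharp f) (sharp f) = dip f f"
proof -
  have "cnj (Complex x 0) = Complex x 0" for x by (simp add: complex_eq_iff)
  then show ?thesis unfolding dip_self by (simp add: sharp_def norm_divide)
qed

lemma deBranges_add:
  assumes "f \<in> deBranges E" "g \<in> deBranges E"
  shows "(\<lambda>z. f z + g z) \<in> deBranges E"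
  using assms unfolding deBranges_iff_hardy2
  by (auto simp: sharp_def add_divide_distrib intro!: holomorphic_intros intro: hardy2_add)

lemma deBranges_scale:
  assumes "f \<in> deBranges E"
  shows "(\<lambda>z. c * f z) \<in> deBranges E"
proof -
  obtain A B where AB: "hardy2 (\<lambda>z. f z / E z) A" "hardy2 (\<lambda>z. sharp f z / E z) B" and h: "f holomorphic_on UNIV"
    using assms unfolding deBranges_iff_hardy2 by blast
  from hardy2_scale[OF AB(1), of c] hardy2_scale[OF AB(2), of "cnj c"]
  have "hardy2 (\<lambda>z. c * f z / E z) ((cmod c)\<^sup>2 * A)" "hardy2 (\<lambda>z. sharp (\<lambda>z. c * f z) z / E z) ((cmod (cnj c))\<^sup>2 * B)"
    by (simp_all add: sharp_def)
  moreover have "(\<lambda>z. c * f z) holomorphic_on UNIV" by (intro holomorphic_intros h)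
  ultimately show ?thesis unfolding deBranges_iff_hardy2 by blast
qed

lemma deBranges_diff:
  assumes "f \<in> deBranges E" "g \<in> deBranges E"
  shows "(\<lambda>z. f z - g z) \<in> deBranges E"
  using deBranges_add[OF assms(1) deBranges_scale[OF assms(2), of "-1"]] by simp

end

section \<open>Limits and reproducing kernels in de Branges spaces\<close>

lemma hardy2_mono: "hardy2 g A \<Longrightarrow> A \<le> B \<Longrightarrow> hardy2 g B"
  unfolding hardy2_def by (meson ennreal_leI order_trans)

text \<open>Fatou's lemma on every horizontal line, the real line included.\<close>

lemma hardy2_limit:
  assumes g: "\<And>n::nat. hardy2 (g n) B"
    and c: "continuous_on {z. 0 \<le> Im z} f" and h: "f holomorphic_on {z. 0 < Im z}"
    and lim: "\<And>z. 0 \<le> Im z \<Longrightarrow> (\<lambda>n. g n z) \<longlonglongrightarrow> f z"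
  shows "hardy2 f B"
  unfolding hardy2_def
proof (intro conjI allI impI c h)
  show "0 \<le> B" using g[of 0] by (simp add: hardy2_def)
  fix y :: real assume y: "0 \<le> y"
  have l: "(\<lambda>n. ennreal ((cmod (g n (Complex x y)))\<^sup>2)) \<longlonglongrightarrow> ennreal ((cmod (f (Complex x y)))\<^sup>2)" for x
    using lim[of "Complex x y"] y by (intro tendsto_intros) auto
  have "(\<integral>\<^sup>+x. ennreal ((cmod (f (Complex x y)))\<^sup>2) \<partial>lborel) =
     (\<integral>\<^sup>+x. liminf (\<lambda>n. ennreal ((cmod (g n (Complex x y)))\<^sup>2)) \<partial>lborel)"
    by (intro nn_integral_cong) (simp add: lim_imp_Liminf[OF _ l])
  also have "\<dots> \<le> liminf (\<lambda>n. \<integral>\<^sup>+x. ennreal ((cmod (g n (Complex x y)))\<^sup>2) \<partial>lborel)"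
  proof (rule nn_integral_liminf)
    fix n
    note [measurable] = hardy2_measurable[OF g y]
    show "(\<lambda>x. ennreal ((cmod (g n (Complex x y)))\<^sup>2)) \<in> borel_measurable lborel" by measurable
  qed
  also have "\<dots> \<le> ennreal B"
  proof -
    have "liminf (\<lambda>n. \<integral>\<^sup>+x. ennreal ((cmod (g n (Complex x y)))\<^sup>2) \<partial>lborel) \<le> liminf (\<lambda>_. ennreal B)"
      using g y by (intro Liminf_mono always_eventually) (auto simp: hardy2_def)
    then show ?thesis by (simp only: Liminf_const[OF sequentially_bot])
  qed
  finally show "(\<integral>\<^sup>+x. ennreal ((cmod (f (Complex x y)))\<^sup>2) \<partial>lborel) \<le> ennreal B" .
qed

context hb_zero_free begin

text \<open>The classical de Branges kernel at \<open>c\<close>, multiplied by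
  \<open>z - cnj c\<close> to avoid its removable singularity.\<close>

definition is_kernel :: "complex \<Rightarrow> (complex \<Rightarrow> complex) \<Rightarrow> bool" where
  "is_kernel c g \<longleftrightarrow> (\<forall>z. (z - cnj c) * g z = \<i> / (2 * pi) * (E z * cnj (E c) - sharp E z * cnj (sharp E c)))"

text \<open>\<open>sharp E\<close> is dominated by \<open>E\<close> in the closed upper half-plane,
  so dividing the kernel by \<open>E\<close> leaves the decay required by
  \<open>hardy2_of_decay\<close>.\<close>

lemma is_kernel_bound:
  assumes "is_kernel c g" "0 \<le> Im z"
  shows "cmod (g z / E z) * cmod (z - cnj c) \<le> cmod (E c) + cmod (sharp E c)"
proof -
  have "cmod (g z) * cmod (z - cnj c) = 1 / (2 * pi) * cmod (E z * cnj (E c) - sharp E z * cnj (sharp E c))"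
    using assms(1) unfolding is_kernel_def norm_mult[symmetric] by (simp add: mult.commute[of "g z"] norm_mult norm_divide)
  also have "\<dots> \<le> 1 * (cmod (E z) * cmod (E c) + cmod (E z) * cmod (sharp E c))"
  proof (intro mult_mono)
    have "cmod (E z * cnj (E c) - sharp E z * cnj (sharp E c)) \<le> cmod (E z * cnj (E c)) + cmod (sharp E z * cnj (sharp E c))"
      by (rule norm_triangle_ineq4)
    also have "\<dots> \<le> cmod (E z) * cmod (E c) + cmod (E z) * cmod (sharp E c)"
      using sharp_E_le[OF assms(2)] by (simp add: norm_mult mult_right_mono)
    finally show "cmod (E z * cnj (E c) - sharp E z * cnj (sharp E c)) \<le> cmod (E z) * cmod (E c) + cmod (E z) * cmod (sharp E c)" .
  qed (use pi_gt3 in auto)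
  finally have "cmod (g z) * cmod (z - cnj c) / cmod (E z) \<le> cmod (E z) * (cmod (E c) + cmod (sharp E c)) / cmod (E z)"
    by (intro divide_right_mono) (auto simp: distrib_left)
  then show ?thesis using E_nonzero[OF assms(2)] by (simp add: norm_divide)
qed

text \<open>With this symmetry one decay estimate gives both membership conditions.\<close>

lemma is_kernel_sharp:
  assumes "is_kernel c g"
  shows "is_kernel (cnj c) (sharp g)"
  unfolding is_kernel_def
proof
  fix z
  have "cnj ((cnj z - cnj c) * g (cnj z)) = cnj (\<i> / (2 * pi) * (E (cnj z) * cnj (E c) - sharp E (cnj z) * cnj (sharp E c)))"
    using assms unfolding is_kernel_def by metis
  then show "(z - cnj (cnj c)) * sharp g z = \<i> / (2 * pi) * (E z * cnj (E (cnj c)) - sharp E z * cnj (sharp E (cnj c)))"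
    by (simp add: sharp_def algebra_simps)
qed

lemma is_kernel_mem:
  assumes g: "is_kernel c g" "g holomorphic_on UNIV"
  shows "g \<in> deBranges E"
  unfolding deBranges_iff_hardy2
proof (intro conjI g(2))
  show "\<exists>C. hardy2 (\<lambda>z. g z / E z) C"
    by (rule hardy2_of_decay[OF quotient_regular[OF g(2)] is_kernel_bound[OF g(1)]]) auto
  show "\<exists>C. hardy2 (\<lambda>z. sharp g z / E z) C"
    by (rule hardy2_of_decay[OF quotient_regular[OF sharp_holomorphic[OF g(2)]] is_kernel_bound[OF is_kernel_sharp[OF g(1)]]]) auto
qed

text \<open>On the real line the integrand splits into the Cauchy kernel at \<open>c\<close> against
  \<open>f / E\<close> and the conjugate of the Cauchy kernel at \<open>cnj c\<close> against
  \<open>sharp f / E\<close>. One of the two points lies in the lower half-plane and contributes 0;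
  the other yields \<open>f c\<close>.\<close>

lemma reproducing:
  assumes f: "f \<in> deBranges E" and c: "Im c \<noteq> 0" and g: "is_kernel c g"
  shows "dip f g = f c"
proof -
  obtain A B where A: "hardy2 (\<lambda>z. f z / E z) A" and B: "hardy2 (\<lambda>z. sharp f z / E z) B"
    using f deBranges_iff_hardy2 by blast
  define I where "I = (if 0 < Im c then 2 * pi * \<i> * (f c / E c) else 0)"
  define J where "J = (if Im c < 0 then 2 * pi * \<i> * (sharp f (cnj c) / E (cnj c)) else 0)"
  have 1: "has_bochner_integral lborel (\<lambda>x. f (Complex x 0) / E (Complex x 0) / (Complex x 0 - c)) I"
    using hardy2_Cauchy[OF A c] by (simp add: I_def)
  have 2: "has_bochner_integral lborel (\<lambda>x. sharp f (Complex x 0) / E (Complex x 0) / (Complex x 0 - cnj c)) J"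
    using hardy2_Cauchy[OF B, of "cnj c"] c by (simp add: J_def)
  have H: "has_bochner_integral lborel (\<lambda>x. - \<i> / (2 * pi) * (E c * (f (Complex x 0) / E (Complex x 0) / (Complex x 0 - c))
       - sharp E c * cnj (sharp f (Complex x 0) / E (Complex x 0) / (Complex x 0 - cnj c))))
     (- \<i> / (2 * pi) * (E c * I - sharp E c * cnj J))"
    by (intro has_bochner_integral_mult_right has_bochner_integral_diff has_bochner_integral_cnj 1 2)
  have pt: "- \<i> / (2 * pi) * (E c * (f z / E z / (z - c)) - sharp E c * cnj (sharp f z / E z / (z - cnj c))) =
     f z / E z * cnj (g z / E z)" if z: "z = Complex x 0" for x z
  proof -
    have cz: "cnj z = z" using z by (simp add: complex_eq_iff)
    have zc: "z - c \<noteq> 0" "z - cnj c \<noteq> 0" using z c by (auto simp: complex_eq_iff)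
    have Ez: "E z \<noteq> 0" using z E_nonzero[of z] by simp
    have sE: "sharp E z = cnj (E z)" by (simp add: sharp_def cz)
    have "g z = \<i> / (2 * pi) * (E z * cnj (E c) - cnj (E z) * cnj (sharp E c)) / (z - cnj c)"
      using g[unfolded is_kernel_def, rule_format, of z, unfolded sE] zc(2) by (metis nonzero_mult_div_cancel_left)
    then have gz: "cnj (g z) = - \<i> / (2 * pi) * (cnj (E z) * E c - E z * sharp E c) / (z - c)"
      by (simp add: cz)
    have alg: "k * (a * (F / e / w) - b * (F / e' / w)) = F / e * (k * (e' * a - e * b) / w / e')"
      if "e \<noteq> 0" "e' \<noteq> 0" "w \<noteq> 0" for k a b F e e' w :: complex
      using that by (simp add: field_simps)
    have e2: "cnj (sharp f z) = f z" "cnj (z - cnj c) = z - c"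
      by (simp_all add: sharp_def cz)
    show ?thesis
      unfolding complex_cnj_divide e2 gz by (rule alg) (use Ez zc in auto)
  qed
  have "dip f g = - \<i> / (2 * pi) * (E c * I - sharp E c * cnj J)"
    using H unfolding dip_def pt[OF refl] by (rule has_bochner_integral_integral_eq)
  also have "\<dots> = f c"
  proof (cases "0 < Im c")
    case True
    then show ?thesis using E_nonzero[of c] by (simp add: I_def J_def)
  next
    case False
    then have "sharp E c \<noteq> 0" using E_nonzero[of "cnj c"] by (simp add: sharp_def)
    moreover have "cnj J = - (2 * pi * \<i> * (f c / sharp E c))"
      using False c by (simp add: J_def sharp_def)
    ultimately show ?thesis using False by (simp add: I_def)
  qed
  finally show ?thesis .
qed

text \<open>Both quotients have the same modulus on the real line, so the squared norm is a Hardy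
  constant for each.\<close>

lemma deBranges_hardy2_optimal:
  assumes "f \<in> deBranges E"
  shows "hardy2 (\<lambda>z. f z / E z) (Re (dip f f))" "hardy2 (\<lambda>z. sharp f z / E z) (Re (dip f f))"
proof -
  have *: "hardy2 (\<lambda>z. f z / E z) (Re (dip f f))" if "f \<in> deBranges E" for f
    using that hardy2_optimal unfolding deBranges_iff_hardy2 dip_self Re_complex_of_real by blast
  show "hardy2 (\<lambda>z. f z / E z) (Re (dip f f))" "hardy2 (\<lambda>z. sharp f z / E z) (Re (dip f f))"
    using *[OF assms] *[OF deBranges_sharp[OF assms]] by (simp_all add: dip_sharp)
qed

text \<open>The squared norm of each \<open>F n\<close> is a Hardy constant, hence \<open>B\<close>
  is a common one and \<open>hardy2_limit\<close> applies. In the density argument this takes the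
  place of completeness of the de Branges space.\<close>

lemma deBranges_limit:
  assumes F: "\<And>n::nat. F n \<in> deBranges E" and f: "f holomorphic_on UNIV"
    and lim: "\<And>z. (\<lambda>n. F n z) \<longlonglongrightarrow> f z" and B: "\<And>n. Re (dip (F n) (F n)) \<le> B"
  shows "f \<in> deBranges E" "Re (dip f f) \<le> B"
proof -
  have 1: "hardy2 (\<lambda>z. f z / E z) B"
  proof (rule hardy2_limit[OF _ quotient_regular[OF f]])
    show "hardy2 (\<lambda>z. F n z / E z) B" for n by (rule hardy2_mono[OF deBranges_hardy2_optimal(1)[OF F] B])
    show "(\<lambda>n. F n z / E z) \<longlonglongrightarrow> f z / E z" if "0 \<le> Im z" for z
      by (intro tendsto_intros lim E_nonzero that)
  qed
  have 2: "hardy2 (\<lambda>z. sharp f z / E z) B"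
  proof (rule hardy2_limit[OF _ quotient_regular[OF sharp_holomorphic[OF f]]])
    show "hardy2 (\<lambda>z. sharp (F n) z / E z) B" for n by (rule hardy2_mono[OF deBranges_hardy2_optimal(2)[OF F] B])
    show "(\<lambda>n. sharp (F n) z / E z) \<longlonglongrightarrow> sharp f z / E z" if "0 \<le> Im z" for z
      unfolding sharp_def by (intro tendsto_intros lim E_nonzero that)
  qed
  show "f \<in> deBranges E" unfolding deBranges_iff_hardy2 using f 1 2 by blast
  show "Re (dip f f) \<le> B"
    using hardy2_square_integrable(2)[OF 1 order_refl] by (simp add: dip_self)
qed

end

text \<open>The reproducing formula is available off the real line; the identity theorem bridges the
  gap.\<close>

lemma entire_eq_off_real:
  fixes f g :: "complex \<Rightarrow> complex"
  assumes "f holomorphic_on UNIV" "g holomorphic_on UNIV" "\<And>z. Im z \<noteq> 0 \<Longrightarrow> f z = g z"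
  shows "f = g"
proof
  fix z
  have ne: "{z. 0 < Im z} \<noteq> {}" by (auto intro!: exI[of _ \<i>])
  show "f z = g z"
    by (rule analytic_continuation_open[OF open_halfspace_Im_gt open_UNIV ne connected_UNIV subset_UNIV assms(1,2) _ UNIV_I])
       (use assms(3) in auto)
qed

section \<open>Unitarity of multiplication by \<open>u\<close>\<close>

context debranges_factor begin

sublocale hb: hb_zero_free E
  by unfold_locales (rule HB_E E_nz; assumption?)+

definition U :: "(complex \<Rightarrow> complex) \<Rightarrow> complex \<Rightarrow> complex" where "U f = (\<lambda>z. u z * f z)"

lemma U_hol: "f \<in> N \<Longrightarrow> U f holomorphic_on A"
  unfolding U_def by (intro holomorphic_intros u_hol holo)

lemma U_add: "U (\<lambda>z. f z + g z) = (\<lambda>z. U f z + U g z)"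
  and U_diff: "U (\<lambda>z. f z - g z) = (\<lambda>z. U f z - U g z)"
  and U_scale: "U (\<lambda>z. c * f z) = (\<lambda>z. c * U f z)"
  by (auto simp: U_def algebra_simps)

lemma U_K_kernel: "hb.is_kernel c (\<lambda>z. cnj (u c) * U (K c) z)"
  unfolding hb.is_kernel_def using E_kernel[of _ c] by (simp add: U_def mult_ac)

lemma U_K_mem: "U (K c) \<in> deBranges E"
proof -
  have "(\<lambda>z. cnj (u c) * U (K c) z) \<in> deBranges E"
    by (rule hb.is_kernel_mem[OF U_K_kernel]) (intro holomorphic_intros U_hol K)
  from hb.deBranges_scale[OF this, of "1 / cnj (u c)"] show ?thesis by simp
qed

lemma U_K_reproducing:
  assumes f: "f \<in> deBranges E" and c: "Im c \<noteq> 0"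
  shows "u c * hb.dip f (U (K c)) = f c"
proof -
  have "f c = hb.dip f (\<lambda>z. cnj (u c) * U (K c) z)" by (rule hb.reproducing[OF f c U_K_kernel, symmetric])
  also have "\<dots> = u c * hb.dip f (U (K c))"
    using hb.dip_scale_left[of "cnj (u c)" "U (K c)" f] by (simp add: hb.dip_cnj[of f])
  finally show ?thesis ..
qed

text \<open>The functions on which unitarity is already known. Testing inner products rather than
  norms makes this a linear subspace, and admitting only tests \<open>g\<close> with
  \<open>U g\<close> in the de Branges space avoids circularity.\<close>

definition V :: "(complex \<Rightarrow> complex) set" where
  "V = {f \<in> N. U f \<in> deBranges E \<and> (\<forall>g\<in>N. U g \<in> deBranges E \<longrightarrow> hb.dip (U f) (U g) = ip f g)}"

text \<open>After cancelling \<open>u c\<close>, both inner products against the kernel reduce to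
  the value \<open>g c\<close>.\<close>

lemma K_in_V:
  assumes "Im c \<noteq> 0"
  shows "K c \<in> V"
proof -
  have "hb.dip (U (K c)) (U g) = ip (K c) g" if "g \<in> N" "U g \<in> deBranges E" for g
  proof -
    have "u c * hb.dip (U g) (U (K c)) = u c * g c"
      using U_K_reproducing[OF that(2) assms] by (simp add: U_def)
    then have "hb.dip (U g) (U (K c)) = ip g (K c)" using K(2)[OF that(1)] by simp
    then show ?thesis using hb.dip_cnj[of "U g" "U (K c)"] ip_cnj[OF that(1) K(1)] hb.dip_cnj ip_cnj[OF K(1) that(1)] by metis
  qed
  then show ?thesis unfolding V_def using K(1) U_K_mem by blast
qed

text \<open>Density of \<open>V\<close>: on \<open>V\<close> the functional \<open>ip g f\<close> is
  represented by a limit of members of \<open>V\<close>. Testing with kernels shows that this limit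
  equals \<open>f\<close> off the real line, hence everywhere.\<close>

lemma V_approx:
  assumes f: "f \<in> N"
  obtains s where "\<And>n::nat. s n \<in> V" "(\<lambda>n. nrm (\<lambda>z. s n z - f z)) \<longlonglongrightarrow> 0"
proof -
  have V: "V \<subseteq> N" by (auto simp: V_def)
  have V0: "(\<lambda>_. 0) \<in> V"
    using hb.deBranges_scale[OF U_K_mem, of 0 0] zero_mem ip_scale_left[OF zero_mem, of _ 0] hb.dip_scale_left[of 0]
    by (auto simp: V_def U_def)
  have Va: "(\<lambda>z. f z + g z) \<in> V" if "f \<in> V" "g \<in> V" for f g
    using that unfolding V_def
    by (auto intro: add_mem hb.deBranges_add simp: hb.dip_add_left ip_add_left U_add)
  have Vs: "(\<lambda>z. c * f z) \<in> V" if "f \<in> V" for c f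
    using that unfolding V_def
    by (auto intro: scale_mem hb.deBranges_scale simp: hb.dip_scale_left ip_scale_left U_scale)
  show ?thesis
  proof (rule Riesz_subspace[OF V V0 Va Vs, of "\<lambda>g. ip g f" "nrm f"])
    fix s :: "nat \<Rightarrow> complex \<Rightarrow> complex" and m
    assume s: "\<And>n. s n \<in> V" and m: "m \<in> N" and lim: "(\<lambda>n. nrm (\<lambda>z. s n z - m z)) \<longlonglongrightarrow> 0"
      and eq: "\<And>g. g \<in> V \<Longrightarrow> ip g m = ip g f"
    have "m = f"
    proof (rule entire_eq_off_real[OF holo[OF m] holo[OF f]])
      fix z assume "Im z \<noteq> 0"
      then show "m z = f z" using eq[OF K_in_V] ip_cnj[OF K(1) m, of z] ip_cnj[OF K(1) f, of z] K(2)[OF m] K(2)[OF f] by simp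
    qed
    then show thesis using that s lim by blast
  next
    show "cmod (ip g f) \<le> nrm f * nrm g" if "g \<in> N" for g
      using Cauchy_Schwarz[OF that f] by (simp add: mult.commute)
  qed (use f in \<open>auto simp: ip_add_left ip_scale_left\<close>)
qed

text \<open>\<open>U\<close> is isometric on differences of the approximating sequence. With one
  index fixed and the other tending to infinity, \<open>deBranges_limit\<close> yields membership
  and a small norm for the remainder; inner products then pass to the limit.\<close>

lemma V_eq: "V = N"
proof
  show "V \<subseteq> N" by (auto simp: V_def)
  show "N \<subseteq> V"
  proof
    fix f assume f: "f \<in> N"
    obtain s where s: "\<And>n::nat. s n \<in> V" and lim: "(\<lambda>n. nrm (\<lambda>z. s n z - f z)) \<longlonglongrightarrow> 0"
      by (rule V_approx[OF f]) blast
    have sN: "s n \<in> N" and sE: "U (s n) \<in> deBranges E" for n using s by (auto simp: V_def)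
    have dN: "(\<lambda>z. s n z - f z) \<in> N" for n by (intro diff_mem sN f)
    have pt: "(\<lambda>n. U (s n) z) \<longlonglongrightarrow> U f z" for z
    proof -
      obtain C where C: "\<And>g. g \<in> N \<Longrightarrow> cmod (g z) \<le> C * nrm g" using eval_bdd by blast
      have "(\<lambda>n. s n z - f z) \<longlonglongrightarrow> 0"
      proof (rule Lim_null_comparison)
        show "\<forall>\<^sub>F n in sequentially. cmod (s n z - f z) \<le> C * nrm (\<lambda>z. s n z - f z)" using C[OF dN] by simp
        show "(\<lambda>n. C * nrm (\<lambda>z. s n z - f z)) \<longlonglongrightarrow> 0" using tendsto_mult_left[OF lim, of C] by simp
      qed
      then have "(\<lambda>n. s n z) \<longlonglongrightarrow> f z" by (rule LIM_zero_cancel)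
      then show ?thesis unfolding U_def by (intro tendsto_intros)
    qed
    have dd: "U (\<lambda>z. s n z - s m z) \<in> deBranges E" for n m
      unfolding U_diff by (intro hb.deBranges_diff sE)
    have small: "\<exists>M. \<forall>n\<ge>M. U (\<lambda>z. s n z - f z) \<in> deBranges E \<and>
        Re (hb.dip (U (\<lambda>z. s n z - f z)) (U (\<lambda>z. s n z - f z))) \<le> (2 * e)\<^sup>2" if e: "0 < e" for e
    proof -
      obtain M where M: "\<And>n. n \<ge> M \<Longrightarrow> nrm (\<lambda>z. s n z - f z) < e"
        using order_tendstoD(2)[OF lim e] by (auto simp: eventually_sequentially)
      have ub: "Re (hb.dip (U (\<lambda>z. s n z - s m z)) (U (\<lambda>z. s n z - s m z))) \<le> (2 * e)\<^sup>2" if "M \<le> n" "M \<le> m" for n m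
      proof -
        have d: "(\<lambda>z. s n z - s m z) \<in> N" by (intro diff_mem sN)
        have neg: "(\<lambda>z. - 1 * (s m z - f z)) \<in> N" by (rule scale_mem[OF dN])
        have eq: "(\<lambda>z. (s n z - f z) + - 1 * (s m z - f z)) = (\<lambda>z. s n z - s m z)" by auto
        have "nrm (\<lambda>z. s n z - s m z) \<le> nrm (\<lambda>z. s n z - f z) + nrm (\<lambda>z. s m z - f z)"
          using nrm_triangle[OF dN[of n] neg] nrm_scale[OF dN[of m], of "-1"] unfolding eq by simp
        also have "\<dots> \<le> 2 * e" using M[OF that(1)] M[OF that(2)] by simp
        finally have le: "nrm (\<lambda>z. s n z - s m z) \<le> 2 * e" .
        have "hb.dip (U (\<lambda>z. s n z - s m z)) (U (\<lambda>z. s n z - s m z)) = ip (\<lambda>z. s n z - s m z) (\<lambda>z. s n z - s m z)"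
        proof -
          have "hb.dip (U (s k)) (U (\<lambda>z. s n z - s m z)) = ip (s k) (\<lambda>z. s n z - s m z)" for k
            using s[of k] d dd[of n m] by (auto simp: V_def)
          then show ?thesis
            using hb.dip_diff_left[OF sE[of n] sE[of m] dd[of n m]] ip_diff_left[OF sN[of n] sN[of m] d] by (simp add: U_diff)
        qed
        then have "Re (hb.dip (U (\<lambda>z. s n z - s m z)) (U (\<lambda>z. s n z - s m z))) = (nrm (\<lambda>z. s n z - s m z))\<^sup>2"
          using nrm_power2[OF d] by simp
        also have "\<dots> \<le> (2 * e)\<^sup>2" by (rule power_mono[OF le nrm_nonneg[OF d]])
        finally show ?thesis .
      qed
      show ?thesis
      proof (intro exI[of _ M] allI impI)
        fix n assume n: "M \<le> n"
        \<comment> \<open>Starting the second index at \<open>M\<close> makes the bound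
          \<open>ub\<close> hold along the whole sequence.\<close>
        have l: "(\<lambda>m. U (\<lambda>z. s n z - s (m + M) z) w) \<longlonglongrightarrow> U (\<lambda>z. s n z - f z) w" for w
          unfolding U_diff by (intro tendsto_intros LIMSEQ_ignore_initial_segment[OF pt])
        show "U (\<lambda>z. s n z - f z) \<in> deBranges E \<and>
          Re (hb.dip (U (\<lambda>z. s n z - f z)) (U (\<lambda>z. s n z - f z))) \<le> (2 * e)\<^sup>2"
          using hb.deBranges_limit[OF dd U_hol[OF dN] l ub[OF n]] by simp
      qed
    qed
    obtain M where "U (\<lambda>z. s M z - f z) \<in> deBranges E" using small[of 1] by auto
    from hb.deBranges_diff[OF sE[of M] this] have fE: "U f \<in> deBranges E"
      unfolding U_diff by simp
    have "hb.dip (U f) (U g) = ip f g" if g: "g \<in> N" "U g \<in> deBranges E" for g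
    proof -
      have "(\<lambda>n. hb.dip (U (s n)) (U g)) \<longlonglongrightarrow> hb.dip (U f) (U g)"
      proof (rule LIMSEQ_I)
        fix r :: real assume r: "0 < r"
        define D where "D = sqrt (Re (hb.dip (U g) (U g)))"
        have D: "0 \<le> D" using hb.dip_self[of "U g"] by (simp add: D_def)
        \<comment> \<open>The summand 1 allows for \<open>D = 0\<close>.\<close>
        define e where "e = r / (2 * (D + 1))"
        have e: "0 < e" using r D by (simp add: e_def)
        have eD: "2 * e * D < r" using r D by (simp add: e_def field_simps)
        obtain M where M: "\<And>n. n \<ge> M \<Longrightarrow> U (\<lambda>z. s n z - f z) \<in> deBranges E"
          "\<And>n. n \<ge> M \<Longrightarrow> Re (hb.dip (U (\<lambda>z. s n z - f z)) (U (\<lambda>z. s n z - f z))) \<le> (2 * e)\<^sup>2"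
          using small[OF e] by blast
        have "cmod (hb.dip (U (s n)) (U g) - hb.dip (U f) (U g)) < r" if n: "M \<le> n" for n
        proof -
          have "hb.dip (U (s n)) (U g) - hb.dip (U f) (U g) = hb.dip (U (\<lambda>z. s n z - f z)) (U g)"
            unfolding U_diff by (rule hb.dip_diff_left[OF sE fE g(2), symmetric])
          then have "cmod (hb.dip (U (s n)) (U g) - hb.dip (U f) (U g)) = cmod (hb.dip (U (\<lambda>z. s n z - f z)) (U g))"
            by (simp only:)
          also have "\<dots> \<le> sqrt (Re (hb.dip (U (\<lambda>z. s n z - f z)) (U (\<lambda>z. s n z - f z)))) * D"
            unfolding D_def by (rule hb.dip_Cauchy_Schwarz[OF M(1)[OF n] g(2)])
          also have "\<dots> \<le> 2 * e * D"
          proof (rule mult_right_mono[OF _ D])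
            show "sqrt (Re (hb.dip (U (\<lambda>z. s n z - f z)) (U (\<lambda>z. s n z - f z)))) \<le> 2 * e"
              by (rule real_le_lsqrt[OF _ M(2)[OF n]]) (use e in simp)
          qed
          finally show ?thesis using eD by simp
        qed
        then show "\<exists>no. \<forall>n\<ge>no. cmod (hb.dip (U (s n)) (U g) - hb.dip (U f) (U g)) < r" by blast
      qed
      moreover have "hb.dip (U (s n)) (U g) = ip (s n) g" for n
        using s[of n] g by (auto simp: V_def)
      moreover have "(\<lambda>n. ip (s n) g) \<longlonglongrightarrow> ip f g"
      proof (rule LIM_zero_cancel, rule Lim_null_comparison)
        show "\<forall>\<^sub>F n in sequentially. cmod (ip (s n) g - ip f g) \<le> nrm (\<lambda>z. s n z - f z) * nrm g"
          using Cauchy_Schwarz[OF dN g(1)] by (simp add: ip_diff_left[OF sN f g(1)])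
        show "(\<lambda>n. nrm (\<lambda>z. s n z - f z) * nrm g) \<longlonglongrightarrow> 0" using tendsto_mult_right[OF lim, of "nrm g"] by simp
      qed
      ultimately show ?thesis using LIMSEQ_unique by auto
    qed
    then show "f \<in> V" unfolding V_def using f fE by blast
  qed
qed

lemma U_mem: "f \<in> N \<Longrightarrow> U f \<in> deBranges E"
  and dip_U: "f \<in> N \<Longrightarrow> g \<in> N \<Longrightarrow> hb.dip (U f) (U g) = ip f g"
  using V_eq unfolding V_def by blast+

lemma U_norm: "f \<in> N \<Longrightarrow> deBranges_norm E (U f) = nrm f"
  unfolding hb.deBranges_norm_eq by (simp add: dip_U hs_norm_def)

text \<open>\<open>n\<close> is the adjoint of \<open>U\<close> applied to \<open>f\<close>. Then
  \<open>f\<close> and \<open>U n\<close> have the same inner products with the images of all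
  kernels, and these determine values off the real line.\<close>

lemma U_surj:
  assumes f: "f \<in> deBranges E"
  obtains n where "n \<in> N" "f = U n"
proof -
  obtain n where n: "n \<in> N" and rep: "\<And>g. g \<in> N \<Longrightarrow> ip g n = hb.dip (U g) f"
  proof (rule Riesz[of "\<lambda>g. hb.dip (U g) f" "sqrt (Re (hb.dip f f))"])
    show "hb.dip (U (\<lambda>z. g z + h z)) f = hb.dip (U g) f + hb.dip (U h) f" if "g \<in> N" "h \<in> N" for g h
      unfolding U_add by (intro hb.dip_add_left U_mem that f)
    show "hb.dip (U (\<lambda>z. c * g z)) f = c * hb.dip (U g) f" for c g
      unfolding U_scale by (rule hb.dip_scale_left)
    show "cmod (hb.dip (U g) f) \<le> sqrt (Re (hb.dip f f)) * nrm g" if "g \<in> N" for g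
      using hb.dip_Cauchy_Schwarz[OF U_mem[OF that] f] dip_U[OF that that] by (simp add: hs_norm_def mult.commute)
  qed (use that in blast)
  have "f = U n"
  proof (rule entire_eq_off_real)
    show "f holomorphic_on UNIV" "U n holomorphic_on UNIV" by (intro hb.deBranges_entire f U_hol n)+
    fix z assume z: "Im z \<noteq> 0"
    have "hb.dip (U (K z)) f = hb.dip (U (K z)) (U n)"
      using rep[OF K(1), of z] dip_U[OF K(1) n, of z] by simp
    then have "hb.dip f (U (K z)) = hb.dip (U n) (U (K z))" by (metis hb.dip_cnj)
    then show "f z = U n z" using U_K_reproducing[OF f z] U_K_reproducing[OF U_mem[OF n] z] by simp
  qed
  then show ?thesis using that n by blast
qed

end

section \<open>Exponential type of the unimodular factor\<close>

text \<open>Cayley transforms before and after \<open>p\<close> produce a self-map of the unit disc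
  fixing 0, to which the Schwarz lemma applies.\<close>

lemma Caratheodory_upper_half_plane:
  assumes hol: "p holomorphic_on {z. 0 < Im z}" and pos: "\<And>z. 0 < Im z \<Longrightarrow> 0 < Re (p z)" and z: "0 < Im z"
  shows "cmod (p z) \<le> cmod (p \<i>) * (cmod (z + \<i>))\<^sup>2 / Im z"
proof -
  define \<phi> where "\<phi> w = \<i> * (1 + w) / (1 - w)" for w :: complex
  have one: "1 - w \<noteq> 0" if "cmod w < 1" for w :: complex using that by auto
  have Im\<phi>: "0 < Im (\<phi> w)" if w: "cmod w < 1" for w
  proof -
    have "(1 + w) / (1 - w) = (1 + w) * cnj (1 - w) / of_real ((cmod (1 - w))\<^sup>2)"
      unfolding complex_norm_square
      by (rule mult_divide_mult_cancel_right[symmetric]) (use one[OF w] in \<open>simp del: complex_cnj_diff\<close>)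
    moreover have "Re ((1 + w) * cnj (1 - w)) = 1 - (cmod w)\<^sup>2"
      unfolding cmod_power2 by (simp add: algebra_simps power2_eq_square)
    ultimately have "Re ((1 + w) / (1 - w)) = (1 - (cmod w)\<^sup>2) / (cmod (1 - w))\<^sup>2"
      by (simp add: Re_divide_of_real)
    moreover have "(cmod w)\<^sup>2 < 1" using w by (simp add: abs_square_less_1)
    ultimately have "0 < Re ((1 + w) / (1 - w))" using one[OF w] by simp
    then show ?thesis unfolding \<phi>_def times_divide_eq_right[symmetric] Im_i_times .
  qed
  define p0 where "p0 = p \<i>"
  define q where "q w = (p (\<phi> w) - p0) / (p (\<phi> w) + cnj p0)" for w
  have p0: "0 < Re p0" unfolding p0_def by (rule pos) simp
  have den: "p (\<phi> w) + cnj p0 \<noteq> 0" if "cmod w < 1" for w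
    using pos[OF Im\<phi>[OF that]] p0 by (auto simp: complex_eq_iff)
  have qlt: "cmod (q w) < 1" if w: "cmod w < 1" for w
  proof -
    define a where "a = p (\<phi> w)"
    have a: "0 < Re a" unfolding a_def by (rule pos[OF Im\<phi>[OF w]])
    have "(cmod (a + cnj p0))\<^sup>2 - (cmod (a - p0))\<^sup>2 = 4 * (Re a * Re p0)"
      unfolding cmod_power2 by (simp add: power2_eq_square algebra_simps)
    moreover have "0 < Re a * Re p0" using a p0 by simp
    ultimately have "(cmod (a - p0))\<^sup>2 < (cmod (a + cnj p0))\<^sup>2" by linarith
    then have "cmod (a - p0) < cmod (a + cnj p0)" by (rule power2_less_imp_less) simp
    then show ?thesis using den[OF w] by (simp add: q_def norm_divide a_def)
  qed
  have h\<phi>: "\<phi> holomorphic_on ball 0 1"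
    unfolding \<phi>_def by (intro holomorphic_intros) (auto dest: one)
  have "(p \<circ> \<phi>) holomorphic_on ball 0 1"
    by (rule holomorphic_on_compose_gen[OF h\<phi> hol]) (auto intro: Im\<phi>)
  then have hq: "q holomorphic_on ball 0 1"
    unfolding q_def o_def by (intro holomorphic_intros) (use den in auto)
  define w where "w = (z - \<i>) / (z + \<i>)"
  have zi: "z + \<i> \<noteq> 0" using z by (auto simp: complex_eq_iff)
  have id: "1 - (cmod w)\<^sup>2 = 4 * Im z / (cmod (z + \<i>))\<^sup>2"
  proof -
    have "(cmod (z + \<i>))\<^sup>2 - (cmod (z - \<i>))\<^sup>2 = 4 * Im z"
      unfolding cmod_power2 by (simp add: power2_eq_square algebra_simps)
    moreover have "(cmod w)\<^sup>2 = (cmod (z - \<i>))\<^sup>2 / (cmod (z + \<i>))\<^sup>2"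
      by (simp add: w_def norm_divide power_divide)
    then have "1 - (cmod w)\<^sup>2 = ((cmod (z + \<i>))\<^sup>2 - (cmod (z - \<i>))\<^sup>2) / (cmod (z + \<i>))\<^sup>2"
      using zi by (simp add: diff_divide_distrib)
    ultimately show ?thesis by simp
  qed
  moreover have "0 < 4 * Im z / (cmod (z + \<i>))\<^sup>2" using z zi by simp
  ultimately have "(cmod w)\<^sup>2 < 1" by linarith
  then have w: "cmod w < 1" by (simp add: abs_square_less_1)
  have \<phi>w: "\<phi> w = z"
  proof -
    have "1 + w = 2 * z / (z + \<i>)" "1 - w = 2 * \<i> / (z + \<i>)"
      using zi by (simp_all add: w_def field_simps)
    then show ?thesis using zi by (simp add: \<phi>_def)
  qed
  have "q 0 = 0" by (simp add: q_def \<phi>_def p0_def)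
  from Schwarz_Lemma(1)[OF hq this qlt w] have "cmod (q w) \<le> cmod w" by simp
  moreover have "p z - p0 = q w * (p z + cnj p0)"
    using den[OF w] by (simp add: q_def \<phi>w)
  ultimately have "cmod (p z - p0) \<le> cmod w * (cmod (p z) + cmod p0)"
    using norm_triangle_ineq[of "p z" "cnj p0"]
    by (simp add: norm_mult) (meson mult_mono norm_ge_zero order_trans)
  then have "cmod (p z) * (1 - cmod w) \<le> cmod p0 * (1 + cmod w)"
    using norm_triangle_ineq2[of "p z" p0] by (simp add: algebra_simps)
  \<comment> \<open>Multiplying by \<open>1 + cmod w\<close> creates
    \<open>1 - (cmod w)\<^sup>2\<close>; the crude factor 4 on the right cancels the 4 in
    \<open>id\<close>.\<close>
  then have "cmod (p z) * (1 - cmod w) * (1 + cmod w) \<le> cmod p0 * (1 + cmod w) * (1 + cmod w)"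
    by (intro mult_right_mono) auto
  also have "\<dots> \<le> cmod p0 * 2 * 2"
    using w by (intro mult_mono) auto
  also have "cmod (p z) * (1 - cmod w) * (1 + cmod w) = cmod (p z) * (1 - (cmod w)\<^sup>2)"
    by (simp add: power2_eq_square algebra_simps)
  finally have "cmod (p z) * (4 * Im z / (cmod (z + \<i>))\<^sup>2) \<le> 4 * cmod p0"
    unfolding id by simp
  then show ?thesis using z zi by (simp add: p0_def field_simps)
qed

text \<open>Multiplying by \<open>(z\<^sup>2 - R\<^sup>2)\<^sup>2\<close> kills the singularities of the bound at \<open>\<plusminus>R\<close> on the circle of radius \<open>R\<close>.\<close>

lemma entire_linear_of_half_plane_bound:
  assumes hol: "f holomorphic_on UNIV" and C: "0 \<le> C"
    and bound: "\<And>z. Im z \<noteq> 0 \<Longrightarrow> cmod (f z) \<le> C * (1 + 2 / \<bar>Im z\<bar>) * (cmod z + 2)\<^sup>2 * (2 / \<bar>Im z\<bar>)"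
  shows "f z = f 0 + deriv f 0 * z"
proof -
  have lin: "cmod (f z) \<le> 256 * C * cmod z ^ 1" if z: "1 \<le> cmod z" for z
  proof -
    \<comment> \<open>This radius gives the multiplier modulus at least
      \<open>(3 / 4 * R\<^sup>2)\<^sup>2\<close> at \<open>z\<close>; dividing a bound of order R^5
      by it leaves linear growth.\<close>
    define R where "R = 2 * cmod z"
    have R: "2 \<le> R" using z by (simp add: R_def)
    define h where "h w = f w * (w\<^sup>2 - of_real (R\<^sup>2))\<^sup>2" for w
    have hh: "h holomorphic_on A" for A
      unfolding h_def by (intro holomorphic_intros holomorphic_on_subset[OF hol]) auto
    have "cmod (h z) \<le> 64 * C * R ^ 5"
    proof (rule maximum_modulus_frontier[of h "ball 0 R :: complex set"])
      show "h holomorphic_on interior (ball 0 R)" by (rule hh)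
      show "continuous_on (closure (ball 0 R)) h" by (intro holomorphic_on_imp_continuous_on hh)
      show "z \<in> ball 0 R" using z by (auto simp: R_def)
      fix w :: complex assume "w \<in> frontier (ball 0 R)"
      then have w: "cmod w = R" using R by (simp add: frontier_ball)
      define Y where "Y = \<bar>Im w\<bar>"
      \<comment> \<open>On the circle \<open>R\<^sup>2 = w * cnj w\<close>, so this factor has
        modulus \<open>2 * R * Y\<close>; squared, it balances the second-order singularity of the
        bound at \<open>Y = 0\<close>.\<close>
      have "w\<^sup>2 - of_real (R\<^sup>2) = w * (w - cnj w)"
        unfolding w[symmetric] complex_norm_square by (simp add: power2_eq_square algebra_simps)
      moreover have "cmod (w - cnj w) = 2 * Y" by (simp add: Y_def cmod_def real_sqrt_mult)
      ultimately have eq: "cmod (w\<^sup>2 - of_real (R\<^sup>2)) = 2 * R * Y" by (simp add: norm_mult w)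
      show "cmod (h w) \<le> 64 * C * R ^ 5"
      proof (cases "Y = 0")
        case True
        then have "h w = 0" using eq by (simp add: h_def)
        then show ?thesis using C R by simp
      next
        case False
        then have Y: "0 < Y" by (simp add: Y_def)
        have "Y \<le> R" unfolding Y_def w[symmetric] by (rule abs_Im_le_cmod)
        have "cmod (h w) = cmod (f w) * (2 * R * Y)\<^sup>2" by (simp only: h_def norm_mult norm_power eq)
        also have "\<dots> \<le> (C * (1 + 2 / Y) * (R + 2)\<^sup>2 * (2 / Y)) * (2 * R * Y)\<^sup>2"
          using bound[of w] Y by (intro mult_right_mono) (auto simp: Y_def w)
        also have "\<dots> = 8 * C * R\<^sup>2 * ((R + 2)\<^sup>2 * (Y + 2))"
          using Y by (simp add: field_simps power2_eq_square)
        also have "\<dots> \<le> 8 * C * R\<^sup>2 * ((2 * R)\<^sup>2 * (2 * R))"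
          using C R \<open>Y \<le> R\<close> Y by (intro mult_left_mono mult_mono power_mono) auto
        also have "\<dots> = 64 * C * R ^ 5"
          by (simp add: power2_eq_square eval_nat_numeral)
        finally show ?thesis .
      qed
    qed auto
    moreover have "3 / 4 * R\<^sup>2 \<le> cmod (z\<^sup>2 - of_real (R\<^sup>2))"
      using norm_triangle_ineq2[of "of_real (R\<^sup>2)" "z\<^sup>2"]
      by (simp add: R_def norm_minus_commute norm_power power_mult_distrib flip: of_real_power of_real_mult)
    then have "(3 / 4 * R\<^sup>2)\<^sup>2 \<le> (cmod (z\<^sup>2 - of_real (R\<^sup>2)))\<^sup>2"
      by (rule power_mono) simp
    then have "cmod (f z) * (3 / 4 * R\<^sup>2)\<^sup>2 \<le> cmod (h z)"
      unfolding h_def norm_mult norm_power by (rule mult_left_mono) simp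
    ultimately have "cmod (f z) * (3 / 4 * R\<^sup>2)\<^sup>2 \<le> 64 * C * R ^ 5" by linarith
    then have "cmod (f z) * (9 / 16) * R ^ 4 \<le> (64 * C * R) * R ^ 4"
      by (simp add: power2_eq_square eval_nat_numeral mult_ac)
    then have "cmod (f z) * (9 / 16) \<le> 64 * C * R" using R by simp
    moreover have "0 \<le> C * cmod z" using C by simp
    ultimately show ?thesis by (simp add: R_def)
  qed
  have "f z = (\<Sum>k\<le>1. (deriv ^^ k) f 0 / fact k * z ^ k)"
    by (rule Liouville_polynomial[OF hol lin])
  then show ?thesis by simp
qed

text \<open>Both \<open>log F\<close> and \<open>log F + 2 i \<gamma>\<close> have real part bounded above on \<open>Im z > \<epsilon>\<close>, hence grow at most
  like a function with positive real part; so does their difference \<open>2 i \<gamma>\<close>.\<close>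

lemma linear_exponent:
  assumes hol: "\<gamma> holomorphic_on UNIV" and sh: "sharp \<gamma> = \<gamma>" and \<gamma>0: "\<gamma> 0 = 0"
    and F: "H2_upper F" "\<And>z. 0 < Im z \<Longrightarrow> F z \<noteq> 0"
    and uF: "H2_upper (\<lambda>z. exp (2 * \<i> * \<gamma> z) * F z)"
  obtains a :: real where "\<And>z. \<gamma> z = of_real a * z"
proof -
  let ?H = "{z. 0 < Im z}"
  have hF: "F holomorphic_on ?H" using F(1) by (simp add: H2_upper_def)
  have h\<gamma>: "\<gamma> holomorphic_on A" for A by (rule holomorphic_on_subset[OF hol]) simp
  have i: "\<i> \<in> ?H" by simp
  obtain \<phi> where h\<phi>: "\<phi> holomorphic_on ?H" and e\<phi>: "\<And>z. z \<in> ?H \<Longrightarrow> exp (\<phi> z) = F z"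
    by (rule holomorphic_logarithm_exists[OF convex_halfspace_Im_gt open_halfspace_Im_gt hF _ i]) (use F(2) in auto)
  obtain M1 where M1: "0 < M1" "\<And>z. 0 < Im z \<Longrightarrow> cmod (F z) \<le> M1 / sqrt (Im z)"
    by (rule H2_upper_pointwise[OF F(1)]) blast
  obtain M2 where M2: "0 < M2" "\<And>z. 0 < Im z \<Longrightarrow> cmod (exp (2 * \<i> * \<gamma> z) * F z) \<le> M2 / sqrt (Im z)"
    by (rule H2_upper_pointwise[OF uF]) blast
  define M where "M = 2 * (M1 + M2)"
  have M: "0 < M" using M1 M2 by (simp add: M_def)
  \<comment> \<open>The segment from \<open>\<i>\<close> to \<open>2 * \<i>\<close> contains every
    shifted base point \<open>\<i> + Complex 0 e\<close>, so the bounds \<open>B1\<close> and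
    \<open>B2\<close> do not depend on \<open>e\<close>.\<close>
  define S where "S = (\<lambda>t. \<i> + Complex 0 t) ` {0..1::real}"
  have cS: "compact S"
    unfolding S_def by (intro compact_continuous_image continuous_intros compact_Icc)
  have SH: "S \<subseteq> ?H" by (auto simp: S_def)
  have "bounded (\<phi> ` S)" "bounded (\<gamma> ` S)"
    by (intro compact_imp_bounded compact_continuous_image cS holomorphic_on_imp_continuous_on
        h\<gamma> holomorphic_on_subset[OF h\<phi> SH])+
  then obtain B1 B2 where B1: "\<And>z. z \<in> S \<Longrightarrow> cmod (\<phi> z) \<le> B1" and B2: "\<And>z. z \<in> S \<Longrightarrow> cmod (\<gamma> z) \<le> B2"
    unfolding bounded_iff by auto
  have "\<i> \<in> S" unfolding S_def by (rule image_eqI[of _ _ 0]) (auto simp: complex_eq_iff)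
  then have B0: "0 \<le> B1" "0 \<le> B2" using B1[of \<i>] B2[of \<i>] norm_ge_zero order_trans by blast+
  define C where "C = \<bar>ln M\<bar> + 1 + B1 + 2 * B2"
  have C: "0 \<le> C" using B0 by (simp add: C_def)
  have shifted: "cmod (\<gamma> (z + Complex 0 e)) \<le> C / e * (cmod (z + \<i>))\<^sup>2 / Im z" if e: "0 < e" "e \<le> 1" and z: "0 < Im z" for e z
  proof -
    define L where "L = ln (M / sqrt e)"
    have Mlt: "max M1 M2 / sqrt (Im w + e) < M / sqrt e" if "0 < Im w" for w
    proof (rule frac_less)
      show "max M1 M2 < M" using M1 M2 by (simp add: M_def)
    qed (use M1 M2 e that in auto)
    define p where "p w = of_real L - \<phi> (w + Complex 0 e)" for w
    define q where "q w = of_real L - (2 * \<i> * \<gamma> (w + Complex 0 e) + \<phi> (w + Complex 0 e))" for w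
    have "(\<phi> \<circ> (\<lambda>w. w + Complex 0 e)) holomorphic_on ?H" "(\<gamma> \<circ> (\<lambda>w. w + Complex 0 e)) holomorphic_on ?H"
      by (intro holomorphic_on_compose_gen[OF _ h\<phi>] holomorphic_on_compose_gen[OF _ hol] holomorphic_intros; use e in auto)+
    note sh = this[unfolded o_def]
    have hp: "p holomorphic_on ?H" unfolding p_def by (intro holomorphic_intros sh)
    have hq: "q holomorphic_on ?H" unfolding q_def by (intro holomorphic_intros sh)
    have ReL: "0 < Re (of_real L - a)" if "cmod (exp a) < M / sqrt e" for a
    proof -
      have "exp (Re a) < M / sqrt e" using that by (simp add: norm_exp_eq_Re)
      then have "ln (exp (Re a)) < ln (M / sqrt e)"
        by (subst ln_less_cancel_iff) (use M e in auto)
      then have "Re a < L" by (simp add: L_def)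
      then show ?thesis by simp
    qed
    have posp: "0 < Re (p w)" if w: "0 < Im w" for w
    proof -
      have Im: "0 < Im (w + Complex 0 e)" using w e by simp
      have "cmod (exp (\<phi> (w + Complex 0 e))) \<le> M1 / sqrt (Im w + e)"
        using M1(2)[OF Im] e\<phi>[of "w + Complex 0 e"] Im by simp
      also have "\<dots> \<le> max M1 M2 / sqrt (Im w + e)" using w e by (intro divide_right_mono) auto
      also have "\<dots> < M / sqrt e" by (rule Mlt[OF w])
      finally show ?thesis unfolding p_def by (rule ReL)
    qed
    have posq: "0 < Re (q w)" if w: "0 < Im w" for w
    proof -
      have Im: "0 < Im (w + Complex 0 e)" using w e by simp
      have "cmod (exp (2 * \<i> * \<gamma> (w + Complex 0 e) + \<phi> (w + Complex 0 e))) \<le> M2 / sqrt (Im w + e)"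
        using M2(2)[OF Im] e\<phi>[of "w + Complex 0 e"] Im by (simp add: exp_add)
      also have "\<dots> \<le> max M1 M2 / sqrt (Im w + e)" using w e by (intro divide_right_mono) auto
      also have "\<dots> < M / sqrt e" by (rule Mlt[OF w])
      finally show ?thesis unfolding q_def by (rule ReL)
    qed
    have S: "\<i> + Complex 0 e \<in> S" using e by (auto simp: S_def)
    have "\<bar>L\<bar> \<le> \<bar>ln M\<bar> + 1 / e"
    proof -
      have "L = ln M + ln (1 / e) / 2" using M e by (simp add: L_def ln_div ln_sqrt)
      moreover have "ln (1 / e) \<le> 1 / e - 1" by (rule ln_le_minus_one) (use e in simp)
      moreover have "0 \<le> ln (1 / e)" using e by simp
      moreover have "1 \<le> 1 / e" using e by simp
      ultimately show ?thesis by linarith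
    qed
    also have "\<dots> + B1 + 2 * B2 \<le> C / e"
    proof -
      have "\<bar>ln M\<bar> + B1 + 2 * B2 \<le> (\<bar>ln M\<bar> + B1 + 2 * B2) / e"
        using e B0 by (simp add: pos_le_divide_eq mult_left_le)
      then show ?thesis by (simp add: C_def add_divide_distrib)
    qed
    finally have LC: "\<bar>L\<bar> + B1 + 2 * B2 \<le> C / e" by simp
    have "cmod (p \<i>) \<le> \<bar>L\<bar> + B1"
      unfolding p_def using B1[OF S] norm_triangle_ineq4[of "of_real L" "\<phi> (\<i> + Complex 0 e)"] by simp
    then have p: "cmod (p \<i>) \<le> C / e" using LC B0 by linarith
    have "cmod (q \<i>) \<le> \<bar>L\<bar> + (2 * B2 + B1)"
    proof -
      have "cmod (2 * \<i> * \<gamma> (\<i> + Complex 0 e) + \<phi> (\<i> + Complex 0 e)) \<le> 2 * B2 + B1"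
        by (rule norm_triangle_le) (use B1[OF S] B2[OF S] in \<open>auto simp: norm_mult\<close>)
      then show ?thesis unfolding q_def
        using norm_triangle_ineq4[of "of_real L" "2 * \<i> * \<gamma> (\<i> + Complex 0 e) + \<phi> (\<i> + Complex 0 e)"] by simp
    qed
    then have q: "cmod (q \<i>) \<le> C / e" using LC by linarith
    have "2 * \<i> * \<gamma> (z + Complex 0 e) = p z - q z" by (simp add: p_def q_def)
    then have "2 * cmod (\<gamma> (z + Complex 0 e)) = cmod (p z - q z)" by (metis norm_mult norm_ii norm_numeral mult.right_neutral)
    also have "\<dots> \<le> cmod (p z) + cmod (q z)" by (rule norm_triangle_ineq4)
    also have "\<dots> \<le> cmod (p \<i>) * (cmod (z + \<i>))\<^sup>2 / Im z + cmod (q \<i>) * (cmod (z + \<i>))\<^sup>2 / Im z"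
      by (intro add_mono Caratheodory_upper_half_plane hp hq posp posq z)
    also have "\<dots> \<le> C / e * (cmod (z + \<i>))\<^sup>2 / Im z + C / e * (cmod (z + \<i>))\<^sup>2 / Im z"
      using z p q by (intro add_mono divide_right_mono mult_right_mono) auto
    finally show ?thesis by simp
  qed
  have upper: "cmod (\<gamma> z) \<le> C * (1 + 2 / Im z) * (cmod z + 2)\<^sup>2 * (2 / Im z)" if z: "0 < Im z" for z
  proof -
    \<comment> \<open>The shift is proportional to small heights, so its cost \<open>1 / e\<close>
      becomes one more factor of order \<open>1 / Im z\<close>; the cap 1 keeps the base point on
      \<open>S\<close>.\<close>
    define e where "e = min 1 (Im z / 2)"
    have e: "0 < e" "e \<le> 1" "e \<le> Im z / 2" using z by (auto simp: e_def)
    have ie: "1 / e \<le> 1 + 2 / Im z" using z by (auto simp: e_def min_def field_simps)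
    define w where "w = z - Complex 0 e"
    have w: "Im z / 2 \<le> Im w" using e by (simp add: w_def)
    have "cmod (w + \<i>) \<le> cmod z + cmod (\<i> - Complex 0 e)"
      using norm_triangle_ineq[of z "\<i> - Complex 0 e"] by (simp add: w_def algebra_simps)
    also have "cmod (\<i> - Complex 0 e) \<le> 2" using e by (simp add: cmod_def)
    finally have n: "cmod (w + \<i>) \<le> cmod z + 2" by simp
    have "cmod (\<gamma> z) = cmod (\<gamma> (w + Complex 0 e))" by (simp add: w_def)
    also have "\<dots> \<le> C / e * (cmod (w + \<i>))\<^sup>2 / Im w" by (rule shifted) (use e w z in auto)
    also have "\<dots> = C * (1 / e) * (cmod (w + \<i>))\<^sup>2 * (1 / Im w)" by simp
    also have "\<dots> \<le> C * (1 + 2 / Im z) * (cmod z + 2)\<^sup>2 * (2 / Im z)"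
    proof (intro mult_mono power_mono n ie order_refl)
      show "1 / Im w \<le> 2 / Im z" using w z by (simp add: field_simps)
    qed (use C z w e in auto)
    finally show ?thesis .
  qed
  have bound: "cmod (\<gamma> z) \<le> C * (1 + 2 / \<bar>Im z\<bar>) * (cmod z + 2)\<^sup>2 * (2 / \<bar>Im z\<bar>)" if z: "Im z \<noteq> 0" for z
  proof (cases "0 < Im z")
    case False
    have "cmod (\<gamma> z) = cmod (\<gamma> (cnj z))" using fun_cong[OF sh, of z] by (metis complex_mod_cnj sharp_def)
    then show ?thesis using upper[of "cnj z"] z False by simp
  qed (use upper[of z] in simp)
  have lin: "\<gamma> z = deriv \<gamma> 0 * z" for z
    using entire_linear_of_half_plane_bound[OF hol C bound, of z] \<gamma>0 by simp
  have "cnj (deriv \<gamma> 0) = deriv \<gamma> 0"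
    using fun_cong[OF sh, of 1] lin[of 1] by (simp add: sharp_def)
  then obtain a where "deriv \<gamma> 0 = of_real a" by (metis Reals_cases Reals_cnj_iff)
  then show ?thesis using that lin by metis
qed

text \<open>Two majorants, because division by \<open>z + \<i>\<close> expresses a function through
  a member of the space and its difference quotient.\<close>

lemma H2_upper_dominated:
  assumes f: "f holomorphic_on {z. 0 < Im z}" and g: "H2_upper g" and h: "H2_upper h" and A: "0 \<le> A" "0 \<le> B"
    and le: "\<And>z. 0 < Im z \<Longrightarrow> cmod (f z) \<le> A * cmod (g z) + B * cmod (h z)"
  shows "H2_upper f"
proof -
  obtain C D where C: "\<forall>y>0. integrable lborel (\<lambda>x. (cmod (g (Complex x y)))\<^sup>2) \<and> (\<integral>x. (cmod (g (Complex x y)))\<^sup>2 \<partial>lborel) \<le> C"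
    and D: "\<forall>y>0. integrable lborel (\<lambda>x. (cmod (h (Complex x y)))\<^sup>2) \<and> (\<integral>x. (cmod (h (Complex x y)))\<^sup>2 \<partial>lborel) \<le> D"
    using g h unfolding H2_upper_def by auto
  show ?thesis
    unfolding H2_upper_def
  proof (intro conjI f exI[of _ "2 * A\<^sup>2 * C + 2 * B\<^sup>2 * D"] allI impI)
    fix y :: real assume y: "0 < y"
    let ?b = "\<lambda>x. 2 * A\<^sup>2 * (cmod (g (Complex x y)))\<^sup>2 + 2 * B\<^sup>2 * (cmod (h (Complex x y)))\<^sup>2"
    have [measurable]: "(\<lambda>x. f (Complex x y)) \<in> borel_measurable borel"
      by (rule borel_measurable_continuous_onI[OF holomorphic_upper_continuous_horizontal[OF f y]])
    have b: "integrable lborel ?b" using C D y by (intro Bochner_Integration.integrable_add integrable_mult_right) auto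
    have pt: "(cmod (f (Complex x y)))\<^sup>2 \<le> ?b x" for x
    proof -
      let ?p = "A * cmod (g (Complex x y))" and ?q = "B * cmod (h (Complex x y))"
      have "(cmod (f (Complex x y)))\<^sup>2 \<le> (?p + ?q)\<^sup>2" using le[of "Complex x y"] y by (intro power_mono) auto
      also have "\<dots> \<le> 2 * ?p\<^sup>2 + 2 * ?q\<^sup>2"
        using zero_le_power2[of "?p - ?q"] by (simp add: power2_sum power2_diff)
      finally show ?thesis by (simp add: power_mult_distrib)
    qed
    show i: "integrable lborel (\<lambda>x. (cmod (f (Complex x y)))\<^sup>2)"
      by (rule Bochner_Integration.integrable_bound[OF b]) (use pt in \<open>auto intro: order_trans[OF _ abs_ge_self]\<close>)
    have "(\<integral>x. (cmod (f (Complex x y)))\<^sup>2 \<partial>lborel) \<le> (\<integral>x. ?b x \<partial>lborel)"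
      by (rule integral_mono[OF i b pt])
    also have "\<dots> = 2 * A\<^sup>2 * (\<integral>x. (cmod (g (Complex x y)))\<^sup>2 \<partial>lborel) + 2 * B\<^sup>2 * (\<integral>x. (cmod (h (Complex x y)))\<^sup>2 \<partial>lborel)"
      using C D y by simp
    also have "\<dots> \<le> 2 * A\<^sup>2 * C + 2 * B\<^sup>2 * D"
      using C D y by (intro add_mono mult_left_mono) auto
    finally show "(\<integral>x. (cmod (f (Complex x y)))\<^sup>2 \<partial>lborel) \<le> 2 * A\<^sup>2 * C + 2 * B\<^sup>2 * D" .
  qed
qed

text \<open>Along the imaginary axis the hypothesis forces the quotient in \<open>exp_type\<close>
  to be at least \<open>b\<close> up to a term tending to 0, and a limit along one ray bounds the
  upper limit from below.\<close>

lemma exp_type_lower_bound: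
  assumes M: "0 < M" and nz: "\<And>y. 0 < y \<Longrightarrow> E (\<i> * of_real y) \<noteq> 0"
    and le: "\<And>y. 0 < y \<Longrightarrow> exp (b * y) / ((y + 1) * cmod (E (\<i> * of_real y))) \<le> M / sqrt y"
  shows "ereal b \<le> exp_type E"
proof (rule ccontr)
  assume "\<not> ?thesis"
  then obtain c where L: "Limsup at_infinity (\<lambda>z. ereal (ln (cmod (E z)) / cmod z)) < c" and c: "c < ereal b"
    unfolding exp_type_def by (meson dense not_le)
  let ?g = "\<lambda>y. b + (ln y / 2 - ln M - ln (y + 1)) / y"
  have lower: "?g y \<le> ln (cmod (E (\<i> * of_real y))) / cmod (\<i> * of_real y)" if y: "0 < y" for y
  proof -
    have pos: "0 < cmod (E (\<i> * of_real y))" using nz[OF y] by simp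
    have "exp (b * y) * sqrt y \<le> M * ((y + 1) * cmod (E (\<i> * of_real y)))"
      using le[OF y] y pos by (simp add: divide_simps mult_ac)
    then have "ln (exp (b * y) * sqrt y) \<le> ln (M * ((y + 1) * cmod (E (\<i> * of_real y))))"
      using y by (subst ln_le_cancel_iff) (use M pos in auto)
    then have "b * y + ln y / 2 \<le> ln M + (ln (y + 1) + ln (cmod (E (\<i> * of_real y))))"
      using y M pos by (simp add: ln_mult ln_sqrt)
    then have "(b * y + (ln y / 2 - ln M - ln (y + 1))) / y \<le> ln (cmod (E (\<i> * of_real y))) / y"
      using y by (intro divide_right_mono) auto
    then show ?thesis using y by (simp add: norm_mult add_divide_distrib)
  qed
  have lim: "(?g \<longlongrightarrow> b) at_top" using M by real_asymp
  then have "((\<lambda>y. ereal (?g y)) \<longlongrightarrow> ereal b) at_top" by simp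
  then have ev: "\<forall>\<^sub>F y in at_top. c < ereal (?g y)" by (rule order_tendstoD(1)[OF _ c])
  have "\<forall>\<^sub>F z in at_infinity. ereal (ln (cmod (E z)) / cmod z) < c"
    by (rule Limsup_lessD[OF L])
  moreover have "filterlim (\<lambda>y::real. \<i> * of_real y) at_infinity at_top"
    by (rule filterlim_norm_at_top_imp_at_infinity) (simp add: norm_mult filterlim_abs_real)
  ultimately have "\<forall>\<^sub>F y::real in at_top. ereal (ln (cmod (E (\<i> * of_real y))) / cmod (\<i> * of_real y)) < c"
    by (rule eventually_compose_filterlim)
  with ev eventually_gt_at_top[of 0] have "\<forall>\<^sub>F y::real in at_top. False"
  proof eventually_elim
    case (elim y)
    then show False using lower[of y] by (meson ereal_less_eq(3) less_le_trans less_asym)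
  qed
  then show False by simp
qed

section \<open>The two additional hypotheses\<close>

context debranges_factor begin

lemma u_square_exp: "exp (2 * \<i> * \<gamma> z) = u z * u z"
  by (simp add: u_def mult.assoc flip: exp_add mult_2)

text \<open>\<open>phase * P = sharp Q\<close>, after cancelling \<open>z + \<i>\<close>, relates
  \<open>K \<i>\<close> to \<open>sharp (K (-\<i>))\<close>. The two membership conditions of
  \<open>deBranges W\<close> thus supply the two H^2 functions for
  \<open>linear_exponent\<close>.\<close>

lemma linear_of_subspace:
  assumes W: "HB W" and sub: "N \<subseteq> deBranges W"
  obtains a :: real where "\<And>z. \<gamma> z = of_real a * z"
proof -
  have Wnz: "W z \<noteq> 0" if "0 < Im z" for z using W that by (force simp: HB_def)
  have F: "H2_upper (\<lambda>z. K \<i> z / W z)" using sub K(1)[of \<i>] by (auto simp: deBranges_def)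
  have G: "H2_upper (\<lambda>z. sharp (K (-\<i>)) z / W z)" using sub K(1)[of "-\<i>"] by (auto simp: deBranges_def)
  define d where "d = of_real (nrm (K \<i>)) / (of_real (nrm (K (-\<i>))) * phase 0)"
  have eq: "exp (2 * \<i> * \<gamma> z) * (K \<i> z / W z) = d * (sharp (K (-\<i>)) z / W z)" if z: "0 < Im z" for z
  proof -
    have n: "complex_of_real (nrm (K \<i>)) \<noteq> 0" "complex_of_real (nrm (K (-\<i>))) \<noteq> 0"
      using K_self(2)[of \<i>] K_self(2)[of "-\<i>"] by auto
    have zi: "z + \<i> \<noteq> 0" using z by (auto simp: complex_eq_iff)
    have "phase z * P z = sharp Q z" using phase_eq[of z] P_nonzero[of z] z by simp
    moreover have "sharp Q z = (z + \<i>) * sharp (K (-\<i>)) z / of_real (nrm (K (-\<i>)))"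
      by (simp add: sharp_def Q_def)
    ultimately have "(z + \<i>) * (phase z * K \<i> z / of_real (nrm (K \<i>))) = (z + \<i>) * (sharp (K (-\<i>)) z / of_real (nrm (K (-\<i>))))"
      by (simp add: P_def mult_ac)
    then have "phase z * K \<i> z / of_real (nrm (K \<i>)) = sharp (K (-\<i>)) z / of_real (nrm (K (-\<i>)))"
      using zi mult_left_cancel by blast
    then have "phase z * K \<i> z = of_real (nrm (K \<i>)) * (sharp (K (-\<i>)) z / of_real (nrm (K (-\<i>))))"
      using n by (simp add: field_simps)
    then show ?thesis
      unfolding \<gamma>_phase d_def by (simp add: mult_ac)
  qed
  have "H2_upper (\<lambda>z. exp (2 * \<i> * \<gamma> z) * (K \<i> z / W z))"
  proof (rule H2_upper_dominated[OF _ G G, of _ "cmod d" 0])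
    have "(\<lambda>z. K \<i> z / W z) holomorphic_on {z. 0 < Im z}" using F by (simp add: H2_upper_def)
    then show "(\<lambda>z. exp (2 * \<i> * \<gamma> z) * (K \<i> z / W z)) holomorphic_on {z. 0 < Im z}"
      by (rule holomorphic_on_mult[rotated]) (intro holomorphic_intros holomorphic_on_subset[OF \<gamma>_hol] subset_UNIV)
    show "cmod (exp (2 * \<i> * \<gamma> z) * (K \<i> z / W z)) \<le> cmod d * cmod (sharp (K (-\<i>)) z / W z) + 0 * cmod (sharp (K (-\<i>)) z / W z)"
      if "0 < Im z" for z
      unfolding eq[OF that] by (simp add: norm_mult norm_divide)
  qed auto
  then show ?thesis
    using linear_exponent[OF \<gamma>_hol \<gamma>_sharp \<gamma>_0 F] K_i_nonzero Wnz that by (metis divide_eq_0_iff less_imp_le)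
qed

text \<open>Surjectivity of \<open>backshift\<close> minus \<open>1 / w\<close> gives
  \<open>g\<close> with \<open>f = backshift g - g / w\<close>; the difference quotient of
  \<open>f\<close> at \<open>w\<close> is a linear combination of \<open>f\<close> and
  \<open>g\<close>.\<close>

lemma difference_quotient_mem:
  assumes spec: "spectrum_on N nrm backshift = {0}" and w: "w \<noteq> 0" and f: "f \<in> N"
  obtains h where "h \<in> N" "\<And>z. z \<noteq> w \<Longrightarrow> h z = (f z - f w) / (z - w)"
proof -
  have "1 / w \<notin> spectrum_on N nrm backshift" using spec w by simp
  then have "bij_betw (\<lambda>f. (\<lambda>z. backshift f z - 1 / w * f z)) N N"
    unfolding spectrum_on_def mem_Collect_eq not_not by (rule conjunct1)
  then have "f \<in> (\<lambda>f. (\<lambda>z. backshift f z - 1 / w * f z)) ` N"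
    using f by (simp only: bij_betw_imp_surj_on)
  then obtain g where eq: "f = (\<lambda>z. backshift g z - 1 / w * g z)" and g: "g \<in> N"
    by (rule imageE)
  have id: "g z * (w - z) = w * g 0 + w * z * f z" for z
  proof (cases "z = 0")
    case False
    have "(g z - g 0) / z - 1 / w * g z = f z" using fun_cong[OF eq, of z] False by (simp add: backshift_def)
    then have "(g z - g 0) * w - z * g z = f z * (w * z)" using False w by (simp add: field_simps)
    then show ?thesis by (simp add: algebra_simps)
  qed simp
  \<comment> \<open>At \<open>z = w\<close> the left side of \<open>id\<close> vanishes, which
    determines \<open>g 0\<close>.\<close>
  have "w * g 0 = w * (- w * f w)" using id[of w] by (simp add: eq_neg_iff_add_eq_0 mult.assoc)
  then have g0: "g 0 = - w * f w" using w by (simp only: mult_cancel_left) simp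
  define h where "h = (\<lambda>z. - 1 / w\<^sup>2 * (g z + w * f z))"
  have "h \<in> N" unfolding h_def by (intro scale_mem add_mem g f)
  moreover have "h z = (f z - f w) / (z - w)" if z: "z \<noteq> w" for z
  proof -
    have "(g z + w * f z) * (w - z) = w\<^sup>2 * (f z - f w)"
      using id[of z] unfolding g0 by (simp add: algebra_simps power2_eq_square)
    then have "g z + w * f z = w\<^sup>2 * (f z - f w) / (w - z)" using z by (simp add: nonzero_eq_divide_eq)
    then have "h z = - ((f z - f w) / (w - z))" using w by (simp add: h_def)
    also have "\<dots> = (f z - f w) / (z - w)" by (metis minus_diff_eq minus_divide_right)
    finally show ?thesis .
  qed
  ultimately show ?thesis by (rule that)
qed

text \<open>The constant \<open>f w\<close> over \<open>z - w\<close> is \<open>f / (z - w)\<close>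
  minus the difference quotient, which stays in \<open>N\<close>. Taking \<open>w = -\<i>\<close>
  for \<open>U f\<close> leaves the factor \<open>u\<close>; taking \<open>w = \<i>\<close> for
  \<open>sharp (U f)\<close> leaves \<open>1 / u\<close>, with the pole moved to
  \<open>-\<i>\<close> by conjugation.\<close>

lemma H2_upper_quotients:
  assumes spec: "spectrum_on N nrm backshift = {0}"
  shows "H2_upper (\<lambda>z. u z / ((z + \<i>) * E z))" "H2_upper (\<lambda>z. 1 / (u z * ((z + \<i>) * E z)))"
proof -
  have zi: "z + \<i> \<noteq> 0" "1 \<le> cmod (z + \<i>)" if "0 < Im z" for z
  proof -
    have "1 \<le> \<bar>Im (z + \<i>)\<bar>" using that by simp
    then show "1 \<le> cmod (z + \<i>)" using abs_Im_le_cmod order_trans by blast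
    then show "z + \<i> \<noteq> 0" by auto
  qed
  have H2: "H2_upper (\<lambda>z. U f z / E z)" "H2_upper (\<lambda>z. sharp (U f) z / E z)" if "f \<in> N" for f
    using U_mem[OF that] by (auto simp: deBranges_def)
  have hol: "(\<lambda>z. c z / ((z + \<i>) * E z)) holomorphic_on {z. 0 < Im z}" if "c holomorphic_on {z. 0 < Im z}" for c
    using that by (intro holomorphic_intros E_hol) (use zi E_nz in auto)
  have alg1: "U / (w * e) = (U * F / e / w - U * ((F - F0) / w) / e) / F0" if "w \<noteq> 0" "e \<noteq> 0" "F0 \<noteq> 0" for U w e F F0 :: complex
    using that by (simp add: field_simps)
  have alg2: "1 / (U * (w * e)) = (F / U / e / w - (F - F0) / w / U / e) / F0" if "U \<noteq> 0" "w \<noteq> 0" "e \<noteq> 0" "F0 \<noteq> 0" for U w e F F0 :: complex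
    using that by (simp add: field_simps)
  obtain f where f: "f \<in> N" "f (-\<i>) \<noteq> 0" using nocommon by blast
  obtain h where h: "h \<in> N" "\<And>z. z \<noteq> -\<i> \<Longrightarrow> h z = (f z - f (-\<i>)) / (z - (-\<i>))"
    by (rule difference_quotient_mem[OF spec _ f(1), of "-\<i>"]) (auto simp: complex_eq_iff)
  have dom: "cmod ((a / w - b) / c) \<le> 1 / cmod c * cmod a + 1 / cmod c * cmod b" if "1 \<le> cmod w" for a b c w :: complex
  proof -
    have "cmod (a / w - b) \<le> cmod (a / w) + cmod b" by (rule norm_triangle_ineq4)
    also have "cmod (a / w) \<le> cmod a" using that by (simp add: norm_divide divide_le_eq mult_left_le_one_le mult_le_cancel_left1)
    finally have "cmod (a / w - b) \<le> cmod a + cmod b" by simp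
    then show ?thesis by (simp add: norm_divide divide_right_mono flip: add_divide_distrib)
  qed
  show "H2_upper (\<lambda>z. u z / ((z + \<i>) * E z))"
  proof (rule H2_upper_dominated[OF hol[OF u_hol] H2(1)[OF f(1)] H2(1)[OF h(1)]])
    fix z :: complex assume z: "0 < Im z"
    have eq: "u z / ((z + \<i>) * E z) = (U f z / E z / (z + \<i>) - U h z / E z) / f (-\<i>)"
    proof -
      have "z \<noteq> -\<i>" using z by auto
      then have "h z = (f z - f (-\<i>)) / (z + \<i>)" using h(2)[of z] by simp
      then show ?thesis using alg1[OF zi(1)[OF z] E_nz f(2)] z by (simp add: U_def)
    qed
    show "cmod (u z / ((z + \<i>) * E z)) \<le> 1 / cmod (f (-\<i>)) * cmod (U f z / E z) + 1 / cmod (f (-\<i>)) * cmod (U h z / E z)"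
      unfolding eq by (rule dom[OF zi(2)[OF z]])
  qed auto
  obtain f where f: "f \<in> N" "f \<i> \<noteq> 0" using nocommon by blast
  obtain h where h: "h \<in> N" "\<And>z. z \<noteq> \<i> \<Longrightarrow> h z = (f z - f \<i>) / (z - \<i>)"
    by (rule difference_quotient_mem[OF spec _ f(1), of \<i>]) auto
  have "(\<lambda>z. 1 / u z) holomorphic_on {z. 0 < Im z}" by (intro holomorphic_intros u_hol) auto
  from hol[OF this] have hol': "(\<lambda>z. 1 / (u z * ((z + \<i>) * E z))) holomorphic_on {z. 0 < Im z}" by simp
  show "H2_upper (\<lambda>z. 1 / (u z * ((z + \<i>) * E z)))"
  proof (rule H2_upper_dominated[OF hol' H2(2)[OF f(1)] H2(2)[OF h(1)]])
    fix z :: complex assume z: "0 < Im z"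
    have cz: "cnj z \<noteq> \<i>" using z by (auto simp: complex_eq_iff)
    have "cnj (h (cnj z)) = (cnj (f (cnj z)) - cnj (f \<i>)) / (z + \<i>)"
      unfolding h(2)[OF cz] by simp
    moreover have "sharp (U g) z = cnj (g (cnj z)) / u z" for g
      using sharp_u[of z] by (simp add: sharp_def U_def)
    ultimately have eq: "1 / (u z * ((z + \<i>) * E z)) = (sharp (U f) z / E z / (z + \<i>) - sharp (U h) z / E z) / cnj (f \<i>)"
      using alg2[OF u_nz zi(1)[OF z] E_nz[of z], of "cnj (f \<i>)" z "cnj (f (cnj z))"] f(2) z by simp
    show "cmod (1 / (u z * ((z + \<i>) * E z))) \<le> 1 / cmod (f \<i>) * cmod (sharp (U f) z / E z) + 1 / cmod (f \<i>) * cmod (sharp (U h) z / E z)"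
      unfolding eq using dom[OF zi(2)[OF z], of "sharp (U f) z / E z" "sharp (U h) z / E z" "cnj (f \<i>)"]
      unfolding complex_mod_cnj .
  qed auto
qed

text \<open>Once \<gamma> is linear, one of the functions in \<open>H2_upper_quotients\<close> has
  modulus \<open>exp (\<bar>a\<bar> * Im z)\<close> times that of
  \<open>1 / ((z + \<i>) * E z)\<close>. The factor is at least 1, which gives regularity; its
  growth on the imaginary axis gives the bound on the type.\<close>

lemma linear_of_spectrum:
  assumes spec: "spectrum_on N nrm backshift = {0}"
  obtains a :: real where "\<And>z. \<gamma> z = of_real a * z" "regular_HB E" "ereal \<bar>a\<bar> \<le> exp_type E"
proof -
  note G = H2_upper_quotients[OF spec]
  have zi: "z + \<i> \<noteq> 0" if "0 < Im z" for z using that by (auto simp: complex_eq_iff)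
  have "(\<lambda>z. exp (2 * \<i> * \<gamma> z) * (1 / (u z * ((z + \<i>) * E z)))) = (\<lambda>z. u z / ((z + \<i>) * E z))"
    unfolding u_square_exp by auto
  then have uF: "H2_upper (\<lambda>z. exp (2 * \<i> * \<gamma> z) * (1 / (u z * ((z + \<i>) * E z))))" using G(1) by simp
  have nz: "1 / (u z * ((z + \<i>) * E z)) \<noteq> 0" if "0 < Im z" for z using zi[OF that] E_nz[of z] that by simp
  obtain a :: real where a: "\<And>z. \<gamma> z = of_real a * z"
  proof (rule linear_exponent[OF \<gamma>_hol \<gamma>_sharp \<gamma>_0 G(2) nz uF])
    fix a :: real
    assume "\<And>z. \<gamma> z = of_real a * z"
    then show thesis by (rule that)
  qed
  have nu: "cmod (u z) = exp (- a * Im z)" for z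
    by (simp add: u_def a norm_exp_eq_Re)
  have hol: "(\<lambda>z. 1 / ((z + \<i>) * E z)) holomorphic_on {z. 0 < Im z}"
    by (intro holomorphic_intros E_hol) (use zi E_nz in auto)
  have "\<exists>G. H2_upper G \<and> (\<forall>z. 0 < Im z \<longrightarrow> cmod (G z) = exp (\<bar>a\<bar> * Im z) * cmod (1 / ((z + \<i>) * E z)))"
  proof (cases "0 \<le> a")
    case True
    then show ?thesis
      using G(2) by (intro exI[of _ "\<lambda>z. 1 / (u z * ((z + \<i>) * E z))"]) (auto simp: norm_mult norm_divide nu exp_minus divide_simps)
  next
    case False
    then show ?thesis
      using G(1) by (intro exI[of _ "\<lambda>z. u z / ((z + \<i>) * E z)"]) (auto simp: norm_mult norm_divide nu)
  qed
  then obtain G where G: "H2_upper G" and Ge: "\<And>z. 0 < Im z \<Longrightarrow> cmod (G z) = exp (\<bar>a\<bar> * Im z) * cmod (1 / ((z + \<i>) * E z))"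
    by blast
  have "regular_HB E" unfolding regular_HB_def
  proof (rule H2_upper_dominated[OF hol G G, of 1 0])
    fix z assume z: "0 < Im z"
    have "1 * cmod (1 / ((z + \<i>) * E z)) \<le> exp (\<bar>a\<bar> * Im z) * cmod (1 / ((z + \<i>) * E z))"
      using z by (intro mult_right_mono) auto
    then show "cmod (1 / ((z + \<i>) * E z)) \<le> 1 * cmod (G z) + 0 * cmod (G z)"
      using Ge[OF z] by simp
  qed auto
  moreover obtain M where M: "0 < M" "\<And>z. 0 < Im z \<Longrightarrow> cmod (G z) \<le> M / sqrt (Im z)"
    by (rule H2_upper_pointwise[OF G]) blast
  have "ereal \<bar>a\<bar> \<le> exp_type E"
  proof (rule exp_type_lower_bound[OF M(1)])
    fix y :: real assume y: "0 < y"
    show "E (\<i> * of_real y) \<noteq> 0" using E_nz[of "\<i> * of_real y"] y by simp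
    have "cmod (\<i> * of_real y + \<i>) = y + 1" using y by (simp add: cmod_def)
    then show "exp (\<bar>a\<bar> * y) / ((y + 1) * cmod (E (\<i> * of_real y))) \<le> M / sqrt y"
      using M(2)[of "\<i> * of_real y"] Ge[of "\<i> * of_real y"] y by (simp add: norm_mult norm_divide)
  qed
  ultimately show ?thesis using that a by blast
qed

end

section \<open>Assembly of the factor, the unitary map and the two supplements\<close>

theorem theorem4p3:
  fixes N :: "(complex \<Rightarrow> complex) set"
    and ip :: "(complex \<Rightarrow> complex) \<Rightarrow> (complex \<Rightarrow> complex) \<Rightarrow> complex"
  assumes hs: "hilbert_space_entire N ip"
    and nocommon: "\<forall>w. \<exists>f\<in>N. f w \<noteq> 0"
    and eval_bdd: "\<forall>w. \<exists>C. \<forall>f\<in>N. cmod (f w) \<le> C * hs_norm ip f"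
    and div_inv: "\<forall>w. Im w \<noteq> 0 \<longrightarrow> (\<forall>f\<in>N. f w = 0 \<longrightarrow>
        (\<exists>g\<in>N. (\<forall>z. z \<noteq> w \<longrightarrow> g z = (z - cnj w) / (z - w) * f z) \<and>
                hs_norm ip g = hs_norm ip f))"
  shows "\<exists>u E. u holomorphic_on UNIV \<and> (\<forall>z. u z \<noteq> 0) \<and> (\<forall>z. u z * sharp u z = 1) \<and>
     HB E \<and> (\<forall>x::real. E (complex_of_real x) \<noteq> 0) \<and>
     (\<lambda>f. (\<lambda>z. u z * f z)) ` N = deBranges E \<and>
     (\<forall>f\<in>N. deBranges_norm E (\<lambda>z. u z * f z) = hs_norm ip f) \<and>
     ((\<exists>W. HB W \<and> N \<subseteq> deBranges W) \<longrightarrow>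
        (\<exists>\<alpha>::real. u = (\<lambda>z. exp (\<i> * complex_of_real \<alpha> * z)))) \<and>
     ((\<forall>f\<in>N. backshift f \<in> N) \<and> spectrum_on N (hs_norm ip) backshift = {0} \<longrightarrow>
        (\<exists>\<alpha>::real. u = (\<lambda>z. exp (\<i> * complex_of_real \<alpha> * z)) \<and>
           regular_HB E \<and> ereal \<bar>\<alpha>\<bar> \<le> exp_type E))"
proof -
  interpret debranges_like N ip
    by unfold_locales (fact hs nocommon eval_bdd div_inv)+
  obtain \<gamma> where \<gamma>: "\<gamma> holomorphic_on UNIV" "\<gamma> 0 = 0" "sharp \<gamma> = \<gamma>" "\<And>z. exp (2 * \<i> * \<gamma> z) = phase z / phase 0"
    by (rule unimodular_entire_log[OF phase_holomorphic phase_nonzero phase_sharp]) blast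
  interpret debranges_factor N ip \<gamma>
    by unfold_locales (fact \<gamma>)+
  have u_eq: "u = (\<lambda>z. exp (\<i> * complex_of_real a * z))" if "\<And>z. \<gamma> z = of_real a * z" for a
    by (simp add: u_def[abs_def] that mult.assoc)
  show ?thesis
  proof (rule exI[of _ u], rule exI[of _ E], intro conjI allI ballI impI)
    show "u holomorphic_on UNIV" by (rule u_hol)
    show "u z \<noteq> 0" for z by simp
    show "u z * sharp u z = 1" for z by (simp add: sharp_u)
    show "HB E" by (rule HB_E)
    show "E (complex_of_real x) \<noteq> 0" for x by (rule E_nz) simp
    show "(\<lambda>f z. u z * f z) ` N = deBranges E"
      using U_mem U_surj unfolding U_def by blast
    show "deBranges_norm E (\<lambda>z. u z * f z) = nrm f" if "f \<in> N" for f
      using U_norm[OF that] by (simp add: U_def)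
    show "\<exists>\<alpha>. u = (\<lambda>z. exp (\<i> * complex_of_real \<alpha> * z))" if "\<exists>W. HB W \<and> N \<subseteq> deBranges W"
      using that linear_of_subspace u_eq by metis
    show "\<exists>\<alpha>. u = (\<lambda>z. exp (\<i> * complex_of_real \<alpha> * z)) \<and> regular_HB E \<and> ereal \<bar>\<alpha>\<bar> \<le> exp_type E"
      if "(\<forall>f\<in>N. backshift f \<in> N) \<and> spectrum_on N nrm backshift = {0}"
      using that linear_of_spectrum u_eq by metis
  qed
qed

end
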